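(* Let $R$ be an aperiodic random walk on $\mathbb{Z}$ with step $\xi$ satisfying $\mathbb{E}|\xi|^2<\infty$ and $\mathbb{E}\xi=0$, and let $(A_n)$ be the DLA process with respect to $R$, $D_n=\operatorname{diam}A_n$. Fix $\alpha\in(2,3]$ and let $\beta=\frac{2}{\alpha-1}$. \begin{enumerate} \item If $\mathbb{P}(|\xi|>t)\ge c\,t^{-\alpha}$ for some $c>0$ and all $t\ge1$, then almost surely $\limsup_{n\to\infty}n^{-\beta}D_n=\infty$, and almost surely $D_n\ge\frac{n^\beta}{\log\log n}$ for all large enough $n$. \item If one has only $\mathbb{P}(|\xi|>t)\ge t^{-\alpha+o(1)}$ as $t\to\infty$, with $2<\alpha<3$, then almost surely $D_n\ge n^{\beta+o(1)}$ as $n\to\infty$. \end{enumerate}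
   Context: $R=(R_0,R_1,\dots)$ is a random walk on $\mathbb{Z}$ with i.i.d. steps distributed as an integer-valued variable $\xi$; $\mathbb{P}_x$ is its law started at $x$, and $p_{x,y}=\mathbb{P}(\xi=y-x)$. The walk is aperiodic if for all $x,y\in\mathbb{Z}$ there is $n$ with $\mathbb{P}_x(R_n=y)\ne0$. For $A\subset\mathbb{Z}$, $T_A=\min\{n>0:R_n\in A\}$, and $T_x=T_{\{x\}}$. $\operatorname{diam}A=\max A-\min A$. (The walks considered here are recurrent.) For $A\subset\mathbb{Z}$ finite nonempty, $x\notin A$, $a\in A$, the limits $\mathbb{P}_{\pm\infty}(T_x<T_A):=\lim_{y\to\pm\infty}\mathbb{P}_y(T_x<T_A)$ exist; put $\mathbb{P}_\infty(T_x<T_A)=\frac12\big(\mathbb{P}_{+\infty}(T_x<T_A)+\mathbb{P}_{-\infty}(T_x<T_A)\big)$ and define the gluing measure $$\mu(x,a;A)=\frac{p_{x,a}\,\mathbb{P}_\infty(T_x<T_A)}{\mathbb{P}_x(T_A<T_x)}.$$ The DLA process with respect to $R$ is the Markov chain of random finite sets $A_0=\{0\}\subset A_1\subset A_2\subset\cdots$ such that for all $n\ge0$, finite $A\subset\mathbb{Z}$ and $x\in\mathbb{Z}\setminus A$, $\mathbb{P}(A_{n+1}=A\cup\{x\}\mid A_n=A)=\sum_{a\in A}\mu(x,a;A)$. "$D_n\ge n^{\beta+o(1)}$ almost surely" means $\liminf_{n\to\infty}\frac{\log D_n}{\log n}\ge\beta$ almost surely; "$\mathbb{P}(|\xi|>t)\ge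 t^{-\alpha+o(1)}$" means $\liminf_{t\to\infty}\frac{\log\mathbb{P}(|\xi|>t)}{\log t}\ge-\alpha$. *)

theory Defs
  imports "HOL-Probability.Probability"
begin

text \<open>The step \<open>\<xi>\<close> enters only through its distribution, an \<open>int pmf\<close>.\<close>

definition rw_law :: "int pmf \<Rightarrow> int \<Rightarrow> (nat \<Rightarrow> int) measure" where
  "rw_law \<xi> x =
     distr (PiM UNIV (\<lambda>_::nat. measure_pmf \<xi>)) (PiM UNIV (\<lambda>_::nat. count_space UNIV))
       (\<lambda>s n. x + (\<Sum>i<n. s i))"

text \<open>This is irreducibility (Spitzer's terminology); it does not exclude a period in time.\<close>

definition aperiodic_walk :: "int pmf \<Rightarrow> bool" where
  "aperiodic_walk \<xi> \<longleftrightarrow> (\<forall>x y. \<exists>n. \<P>(R in rw_law \<xi> x. R n = y) \<noteq> 0)"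

text \<open>The infimum of the empty set is \<open>\<infinity>\<close> in \<^typ>\<open>enat\<close>. Time \<open>0\<close> does not count.\<close>

definition hitting_time :: "int set \<Rightarrow> (nat \<Rightarrow> int) \<Rightarrow> enat" where
  "hitting_time A R = Inf (enat ` {n. n > 0 \<and> R n \<in> A})"

definition hit_before :: "int pmf \<Rightarrow> int \<Rightarrow> int set \<Rightarrow> int set \<Rightarrow> real" where
  "hit_before \<xi> y B A = \<P>(R in rw_law \<xi> y. hitting_time B R < hitting_time A R)"

definition hit_before_infinity :: "int pmf \<Rightarrow> int set \<Rightarrow> int set \<Rightarrow> real" where
  "hit_before_infinity \<xi> B A =
     (Lim at_top (\<lambda>y::int. hit_before \<xi> y B A) + Lim at_bot (\<lambda>y::int. hit_before \<xi> y B A)) / 2"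

definition gluing :: "int pmf \<Rightarrow> int \<Rightarrow> int \<Rightarrow> int set \<Rightarrow> real" where
  "gluing \<xi> x a A = pmf \<xi> (a - x) * hit_before_infinity \<xi> {x} A / hit_before \<xi> x A {x}"

text \<open>
  The last two conjuncts are the Markov property with respect to the past of the process and the
  one-step transition probabilities. Conditioning on a null event is excluded, because
  \<open>cond_prob\<close> is then \<open>0\<close> by convention.
\<close>

definition DLA_process :: "int pmf \<Rightarrow> 'w measure \<Rightarrow> (nat \<Rightarrow> 'w \<Rightarrow> int set) \<Rightarrow> bool" where
  "DLA_process \<xi> M A \<longleftrightarrow>
     prob_space M \<and>
     (\<forall>n. A n \<in> measurable M (count_space {S. finite S})) \<and>
     (AE \<omega> in M. A 0 \<omega> = {0}) \<and>
     (AE \<omega> in M. \<forall>n. A n \<omega> \<subseteq> A (Suc n) \<omega>) \<and>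
     (\<forall>n B C. \<P>(\<omega> in M. \<forall>i\<le>n. A i \<omega> = B i) \<noteq> 0 \<longrightarrow>
        \<P>(\<omega> in M. A (Suc n) \<omega> = C \<bar> \<forall>i\<le>n. A i \<omega> = B i) =
        \<P>(\<omega> in M. A (Suc n) \<omega> = C \<bar> A n \<omega> = B n)) \<and>
     (\<forall>n S x. finite S \<longrightarrow> x \<notin> S \<longrightarrow> \<P>(\<omega> in M. A n \<omega> = S) \<noteq> 0 \<longrightarrow>
        \<P>(\<omega> in M. A (Suc n) \<omega> = insert x S \<bar> A n \<omega> = S) = (\<Sum>a\<in>S. gluing \<xi> x a S))"

definition diam :: "int set \<Rightarrow> int" where
  "diam A = Max A - Min A"

text \<open>
  The logarithm of a nonnegative real, with \<open>log 0 = -\<infinity>\<close>. With the library value \<open>ln 0 = 0\<close>, a step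
  with bounded support would satisfy \<open>tail_at_least\<close> for every \<open>\<alpha> \<ge> 0\<close>.
\<close>

definition elog :: "real \<Rightarrow> ereal" where
  "elog x = (if x = 0 then -\<infinity> else ereal (ln x))"

definition tail :: "int pmf \<Rightarrow> real \<Rightarrow> real" where
  "tail \<xi> t = \<P>(k in measure_pmf \<xi>. \<bar>real_of_int k\<bar> > t)"

text \<open>\<open>P(|\<xi>| > t) \<ge> t\<^bsup>-\<alpha>+o(1)\<^esup>\<close> as \<open>t \<rightarrow> \<infinity>\<close>\<close>

definition tail_at_least :: "int pmf \<Rightarrow> real \<Rightarrow> bool" where
  "tail_at_least \<xi> \<alpha> \<longleftrightarrow> Liminf at_top (\<lambda>t::real. elog (tail \<xi> t) / ereal (ln t)) \<ge> ereal (- \<alpha>)"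

text \<open>\<open>d\<^sub>n \<ge> n\<^bsup>\<beta>+o(1)\<^esup>\<close> as \<open>n \<rightarrow> \<infinity>\<close>\<close>

definition growth_at_least :: "(nat \<Rightarrow> real) \<Rightarrow> real \<Rightarrow> bool" where
  "growth_at_least d \<beta> \<longleftrightarrow> liminf (\<lambda>n. elog (d n) / ereal (ln (real n))) \<ge> ereal \<beta>"

end

theory Submission
  imports Defs "HOL-Real_Asymp.Real_Asymp"
begin

text \<open>
  Write \<open>h\<close> for the probability that the walk hits \<open>x\<close> before \<open>S\<close>. Since \<open>|y|\<close> is subharmonic with
  summable excess \<open>E|y + \<xi>| - |y|\<close>, and the Green function of the walk killed at its starting point
  is at most \<open>1\<close>, the escape probability from \<open>x\<close> to a set at distance \<open>m\<close> is \<open>O(1/m)\<close>; letting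
  \<open>m \<rightarrow> \<infinity>\<close> also gives recurrence. A finite second moment makes the undershoot at the first entrance
  of a half line tight, uniformly in the starting point. As \<open>h(y + 1) - h(y) \<rightarrow> 0\<close>, tightness implies
  that \<open>h\<close> has limits at \<open>\<plusminus>\<infinity>\<close>, and that one of them is at least \<open>1/2\<close> if \<open>x\<close> lies far to one side of
  \<open>S\<close>. Hence \<open>\<mu>(x, a; S) \<ge> c m p\<^bsub>x,a\<^esub>\<close> for such \<open>x\<close>, and the diameter of \<open>A\<^sub>n\<close> grows by \<open>m\<close> in
  one step with probability at least \<open>c m |A\<^sub>n| P(|\<xi>| > diam A\<^sub>n + m)\<close>, where \<open>|A\<^sub>n| \<ge> \<kappa> n\<close>
  eventually. While \<open>diam A\<^sub>i \<le> L\<close> this is of order \<open>i L\<^bsup>1-\<alpha>\<^esup>\<close>, so a diameter far below \<open>n\<^bsup>\<beta>\<^esup>\<close> cannot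
  persist over a dyadic block of times.
\<close>

section \<open>Hitting probabilities and iterated averages\<close>

text \<open>The exponent comes from a balance. At times up to \<open>n\<close> with diameter below
  \<open>L\<close>, the one-step chances of a jump of size \<open>L\<close> add up to order
  \<open>n^2 * L powr (1 - \<alpha>)\<close>, which is of order one exactly at
  \<open>L = n powr \<beta>\<close>. With the moving barrier \<open>K * i powr \<beta>\<close> the
  chance at time \<open>i\<close> is of order \<open>1 / i\<close>, and this borderline divergence,
  valid for every \<open>K\<close>, yields the infinite limsup. The obstacle is uniformity in the
  shape of the aggregate: the bounds may depend on the set only through its distance from the
  attached point, its diameter and its cardinality. So the constants for the walk are fixed before
  the set is chosen. Estimates are first made for a finite horizon, by induction over one-step
  averages of functions with values in \<open>ennreal\<close>. This replaces stopping times, the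
  strong Markov property and integrability questions by an algebra of positive operators; the
  horizon goes to infinity only at the end, where recurrence removes the term for paths that have
  not stopped yet.\<close>

definition step_mean :: "int pmf \<Rightarrow> (int \<Rightarrow> ennreal) \<Rightarrow> int \<Rightarrow> ennreal" where
  "step_mean \<xi> f y = (\<integral>\<^sup>+k. f (y + k) \<partial>measure_pmf \<xi>)"

text \<open>The horizon \<open>n\<close> makes the probability a finite iteration of averages.
  \<open>A\<close> is tested before \<open>B\<close>, so a common point counts for \<open>A\<close>,
  as the strict inequality of hitting times demands; the start is not tested because time 0 does not
  count.\<close>

primrec hit_within :: "int pmf \<Rightarrow> int set \<Rightarrow> int set \<Rightarrow> nat \<Rightarrow> int \<Rightarrow> ennreal" where
  "hit_within \<xi> B A 0 y = 0"
| "hit_within \<xi> B A (Suc n) y =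
     step_mean \<xi> (\<lambda>z. if z \<in> A then 0 else if z \<in> B then 1 else hit_within \<xi> B A n z) y"

abbreviation steps :: "int pmf \<Rightarrow> (nat \<Rightarrow> int) measure" where
  "steps \<xi> \<equiv> PiM UNIV (\<lambda>_::nat. measure_pmf \<xi>)"

definition walk :: "int \<Rightarrow> (nat \<Rightarrow> int) \<Rightarrow> nat \<Rightarrow> int" where
  "walk x s n = x + (\<Sum>i<n. s i)"

definition hits_by :: "int set \<Rightarrow> int set \<Rightarrow> nat \<Rightarrow> (nat \<Rightarrow> int) \<Rightarrow> bool" where
  "hits_by B A n R \<longleftrightarrow> (\<exists>i\<in>{1..n}. R i \<in> B \<and> (\<forall>j\<in>{1..i}. R j \<notin> A))"

lemma walk_0 [simp]: "walk x s 0 = x"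
  by (simp add: walk_def)

lemma walk_case_nat: "walk x (case_nat k s) (Suc n) = walk (x + k) s n"
  by (simp add: walk_def sum.lessThan_Suc_shift del: sum.lessThan_Suc)

lemma hits_by_Suc:
  "hits_by B A (Suc n) R \<longleftrightarrow>
     R 1 \<notin> A \<and> (R 1 \<in> B \<or> hits_by B A n (\<lambda>i. R (Suc i)))"
proof
  assume "hits_by B A (Suc n) R"
  then obtain i where i: "i \<in> {1..Suc n}" "R i \<in> B" "\<And>j. j \<in> {1..i} \<Longrightarrow> R j \<notin> A"
    by (auto simp: hits_by_def)
  show "R 1 \<notin> A \<and> (R 1 \<in> B \<or> hits_by B A n (\<lambda>i. R (Suc i)))"
  proof (cases "i = 1")
    case True
    then show ?thesis using i by auto
  next
    case False
    with i have "i - 1 \<in> {1..n}" "R (Suc (i - 1)) \<in> B" "\<forall>j\<in>{1..i-1}. R (Suc j) \<notin> A" "R 1 \<notin> A"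
      by auto
    then show ?thesis unfolding hits_by_def by blast
  qed
next
  assume *: "R 1 \<notin> A \<and> (R 1 \<in> B \<or> hits_by B A n (\<lambda>i. R (Suc i)))"
  show "hits_by B A (Suc n) R"
  proof (cases "R 1 \<in> B")
    case True
    with * show ?thesis by (auto simp: hits_by_def intro!: bexI[of _ 1])
  next
    case False
    with * obtain i where i: "i \<in> {1..n}" "R (Suc i) \<in> B" "\<And>j. j \<in> {1..i} \<Longrightarrow> R (Suc j) \<notin> A"
      by (auto simp: hits_by_def)
    have "R j \<notin> A" if "j \<in> {1..Suc i}" for j
      using i(3)[of "j - 1"] * that
          by (smt (verit) One_nat_def Suc_pred atLeastAtMost_iff le_SucE le_neq_implies_less
          less_Suc0 not_less_eq_eq zero_less_iff_neq_zero Suc_le_mono diff_Suc_1 nat.exhaust)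
    with i show ?thesis unfolding hits_by_def by (intro bexI[of _ "Suc i"]) auto
  qed
qed

lemma hits_by_mono: "hits_by B A m R \<Longrightarrow> m \<le> n \<Longrightarrow> hits_by B A n R"
  by (force simp: hits_by_def)

text \<open>Replaces the infima by a countable union of finite-horizon events, which gives both
  measurability and approximation from below by \<open>hit_within\<close>.\<close>

lemma hitting_time_less_iff:
  "hitting_time B R < hitting_time A R \<longleftrightarrow> (\<exists>n. hits_by B A n R)"
proof
  assume less: "hitting_time B R < hitting_time A R"
  then have ne: "enat ` {n. n > 0 \<and> R n \<in> B} \<noteq> {}"
    unfolding hitting_time_def by (metis Inf_empty not_top_less)
  have "hitting_time B R \<in> enat ` {n. n > 0 \<and> R n \<in> B}"
    unfolding hitting_time_def using ne by (meson wellorder_InfI ex_in_conv)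
  then obtain i where i: "hitting_time B R = enat i" "i > 0" "R i \<in> B" by auto
  have "R j \<notin> A" if "j \<in> {1..i}" for j
  proof
    assume "R j \<in> A"
    with that have "hitting_time A R \<le> enat j"
      unfolding hitting_time_def by (intro Inf_lower) auto
    also have "\<dots> \<le> hitting_time B R" using that i by simp
    finally show False using less by simp
  qed
  with i show "\<exists>n. hits_by B A n R"
    by (auto simp: hits_by_def intro!: exI[of _ i] bexI[of _ i])
next
  assume "\<exists>n. hits_by B A n R"
  then obtain i where i: "i > 0" "R i \<in> B" "\<And>j. j \<in> {1..i} \<Longrightarrow> R j \<notin> A"
    unfolding hits_by_def by (metis Suc_le_eq atLeastAtMost_iff One_nat_def)
  have "hitting_time B R \<le> enat i"
    unfolding hitting_time_def using i by (intro Inf_lower) auto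
  also have "enat i < enat (Suc i)" by simp
  also have "\<dots> \<le> hitting_time A R"
    unfolding hitting_time_def
  proof (intro Inf_greatest, clarsimp)
    fix j assume "0 < j" "R j \<in> A"
    then show "Suc i \<le> j" using i(3)[of j] by (cases "j \<le> i") auto
  qed
  finally show "hitting_time B R < hitting_time A R" .
qed

lemma walk_Suc: "walk x s (Suc n) = walk x s n + s n"
  by (simp add: walk_def)

lemma walk_measurable [measurable]: "walk x \<in> steps \<xi> \<rightarrow>\<^sub>M PiM UNIV (\<lambda>_. count_space UNIV)"
proof (rule measurable_PiM_single'[where f = "\<lambda>n s. walk x s n"])
  have comp [measurable]: "(\<lambda>s. s i) \<in> steps \<xi> \<rightarrow>\<^sub>M count_space UNIV" for i
  proof -
    have "(\<lambda>s. s i) \<in> steps \<xi> \<rightarrow>\<^sub>M measure_pmf \<xi>" by measurable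
    then show ?thesis by (simp add: measurable_cong_sets)
  qed
  show "(\<lambda>s. walk x s n) \<in> steps \<xi> \<rightarrow>\<^sub>M count_space UNIV" for n
  proof (induction n)
    case (Suc n)
    have "(\<lambda>p. fst p + snd p) \<in>
        count_space (UNIV :: int set) \<Otimes>\<^sub>M count_space UNIV \<rightarrow>\<^sub>M count_space UNIV"
      by (simp add: pair_measure_countable)
    from measurable_compose[OF measurable_Pair[OF Suc comp] this]
    show ?case by (simp add: walk_Suc)
  qed simp
qed (simp add: space_PiM PiE_def extensional_def)

lemma hits_by_measurable [measurable]:
  "Measurable.pred (PiM UNIV (\<lambda>_. count_space UNIV)) (hits_by B A n)"
  unfolding hits_by_def by measurable

lemma rw_law_eq: "rw_law \<xi> x = distr (steps \<xi>) (PiM UNIV (\<lambda>_. count_space UNIV)) (walk x)"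
  unfolding rw_law_def walk_def ..

text \<open>First-step analysis: \<open>PiM_iter\<close> splits off the first increment
  \<open>k\<close>, and the remaining increments drive a walk started at
  \<open>y + k\<close>.\<close>

lemma emeasure_hits_by:
  "emeasure (steps \<xi>) {s \<in> space (steps \<xi>). hits_by B A n (walk y s)} = hit_within \<xi> B A n y"
proof (induction n arbitrary: y)
  case 0
  then show ?case by (simp add: hits_by_def)
next
  case (Suc n)
  interpret sequence_space "measure_pmf \<xi>" ..
  have eq: "indicator {s \<in> space (steps \<xi>). hits_by B A (Suc n) (walk y s)} (case_nat k s) =
      (if y + k \<in> A then 0 else if y + k \<in> B then 1
       else indicator {s \<in> space (steps \<xi>). hits_by B A n (walk (y + k) s)} s :: ennreal)" for k s
    using hits_by_Suc[of B A n "walk y (case_nat k s)"]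
    by (auto simp: space_PiM walk_case_nat indicator_def)
  have [measurable]: "{s \<in> space (steps \<xi>). hits_by B A n (walk y s)} \<in> sets (steps \<xi>)" for y n
    by measurable
  have "emeasure (steps \<xi>) {s \<in> space (steps \<xi>). hits_by B A (Suc n) (walk y s)}
     = (\<integral>\<^sup>+s. indicator {s \<in> space (steps \<xi>). hits_by B A (Suc n) (walk y s)} s
          \<partial>distr (measure_pmf \<xi> \<Otimes>\<^sub>M steps \<xi>) (steps \<xi>) (\<lambda>(s, \<omega>). case_nat s \<omega>))"
    by (subst PiM_iter) simp
  also have "\<dots> = (\<integral>\<^sup>+p. indicator {s \<in> space (steps \<xi>). hits_by B A (Suc n) (walk y s)}
      (case_nat (fst p) (snd p)) \<partial>(measure_pmf \<xi> \<Otimes>\<^sub>M steps \<xi>))"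
    by (subst nn_integral_distr) (auto simp: case_prod_beta)
  also have "\<dots> = (\<integral>\<^sup>+k. \<integral>\<^sup>+s. indicator {s \<in> space (steps \<xi>). hits_by B A (Suc n) (walk y s)}
      (case_nat k s) \<partial>steps \<xi> \<partial>measure_pmf \<xi>)"
    by (subst P.nn_integral_fst[symmetric]) auto
  also have "\<dots> = hit_within \<xi> B A (Suc n) y"
    by (auto simp: eq step_mean_def Suc.IH[symmetric] P.emeasure_space_1 intro!: nn_integral_cong)
  finally show ?case .
qed

lemma incseq_hit_within: "incseq (\<lambda>n. hit_within \<xi> B A n y)"
  unfolding emeasure_hits_by[symmetric]
  by (intro incseq_SucI emeasure_mono) (auto intro: hits_by_mono)

lemma hit_before_conv_SUP: "ennreal (hit_before \<xi> y B A) = (SUP n. hit_within \<xi> B A n y)"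
proof -
  interpret sequence_space "measure_pmf \<xi>" ..
  let ?E = "\<lambda>n. {s \<in> space (steps \<xi>). hits_by B A n (walk y s)}"
  have "Measurable.pred (PiM UNIV (\<lambda>_. count_space UNIV)) (\<lambda>R. \<exists>n. hits_by B A n R)"
    by measurable
  then have m: "{R. \<exists>n. hits_by B A n R} \<in> sets (PiM UNIV (\<lambda>_. count_space UNIV))"
    by (simp add: pred_def space_PiM)
  interpret L: prob_space "rw_law \<xi> y"
    unfolding rw_law_eq by (intro prob_space_distr) auto
  have "ennreal (hit_before \<xi> y B A) =
      emeasure (rw_law \<xi> y) {R \<in> space (rw_law \<xi> y). \<exists>n. hits_by B A n R}"
    unfolding hit_before_def hitting_time_less_iff by (simp add: L.emeasure_eq_measure)
  also have "\<dots> = emeasure (steps \<xi>) {s \<in> space (steps \<xi>). \<exists>n. hits_by B A n (walk y s)}"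
    unfolding rw_law_eq using m
    by (subst emeasure_distr) (auto simp: space_PiM intro!: arg_cong2[where f=emeasure])
  also have "{s \<in> space (steps \<xi>). \<exists>n. hits_by B A n (walk y s)} = (\<Union>n. ?E n)" by auto
  also have "emeasure (steps \<xi>) \<dots> = (SUP n. emeasure (steps \<xi>) (?E n))"
    by (intro SUP_emeasure_incseq[symmetric])
      (auto intro!: incseq_SucI intro: hits_by_mono)
  finally show ?thesis by (simp add: emeasure_hits_by)
qed

lemma hit_before_nonneg: "0 \<le> hit_before \<xi> y B A"
  by (simp add: hit_before_def)

lemma hit_before_le_1: "hit_before \<xi> y B A \<le> 1"
proof -
  interpret sequence_space "measure_pmf \<xi>" ..
  interpret L: prob_space "rw_law \<xi> y"
    unfolding rw_law_eq by (intro prob_space_distr) auto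
  show ?thesis unfolding hit_before_def by (rule L.prob_le_1)
qed

text \<open>Paths are replaced by a closure principle, which is all that is used of irreducibility.\<close>

definition irreducible_steps :: "int pmf \<Rightarrow> bool" where
  "irreducible_steps \<xi> \<longleftrightarrow>
     (\<forall>Q x y. Q x \<longrightarrow> (\<forall>z k. Q z \<longrightarrow> k \<in> set_pmf \<xi> \<longrightarrow> Q (z + k)) \<longrightarrow> Q y)"

lemma irreducible_closure:
  assumes "irreducible_steps \<xi>" "Q x" "\<And>z k. Q z \<Longrightarrow> k \<in> set_pmf \<xi> \<Longrightarrow> Q (z + k)"
  shows "Q y"
  using assms unfolding irreducible_steps_def by blast

lemma irreducible_steps_reflect:
  assumes "irreducible_steps \<xi>"
  shows "irreducible_steps (map_pmf uminus \<xi>)"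
  unfolding irreducible_steps_def
proof (intro allI impI)
  fix Q :: "int \<Rightarrow> bool" and x y
  assume Q: "Q x" "\<forall>z k. Q z \<longrightarrow> k \<in> set_pmf (map_pmf uminus \<xi>) \<longrightarrow> Q (z + k)"
  have "Q (- (- y))"
  proof (rule irreducible_closure[OF assms, where Q = "\<lambda>z. Q (- z)" and x = "- x"])
    fix z k assume "Q (- z)" "k \<in> set_pmf \<xi>"
    then have "Q (- z + - k)" using Q(2) by (auto simp del: add_uminus_conv_diff)
    then show "Q (- (z + k))" by simp
  qed (use Q in simp)
  then show "Q y" by simp
qed

text \<open>Almost every step sequence stays in the support of \<open>\<xi>\<close>, so an event of
  positive probability contains a path with all steps in the support, and \<open>Q\<close> is
  carried along this path.\<close>

lemma aperiodic_walk_imp_irreducible_steps: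
  assumes "aperiodic_walk \<xi>"
  shows "irreducible_steps \<xi>"
  unfolding irreducible_steps_def
proof (intro allI impI)
  fix Q :: "int \<Rightarrow> bool" and x y
  assume Q: "Q x" "\<forall>z k. Q z \<longrightarrow> k \<in> set_pmf \<xi> \<longrightarrow> Q (z + k)"
  interpret sequence_space "measure_pmf \<xi>" ..
  obtain n where n: "\<P>(R in rw_law \<xi> x. R n = y) \<noteq> 0"
    using assms unfolding aperiodic_walk_def by blast
  have "\<P>(R in rw_law \<xi> x. R n = y) = \<P>(s in steps \<xi>. walk x s n = y)"
  proof -
    have "Measurable.pred (PiM UNIV (\<lambda>_. count_space UNIV)) (\<lambda>R::nat \<Rightarrow> int. R n = y)"
      by measurable
    then have "{R::nat \<Rightarrow> int. R n = y} \<in> sets (PiM UNIV (\<lambda>_. count_space UNIV))"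
      by (simp add: pred_def space_PiM)
    then show ?thesis
      unfolding rw_law_eq
      by (subst measure_distr) (auto simp: space_PiM intro!: arg_cong2[where f=measure])
  qed
  with n have ne: "\<P>(s in steps \<xi>. walk x s n = y) \<noteq> 0" by simp
  have "AE s in steps \<xi>. s i \<in> set_pmf \<xi>" for i
    by (rule AE_component) (auto simp: AE_measure_pmf)
  then have ae: "AE s in steps \<xi>. \<forall>i. s i \<in> set_pmf \<xi>" by (simp add: AE_all_countable)
  have "\<exists>s. walk x s n = y \<and> (\<forall>i. s i \<in> set_pmf \<xi>)"
  proof (rule ccontr)
    assume "\<not> ?thesis"
    then have "AE s in steps \<xi>. s \<notin> {s \<in> space (steps \<xi>). walk x s n = y}"
      using ae by (auto elim!: AE_mp)
    then have "emeasure (steps \<xi>) {s \<in> space (steps \<xi>). walk x s n = y} = 0"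
      by (subst AE_iff_measurable[symmetric, where P="\<lambda>s. s \<notin> {s \<in> space (steps \<xi>). walk x s n =
          y}"])
         auto
    with ne show False by (simp add: measure_def)
  qed
  then obtain s where s: "walk x s n = y" "\<And>i. s i \<in> set_pmf \<xi>" by blast
  have "Q (walk x s i)" for i
  proof (induction i)
    case (Suc i)
    with Q(2) s(2) show ?case by (simp add: walk_Suc)
  qed (use Q(1) in simp)
  with s(1) show "Q y" by metis
qed

section \<open>Green functions of killed walks\<close>

definition killed_mean :: "int pmf \<Rightarrow> int set \<Rightarrow> (int \<Rightarrow> ennreal) \<Rightarrow> int \<Rightarrow> ennreal" where
  "killed_mean \<xi> W f = step_mean \<xi> (\<lambda>z. indicator W z * f z)"

text \<open>Expected sum of \<open>f\<close> over the first \<open>n\<close> positions of the walk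
  from \<open>y\<close> killed on leaving \<open>W\<close>. The starting point is counted even if it
  lies outside \<open>W\<close>, which permits killing at the starting point itself.\<close>

definition green :: "int pmf \<Rightarrow> int set \<Rightarrow> nat \<Rightarrow> (int \<Rightarrow> ennreal) \<Rightarrow> int \<Rightarrow> ennreal" where
  "green \<xi> W n f y = (\<Sum>i<n. (killed_mean \<xi> W ^^ i) f y)"

lemma step_mean_mono: "(\<And>z. f z \<le> g z) \<Longrightarrow> step_mean \<xi> f y \<le> step_mean \<xi> g y"
  unfolding step_mean_def by (intro nn_integral_mono) auto

lemma step_mean_add: "step_mean \<xi> (\<lambda>z. f z + g z) y = step_mean \<xi> f y + step_mean \<xi> g y"
  unfolding step_mean_def by (subst nn_integral_add) auto

lemma step_mean_cmult: "step_mean \<xi> (\<lambda>z. c * f z) y = c * step_mean \<xi> f y"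
  unfolding step_mean_def by (subst nn_integral_cmult) auto

lemma step_mean_const: "step_mean \<xi> (\<lambda>z. c) y = c"
  unfolding step_mean_def by (simp add: measure_pmf.emeasure_space_1)

lemma step_mean_ge: "ennreal (pmf \<xi> k) * f (y + k) \<le> step_mean \<xi> f y"
proof -
  have "ennreal (pmf \<xi> k) * f (y + k) = (\<integral>\<^sup>+j. f (y + k) * indicator {k} j \<partial>measure_pmf \<xi>)"
    by (simp add: nn_integral_cmult emeasure_pmf_single mult.commute)
  also have "\<dots> \<le> step_mean \<xi> f y"
    unfolding step_mean_def by (intro nn_integral_mono) (auto simp: indicator_def)
  finally show ?thesis .
qed

lemma killed_mean_mono:
  "(\<And>z. f z \<le> g z) \<Longrightarrow> V \<subseteq> W \<Longrightarrow> killed_mean \<xi> V f y \<le> killed_mean \<xi> W g y"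
  unfolding killed_mean_def by (intro step_mean_mono mult_mono) (auto simp: indicator_def)

lemma killed_mean_add:
  "killed_mean \<xi> W (\<lambda>z. f z + g z) y = killed_mean \<xi> W f y + killed_mean \<xi> W g y"
  unfolding killed_mean_def by (simp add: distrib_left step_mean_add)

lemma killed_mean_cmult: "killed_mean \<xi> W (\<lambda>z. c * f z) y = c * killed_mean \<xi> W f y"
  unfolding killed_mean_def by (simp add: mult.left_commute[of _ c] step_mean_cmult)

lemma killed_mean_0: "killed_mean \<xi> W (\<lambda>z. 0) y = 0"
  unfolding killed_mean_def by (simp add: step_mean_const)

lemma killed_mean_le: "killed_mean \<xi> W f y \<le> step_mean \<xi> f y"
  unfolding killed_mean_def by (intro step_mean_mono) (auto simp: indicator_def)

lemma killed_mean_pow_mono: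
  "(\<And>z. f z \<le> g z) \<Longrightarrow> V \<subseteq> W \<Longrightarrow> (killed_mean \<xi> V ^^ n) f y \<le> (killed_mean \<xi> W ^^ n) g y"
  by (induction n arbitrary: y) (auto intro!: killed_mean_mono)

lemma killed_mean_pow_add: "(killed_mean \<xi> W ^^ n) (\<lambda>z. f z + g z) y =
   (killed_mean \<xi> W ^^ n) f y + (killed_mean \<xi> W ^^ n) g y"
proof (induction n arbitrary: y)
  case (Suc n)
  then have "(killed_mean \<xi> W ^^ n) (\<lambda>z. f z + g z) =
     (\<lambda>z. (killed_mean \<xi> W ^^ n) f z + (killed_mean \<xi> W ^^ n) g z)" by (simp add: fun_eq_iff)
  then show ?case by (simp add: killed_mean_add)
qed simp

lemma killed_mean_pow_cmult: "(killed_mean \<xi> W ^^ n) (\<lambda>z. c * f z) y =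
   c * (killed_mean \<xi> W ^^ n) f y"
proof (induction n arbitrary: y)
  case (Suc n)
  then have "(killed_mean \<xi> W ^^ n) (\<lambda>z. c * f z) =
     (\<lambda>z. c * (killed_mean \<xi> W ^^ n) f z)" by (simp add: fun_eq_iff)
  then show ?case by (simp add: killed_mean_cmult)
qed simp

lemma green_0 [simp]: "green \<xi> W 0 f y = 0"
  by (simp add: green_def)

lemma green_Suc: "green \<xi> W (Suc n) f y = f y + green \<xi> W n (killed_mean \<xi> W f) y"
  unfolding green_def
  by (simp add: sum.lessThan_Suc_shift funpow_Suc_right del: sum.lessThan_Suc funpow.simps)

text \<open>Here the operator is split off on the outside, which is the first-step decomposition;
  \<open>green_Suc\<close> puts it on the function, for inductions that vary
  \<open>f\<close>.\<close>

lemma green_Suc': "green \<xi> W (Suc n) f y = f y + killed_mean \<xi> W (green \<xi> W n f) y"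
proof (induction n arbitrary: f y)
  case 0
  have "green \<xi> W 0 f = (\<lambda>z. 0)" by (simp add: fun_eq_iff)
  then show ?case by (simp add: green_Suc killed_mean_0)
next
  case (Suc n)
  have "green \<xi> W (Suc n) f = (\<lambda>z. f z + green \<xi> W n (killed_mean \<xi> W f) z)"
    by (simp add: green_Suc fun_eq_iff)
  then have "killed_mean \<xi> W (green \<xi> W (Suc n) f) y =
     killed_mean \<xi> W f y + killed_mean \<xi> W (green \<xi> W n (killed_mean \<xi> W f)) y"
    by (simp only: killed_mean_add)
  then show ?case
    unfolding green_Suc[of \<xi> W "Suc n" f y] Suc.IH by simp
qed

text \<open>Decomposition by the last position before the entrance into \<open>B\<close>: up to then
  the walk has survived outside \<open>A \<union> B\<close>, and its next step leads into
  \<open>B - A\<close>.\<close>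

lemma hit_within_eq_green:
  "hit_within \<xi> B A n y = green \<xi> (- (A \<union> B)) n (step_mean \<xi> (indicator (B - A))) y"
proof (induction n arbitrary: y)
  case (Suc n)
  have eq: "(\<lambda>z. if z \<in> A then 0 else if z \<in> B then 1 else hit_within \<xi> B A n z) =
    (\<lambda>z. indicator (B - A) z + indicator (- (A \<union> B)) z * hit_within \<xi> B A n z)"
    by (auto simp: fun_eq_iff)
  have "hit_within \<xi> B A n = green \<xi> (- (A \<union> B)) n (step_mean \<xi> (indicator (B - A)))"
    using Suc.IH by (simp add: fun_eq_iff)
  then show ?case
    unfolding hit_within.simps eq step_mean_add green_Suc' killed_mean_def by simp
qed simp

section \<open>Invariance of counting measure and bounds for Green functions\<close>

lemma nn_integral_count_pmf_swap:
  "(\<integral>\<^sup>+y. (\<integral>\<^sup>+k. f y k \<partial>measure_pmf \<xi>) \<partial>count_space UNIV) =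
   (\<integral>\<^sup>+k. (\<integral>\<^sup>+y. f y k \<partial>count_space UNIV) \<partial>measure_pmf \<xi>)"
  using nn_integral_fst_count_space[of "\<lambda>(y, k). ennreal (pmf \<xi> k) * f y k"]
    nn_integral_snd_count_space[of "\<lambda>(y, k). ennreal (pmf \<xi> k) * f y k"]
  by (simp add: nn_integral_measure_pmf nn_integral_cmult)

lemma nn_integral_count_shift:
  "(\<integral>\<^sup>+y. f (y + k) \<partial>count_space UNIV) = (\<integral>\<^sup>+y. f y \<partial>count_space (UNIV :: int set))"
  by (rule nn_integral_bij_count_space)
     (auto simp: bij_betw_def inj_on_def surj_def intro: exI[of _ "_ - k"])

lemma sum_step_mean:
  "(\<integral>\<^sup>+y. step_mean \<xi> f y \<partial>count_space UNIV) = (\<integral>\<^sup>+y. f y \<partial>count_space UNIV)"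
proof -
  have "(\<integral>\<^sup>+k. (\<integral>\<^sup>+y. f (y + k) \<partial>count_space UNIV) \<partial>measure_pmf \<xi>) =
    (\<integral>\<^sup>+k. (\<integral>\<^sup>+y. f y \<partial>count_space UNIV) \<partial>measure_pmf \<xi>)"
    by (intro nn_integral_cong nn_integral_count_shift)
  then show ?thesis
    unfolding step_mean_def nn_integral_count_pmf_swap
    by (simp add: measure_pmf.emeasure_space_1)
qed

lemma nn_integral_count_insert:
  "x \<notin> W \<Longrightarrow> f x + (\<integral>\<^sup>+y. indicator W y * f y \<partial>count_space UNIV) =
    (\<integral>\<^sup>+y. indicator (insert x W) y * f y \<partial>count_space UNIV)"
proof -
  assume x: "x \<notin> W"
  have "f x = (\<integral>\<^sup>+y. indicator {x} y * f y \<partial>count_space UNIV)"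
    by (subst mult.commute) (simp add: nn_integral_indicator_singleton)
  then have "f x + (\<integral>\<^sup>+y. indicator W y * f y \<partial>count_space UNIV) =
     (\<integral>\<^sup>+y. indicator {x} y * f y \<partial>count_space UNIV) +
     (\<integral>\<^sup>+y. indicator W y * f y \<partial>count_space UNIV)" by simp
  also have "\<dots> = (\<integral>\<^sup>+y. indicator {x} y * f y + indicator W y * f y \<partial>count_space UNIV)"
    by (subst nn_integral_add) auto
  also have "\<dots> = (\<integral>\<^sup>+y. indicator (insert x W) y * f y \<partial>count_space UNIV)"
    using x by (intro nn_integral_cong) (auto simp: indicator_def)
  finally show ?thesis .
qed

text \<open>Duality: the assumption, tested against all functions, says that the measure
  \<open>v\<close> dominates the point mass at 0 plus its own image under the killed step. By
  iteration \<open>v\<close> dominates the occupation measure of the killed walk from 0, for every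
  horizon.\<close>

lemma green_le_supersolution:
  assumes "\<And>\<rho>. \<rho> 0 + (\<integral>\<^sup>+y. v y * killed_mean \<xi> W \<rho> y \<partial>count_space UNIV)
             \<le> (\<integral>\<^sup>+y. v y * \<rho> y \<partial>count_space UNIV)"
  shows "green \<xi> W n \<rho> 0 \<le> (\<integral>\<^sup>+y. v y * \<rho> y \<partial>count_space UNIV)"
proof (induction n arbitrary: \<rho>)
  case (Suc n)
  have "green \<xi> W (Suc n) \<rho> 0 \<le> \<rho> 0 + (\<integral>\<^sup>+y. v y * killed_mean \<xi> W \<rho> y \<partial>count_space UNIV)"
    unfolding green_Suc by (intro add_left_mono Suc)
  also note assms
  finally show ?case .
qed simp

text \<open>Take \<open>v = 1\<close>: before its return to 0 the walk visits any site at most once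
  on average. Counting measure is invariant by \<open>sum_step_mean\<close>, and removing 0 from
  \<open>W\<close> frees unit mass there for the source.\<close>

lemma green_punctured_le:
  assumes "0 \<notin> W"
  shows "green \<xi> W n \<rho> 0 \<le> (\<integral>\<^sup>+y. \<rho> y \<partial>count_space UNIV)"
proof -
  have "f 0 + (\<integral>\<^sup>+y. killed_mean \<xi> W f y \<partial>count_space UNIV) \<le> (\<integral>\<^sup>+y. f y \<partial>count_space UNIV)" for f
    unfolding killed_mean_def sum_step_mean nn_integral_count_insert[OF assms]
    by (intro nn_integral_mono) (auto simp: indicator_def)
  then show ?thesis
    using green_le_supersolution[of "\<lambda>_. 1" \<xi> W n \<rho>] by simp
qed

text \<open>The supersolution is the constant \<open>C\<close> on the half line. Arrivals at
  \<open>y\<close> from the half line have weight \<open>C * P(\<xi> \<le> y)\<close>, and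
  \<open>C = 1 / P(\<xi> > 0)\<close> leaves at \<open>y = 0\<close> exactly the unit mass of the
  source.\<close>

lemma green_half_line_le:
  assumes C: "C * emeasure (measure_pmf \<xi>) {0<..} = 1"
  shows "green \<xi> {0..} n \<rho> 0 \<le> C * (\<integral>\<^sup>+y. indicator {0..} y * \<rho> y \<partial>count_space UNIV)"
proof -
  have "f 0 + (\<integral>\<^sup>+y. C * indicator {0..} y * killed_mean \<xi> {0..} f y \<partial>count_space UNIV)
     \<le> (\<integral>\<^sup>+y. C * indicator {0..} y * f y \<partial>count_space UNIV)" for f :: "int \<Rightarrow> ennreal"
  proof -
    \<comment> \<open>The departure point is written \<open>y + k - k\<close>, so that the integrand
      is a function of the arrival point. After the shift, a step \<open>k\<close> that ends at
      \<open>y\<close> has started in \<open>{0..}\<close> iff \<open>k \<le> y\<close>.\<close>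
    have "(\<integral>\<^sup>+y. indicator {0..} y * killed_mean \<xi> {0..} f y \<partial>count_space UNIV) =
      (\<integral>\<^sup>+k. (\<integral>\<^sup>+y. indicator {0..} (y + k - k) * (indicator {0..} (y + k) * f (y + k))
         \<partial>count_space UNIV) \<partial>measure_pmf \<xi>)"
      unfolding killed_mean_def step_mean_def
      by (simp add: nn_integral_cmult[symmetric] nn_integral_count_pmf_swap)
    also have "\<dots> = (\<integral>\<^sup>+k. (\<integral>\<^sup>+y. indicator {0..} (y - k) * (indicator {0..} y * f y)
         \<partial>count_space UNIV) \<partial>measure_pmf \<xi>)"
      by (intro nn_integral_cong
        nn_integral_count_shift[where f =
            "\<lambda>y. indicator {0..} (y - _) * (indicator {0..} y * f y)"])
    also have "\<dots> = (\<integral>\<^sup>+y. indicator {0..} y * f y *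
        emeasure (measure_pmf \<xi>) {..y} \<partial>count_space UNIV)"
      unfolding nn_integral_count_pmf_swap[symmetric]
    proof (intro nn_integral_cong)
      fix y
      have "(\<integral>\<^sup>+k. indicator {0..} (y - k) * (indicator {0..} y * f y) \<partial>measure_pmf \<xi>) =
        (\<integral>\<^sup>+k. (indicator {0..} y * f y) * indicator {..y} k \<partial>measure_pmf \<xi>)"
        by (intro nn_integral_cong) (auto simp: indicator_def)
      then show "(\<integral>\<^sup>+k. indicator {0..} (y - k) * (indicator {0..} y * f y) \<partial>measure_pmf \<xi>) =
         indicator {0..} y * f y * emeasure (measure_pmf \<xi>) {..y}"
        by (simp add: nn_integral_cmult)
    qed
    finally have eq: "(\<integral>\<^sup>+y. indicator {0..} y * killed_mean \<xi> {0..} f y \<partial>count_space UNIV) =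
       (\<integral>\<^sup>+y. indicator {0..} y * f y * emeasure (measure_pmf \<xi>) {..y} \<partial>count_space UNIV)" .
    have "f 0 = (\<integral>\<^sup>+y. indicator {0} y * f y \<partial>count_space UNIV)"
      by (subst mult.commute) (simp add: nn_integral_indicator_singleton)
    then have "f 0 + (\<integral>\<^sup>+y. C * indicator {0..} y * killed_mean \<xi> {0..} f y \<partial>count_space UNIV)
      = (\<integral>\<^sup>+y. indicator {0} y * f y \<partial>count_space UNIV) +
        C * (\<integral>\<^sup>+y. indicator {0..} y * f y * emeasure (measure_pmf \<xi>) {..y} \<partial>count_space UNIV)"
      by (simp add: mult.assoc nn_integral_cmult eq)
    also have "\<dots> = (\<integral>\<^sup>+y. indicator {0} y * f y +
         C * (indicator {0..} y * f y * emeasure (measure_pmf \<xi>) {..y}) \<partial>count_space UNIV)"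
      by (simp add: nn_integral_add nn_integral_cmult)
    also have "\<dots> \<le> (\<integral>\<^sup>+y. C * indicator {0..} y * f y \<partial>count_space UNIV)"
    proof (intro nn_integral_mono)
      fix y :: int
      have "emeasure (measure_pmf \<xi>) {0<..} + emeasure (measure_pmf \<xi>) {..0} =
          emeasure (measure_pmf \<xi>) ({0<..} \<union> {..0})"
        by (intro plus_emeasure) auto
      also have "{0<..} \<union> {..0} = (UNIV :: int set)" by auto
      finally have "C * (emeasure (measure_pmf \<xi>) {0<..} + emeasure (measure_pmf \<xi>) {..0}) = C"
        using measure_pmf.emeasure_space_1[of \<xi>] by simp
      then have C0: "1 + C * emeasure (measure_pmf \<xi>) {..0} = C"
        by (simp add: distrib_left C)
      show "indicator {0} y * f y + C * (indicator {0..} y * f y * emeasure (measure_pmf \<xi>) {..y})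
        \<le> C * indicator {0..} y * f y"
      proof (cases "y = 0")
        case True
        have "f 0 + C * (f 0 * emeasure (measure_pmf \<xi>) {..0}) =
            (1 + C * emeasure (measure_pmf \<xi>) {..0}) * f 0"
          by (simp only: distrib_right mult_1_left mult.assoc mult.commute[of "f 0"])
        then show ?thesis using True C0 by simp
      next
        case False
        have "indicator {0..} y * f y * emeasure (measure_pmf \<xi>) {..y} \<le>
            indicator {0..} y * f y * 1"
          by (intro mult_left_mono measure_pmf.emeasure_le_1) auto
        then have "C * (indicator {0..} y * f y * emeasure (measure_pmf \<xi>) {..y}) \<le>
            C * (indicator {0..} y * f y * 1)"
          by (rule mult_left_mono) simp
        with False show ?thesis by (simp add: mult.assoc)
      qed
    qed
    finally show ?thesis .
  qed
  from green_le_supersolution[OF this, of n \<rho>] show ?thesis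
    by (simp add: mult.assoc nn_integral_cmult)
qed

section \<open>Translations and reflections\<close>

lemma step_mean_shift: "step_mean \<xi> f (c + y) = step_mean \<xi> (\<lambda>z. f (c + z)) y"
  by (simp add: step_mean_def add.assoc)

lemma hit_within_translate:
  "hit_within \<xi> ((+) c ` B) ((+) c ` A) n (c + y) = hit_within \<xi> B A n y"
proof (induction n arbitrary: y)
  case (Suc n)
  have "c + z \<in> (+) c ` X \<longleftrightarrow> z \<in> X" for z X by auto
  then show ?case by (simp only: hit_within.simps step_mean_shift Suc)
qed simp

lemma hit_within_reflect:
  "hit_within (map_pmf uminus \<xi>) (uminus ` B) (uminus ` A) n (- y) = hit_within \<xi> B A n y"
proof (induction n arbitrary: y)
  case (Suc n)
  have *: "- z \<in> uminus ` X \<longleftrightarrow> z \<in> X" for z :: int and X by auto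
  have "hit_within (map_pmf uminus \<xi>) (uminus ` B) (uminus ` A) (Suc n) (- y) =
    (\<integral>\<^sup>+k. (if - (y + k) \<in> uminus ` A then 0 else if - (y + k) \<in> uminus ` B then 1
       else hit_within (map_pmf uminus \<xi>) (uminus ` B) (uminus ` A) n (- (y + k))) \<partial>measure_pmf \<xi>)"
    unfolding hit_within.simps step_mean_def
    by (simp only: nn_integral_map_pmf minus_add_distrib add.commute)
  also have "\<dots> = hit_within \<xi> B A (Suc n) y"
    unfolding Suc * by (simp add: step_mean_def)
  finally show ?case .
qed simp

lemma ennreal_hit_before_cong:
  assumes "\<And>n. hit_within \<xi> B A n y = hit_within \<xi>' B' A' n y'"
  shows "hit_before \<xi> y B A = hit_before \<xi>' y' B' A'"
proof -
  have "ennreal (hit_before \<xi> y B A) = ennreal (hit_before \<xi>' y' B' A')"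
    unfolding hit_before_conv_SUP assms ..
  then show ?thesis by (simp add: hit_before_nonneg)
qed

lemma hit_before_translate:
  "hit_before \<xi> (c + y) ((+) c ` B) ((+) c ` A) = hit_before \<xi> y B A"
  by (rule ennreal_hit_before_cong) (rule hit_within_translate)

lemma hit_before_reflect:
  "hit_before (map_pmf uminus \<xi>) (- y) (uminus ` B) (uminus ` A) = hit_before \<xi> y B A"
  by (rule ennreal_hit_before_cong) (rule hit_within_reflect)

lemma hit_within_le_hit_before: "hit_within \<xi> B A n y \<le> ennreal (hit_before \<xi> y B A)"
  unfolding hit_before_conv_SUP by (rule SUP_upper) simp

lemma hit_before_harmonic:
  "ennreal (hit_before \<xi> y B A) =
     step_mean \<xi> (\<lambda>z. if z \<in> A then 0 else if z \<in> B then 1 else ennreal (hit_before \<xi> z B A)) y"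
proof -
  have "ennreal (hit_before \<xi> y B A) = (SUP n. hit_within \<xi> B A (Suc n) y)"
    unfolding hit_before_conv_SUP
    by (intro SUP_eq) (use incseq_SucD[OF incseq_hit_within[of \<xi> B A y]] in blast)+
  also have "\<dots> = (SUP n. \<integral>\<^sup>+k. (if y + k \<in> A then 0 else if y + k \<in> B then 1
     else hit_within \<xi> B A n (y + k)) \<partial>measure_pmf \<xi>)"
    by (simp add: step_mean_def)
  also have "\<dots> = (\<integral>\<^sup>+k. (SUP n. if y + k \<in> A then 0 else if y + k \<in> B then 1
     else hit_within \<xi> B A n (y + k)) \<partial>measure_pmf \<xi>)"
    using incseq_hit_within
    by (intro nn_integral_monotone_convergence_SUP[symmetric])
       (auto simp: incseq_def le_fun_def)
  also have "\<dots> = step_mean \<xi> (\<lambda>z. if z \<in> A then 0 else if z \<in> B then 1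
     else ennreal (hit_before \<xi> z B A)) y"
    unfolding step_mean_def hit_before_conv_SUP by (intro nn_integral_cong) auto
  finally show ?thesis .
qed

section \<open>Escape probabilities and recurrence\<close>

lemma abs_le_square_int: "\<bar>x\<bar> \<le> x\<^sup>2" for x :: int
proof (cases "x = 0")
  case False
  then have "\<bar>x\<bar> * 1 \<le> \<bar>x\<bar> * \<bar>x\<bar>" by (intro mult_left_mono) auto
  then show ?thesis by (simp add: power2_eq_square)
qed simp

text \<open>The assumptions are invariant under reflection of the step. One-sided statements reach
  the other side by interpreting the locale for the reflected step.\<close>

locale centred_walk =
  fixes \<xi> :: "int pmf"
  assumes irreducible: "irreducible_steps \<xi>"
    and integrable_square: "integrable (measure_pmf \<xi>) (\<lambda>k. \<bar>real_of_int k\<bar>\<^sup>2)"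
    and mean_zero: "measure_pmf.expectation \<xi> (\<lambda>k. real_of_int k) = 0"
begin

lemma integrable_step: "integrable (measure_pmf \<xi>) (\<lambda>k. real_of_int k)"
proof (rule Bochner_Integration.integrable_bound[OF integrable_square])
  have "\<bar>real_of_int x\<bar> \<le> (real_of_int x)\<^sup>2" for x
    using abs_le_square_int[of x] by (metis of_int_abs of_int_le_iff of_int_power)
  then show "AE x in measure_pmf \<xi>. norm (real_of_int x) \<le> norm (\<bar>real_of_int x\<bar>\<^sup>2)"
    by simp
qed simp

lemma step_support_pos: "\<exists>k\<in>set_pmf \<xi>. k > 0"
proof (rule ccontr)
  assume *: "\<not> ?thesis"
  have "(1::int) \<le> 0"
    by (rule irreducible_closure[OF irreducible, where Q = "\<lambda>z. z \<le> 0" and x = 0]) (use * in force)+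
  then show False by simp
qed

text \<open>The excess of \<open>E|y + \<xi>|\<close> over \<open>|y|\<close>, written so that the integrand is nonnegative.\<close>

definition abs_excess :: "int \<Rightarrow> ennreal" where
  "abs_excess y = (\<integral>\<^sup>+k. ennreal (real_of_int (\<bar>y + k\<bar> - \<bar>y\<bar> - sgn y * k)) \<partial>measure_pmf \<xi>)"

definition total_excess :: ennreal where
  "total_excess = (\<integral>\<^sup>+y. abs_excess y \<partial>count_space UNIV)"

lemma abs_excess_nonneg: "0 \<le> \<bar>y + k\<bar> - \<bar>y\<bar> - sgn y * (k :: int)"
  by (cases "y > 0"; cases "y = 0") auto

text \<open>For a fixed step \<open>k\<close> the integrand vanishes unless
  \<open>|y| \<le> |k|\<close>, where it is at most \<open>2 * |k|\<close>. The sum over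
  \<open>y\<close> is thus quadratic in \<open>k\<close>, and the second moment bounds the total;
  the constant 6 absorbs the linear term through \<open>|k| \<le> k^2\<close>.\<close>

lemma total_excess_finite: "total_excess < \<infinity>"
proof -
  have "(\<integral>\<^sup>+y. ennreal (real_of_int (\<bar>y + k\<bar> - \<bar>y\<bar> - sgn y * k)) \<partial>count_space UNIV)
     \<le> ennreal (6 * \<bar>real_of_int k\<bar>\<^sup>2)" for k
  proof -
    have "(\<integral>\<^sup>+y. ennreal (real_of_int (\<bar>y + k\<bar> - \<bar>y\<bar> - sgn y * k)) \<partial>count_space UNIV)
       \<le> (\<integral>\<^sup>+y. ennreal (2 * \<bar>real_of_int k\<bar>) * indicator {-\<bar>k\<bar>..\<bar>k\<bar>} y \<partial>count_space UNIV)"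
    proof (intro nn_integral_mono)
      fix y
      have "\<bar>y + k\<bar> - \<bar>y\<bar> - sgn y * k \<le> (if y \<in> {-\<bar>k\<bar>..\<bar>k\<bar>} then 2 * \<bar>k\<bar> else 0)"
        by (cases "y > 0"; cases "y = 0") auto
      then have "real_of_int (\<bar>y + k\<bar> - \<bar>y\<bar> - sgn y * k)
          \<le> real_of_int (if y \<in> {-\<bar>k\<bar>..\<bar>k\<bar>} then 2 * \<bar>k\<bar> else 0)"
        using of_int_le_iff by blast
      then show "ennreal (real_of_int (\<bar>y + k\<bar> - \<bar>y\<bar> - sgn y * k))
         \<le> ennreal (2 * \<bar>real_of_int k\<bar>) * indicator {-\<bar>k\<bar>..\<bar>k\<bar>} y"
        by (cases "y \<in> {-\<bar>k\<bar>..\<bar>k\<bar>}")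
           (auto simp add: ennreal_leI ennreal_neg simp del: of_int_diff of_int_mult of_int_add)
    qed
    also have "\<dots> = ennreal (2 * \<bar>real_of_int k\<bar>) * of_nat (card {-\<bar>k\<bar>..\<bar>k\<bar>})"
      by (subst nn_integral_cmult_indicator) auto
    also have "\<dots> = ennreal (2 * \<bar>real_of_int k\<bar> * (2 * \<bar>real_of_int k\<bar> + 1))"
      by (simp add: ennreal_mult ennreal_of_nat_eq_real_of_nat)
    also have "\<dots> \<le> ennreal (6 * \<bar>real_of_int k\<bar>\<^sup>2)"
    proof (rule ennreal_leI)
      have "\<bar>k\<bar> \<le> \<bar>k\<bar>\<^sup>2"
        using abs_le_square_int[of k] by simp
      then have "2 * \<bar>k\<bar> * (2 * \<bar>k\<bar> + 1) \<le> 6 * \<bar>k\<bar>\<^sup>2"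
        unfolding power2_eq_square distrib_left by linarith
      then have "real_of_int (2 * \<bar>k\<bar> * (2 * \<bar>k\<bar> + 1)) \<le> real_of_int (6 * \<bar>k\<bar>\<^sup>2)"
        using of_int_le_iff by blast
      then show "2 * \<bar>real_of_int k\<bar> * (2 * \<bar>real_of_int k\<bar> + 1) \<le> 6 * \<bar>real_of_int k\<bar>\<^sup>2" by simp
    qed
    finally show ?thesis .
  qed
  then have "total_excess \<le> (\<integral>\<^sup>+k. ennreal (6 * \<bar>real_of_int k\<bar>\<^sup>2) \<partial>measure_pmf \<xi>)"
    unfolding total_excess_def abs_excess_def nn_integral_count_pmf_swap
    by (intro nn_integral_mono)
  also have "\<dots> = ennreal (\<integral>k. 6 * \<bar>real_of_int k\<bar>\<^sup>2 \<partial>measure_pmf \<xi>)"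
    by (intro nn_integral_eq_integral integrable_mult_right integrable_square) auto
  also have "\<dots> < \<infinity>" by simp
  finally show ?thesis .
qed

text \<open>The correction \<open>sgn y * k\<close> inside \<open>abs_excess\<close> has mean zero
  and disappears in the expectation.\<close>

lemma step_mean_abs:
  "step_mean \<xi> (\<lambda>z. ennreal \<bar>real_of_int z\<bar>) y = ennreal \<bar>real_of_int y\<bar> + abs_excess y"
proof -
  let ?g = "\<lambda>k. real_of_int (\<bar>y + k\<bar> - \<bar>y\<bar> - sgn y * k)"
  have int1: "integrable (measure_pmf \<xi>) (\<lambda>k. \<bar>real_of_int y + real_of_int k\<bar>)"
    using integrable_step by (intro integrable_abs) auto
  have int: "integrable (measure_pmf \<xi>) ?g"
    using int1 integrable_step by simp
  have "abs_excess y = ennreal (integral\<^sup>L (measure_pmf \<xi>) ?g)"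
    unfolding abs_excess_def
    using int abs_excess_nonneg[of y]
        by (intro nn_integral_eq_integral) (auto simp del: of_int_diff of_int_mult)
  moreover have "integral\<^sup>L (measure_pmf \<xi>) ?g =
     (\<integral>k. \<bar>real_of_int (y + k)\<bar> \<partial>measure_pmf \<xi>) - \<bar>real_of_int y\<bar>"
    using int1 integrable_step mean_zero by simp
  moreover have "step_mean \<xi> (\<lambda>z. ennreal \<bar>real_of_int z\<bar>) y =
      ennreal (\<integral>k. \<bar>real_of_int (y + k)\<bar> \<partial>measure_pmf \<xi>)"
    unfolding step_mean_def using int1 by (intro nn_integral_eq_integral) auto
  moreover have "integral\<^sup>L (measure_pmf \<xi>) ?g \<ge> 0"
    using abs_excess_nonneg[of y] by (intro integral_nonneg_AE AE_I2)
        (simp del: of_int_diff of_int_mult)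
  ultimately show ?thesis
    by (simp add: ennreal_plus[symmetric] del: ennreal_plus)
qed

text \<open>The absolute value minus the accumulated excess is a martingale, and killing only loses
  mass.\<close>

lemma killed_mean_pow_abs_le:
  "(killed_mean \<xi> W ^^ n) (\<lambda>z. ennreal \<bar>real_of_int z\<bar>) y
     \<le> ennreal \<bar>real_of_int y\<bar> + green \<xi> W n abs_excess y"
proof (induction n arbitrary: y)
  case (Suc n)
  have "(killed_mean \<xi> W ^^ Suc n) (\<lambda>z. ennreal \<bar>real_of_int z\<bar>) y \<le>
     killed_mean \<xi> W (\<lambda>z. ennreal \<bar>real_of_int z\<bar> + green \<xi> W n abs_excess z) y"
    unfolding funpow.simps o_apply by (rule killed_mean_mono) (use Suc in auto)
  also have "\<dots> \<le> (ennreal \<bar>real_of_int y\<bar> + abs_excess y) +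
      killed_mean \<xi> W (green \<xi> W n abs_excess) y"
    unfolding killed_mean_add using killed_mean_le[of \<xi> W] step_mean_abs
    by (intro add_right_mono) metis
  also have "\<dots> = ennreal \<bar>real_of_int y\<bar> + green \<xi> W (Suc n) abs_excess y"
    by (simp add: green_Suc' add.assoc)
  finally show ?case .
qed simp

text \<open>Optional stopping for the same martingale at the first visit to \<open>A\<close> or 0,
  for a finite horizon: ending in \<open>A\<close> contributes at least \<open>m\<close>, and ending
  at 0 contributes nothing.\<close>

lemma hit_far_le:
  assumes "\<And>a. a \<in> A \<Longrightarrow> m \<le> \<bar>real_of_int a\<bar>"
  shows "ennreal m * hit_within \<xi> A {0} n y
     \<le> ennreal \<bar>real_of_int y\<bar> + green \<xi> (- ({0} \<union> A)) n abs_excess y"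
proof (induction n arbitrary: y)
  case (Suc n)
  let ?W = "- ({0} \<union> A)"
  have "ennreal m * hit_within \<xi> A {0} (Suc n) y =
     step_mean \<xi> (\<lambda>z. ennreal m * (if z \<in> {0} then 0 else if z \<in> A then 1 else hit_within \<xi> A {0} n
         z)) y"
    by (simp only: hit_within.simps step_mean_cmult)
  also have "\<dots> \<le> step_mean \<xi> (\<lambda>z. ennreal \<bar>real_of_int z\<bar> + indicator ?W z *
      green \<xi> ?W n abs_excess z) y"
  proof (rule step_mean_mono)
    fix z
    show "ennreal m * (if z \<in> {0} then 0 else if z \<in> A then 1 else hit_within \<xi> A {0} n z)
       \<le> ennreal \<bar>real_of_int z\<bar> + indicator ?W z * green \<xi> ?W n abs_excess z"
      using Suc[of z] assms[of z] by (auto simp: ennreal_leI)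
  qed
  also have "\<dots> = (ennreal \<bar>real_of_int y\<bar> + abs_excess y) +
      killed_mean \<xi> ?W (green \<xi> ?W n abs_excess) y"
    unfolding step_mean_add step_mean_abs killed_mean_def ..
  also have "\<dots> = ennreal \<bar>real_of_int y\<bar> + green \<xi> ?W (Suc n) abs_excess y"
    by (simp add: green_Suc' add.assoc)
  finally show ?case .
qed simp

lemma green_excess_le: "0 \<notin> W \<Longrightarrow> green \<xi> W n abs_excess 0 \<le> total_excess"
  unfolding total_excess_def by (rule green_punctured_le)

lemma escape_within_le:
  assumes "\<And>a. a \<in> A \<Longrightarrow> m \<le> \<bar>real_of_int a\<bar>"
  shows "ennreal m * hit_within \<xi> A {0} n 0 \<le> total_excess"
proof -
  have "ennreal m * hit_within \<xi> A {0} n 0 \<le> green \<xi> (- ({0} \<union> A)) n abs_excess 0"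
    using hit_far_le[of A m n 0] assms by simp
  also have "\<dots> \<le> total_excess" by (rule green_excess_le) simp
  finally show ?thesis .
qed

text \<open>The bound for the starting point \<open>0\<close> is transported along paths that start at \<open>0\<close>.\<close>

lemma hit_within_far_le:
  obtains C :: ennreal and m0 :: real where "C < \<infinity>"
    "\<And>m A n. m0 \<le> m \<Longrightarrow> (\<And>a. a \<in> A \<Longrightarrow> m \<le> \<bar>real_of_int a\<bar>) \<Longrightarrow>
       ennreal m * hit_within \<xi> A {0} n z \<le> C"
proof -
  define Q where "Q z \<longleftrightarrow> (\<exists>C m0. C < (\<infinity>::ennreal) \<and>
    (\<forall>m\<ge>m0. \<forall>A n. (\<forall>a\<in>A. m \<le> \<bar>real_of_int a\<bar>) \<longrightarrow> ennreal m * hit_within \<xi> A {0} n z \<le> C))" for z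
  have "Q 0"
    unfolding Q_def
    by (intro exI[of _ total_excess] exI[of _ 0] conjI total_excess_finite allI impI)
       (auto intro: escape_within_le)
  have "Q z"
  proof (rule irreducible_closure[OF irreducible, where x = 0])
    fix z k assume "Q z" and k: "k \<in> set_pmf \<xi>"
    then obtain C m0 where C: "C < (\<infinity>::ennreal)"
      "\<forall>m\<ge>m0. \<forall>A n. (\<forall>a\<in>A. m \<le> \<bar>real_of_int a\<bar>) \<longrightarrow> ennreal m * hit_within \<xi> A {0} n z \<le> C"
      unfolding Q_def by (elim exE conjE)
    show "Q (z + k)"
    \<comment> \<open>At 0 the bound is already known. Elsewhere the step from \<open>z\<close> to
      \<open>z + k\<close> is not absorbed, and the bound survives at the cost of a factor
      \<open>1 / pmf \<xi> k\<close>.\<close>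
    proof (cases "z + k = 0")
      case False
      have p: "0 < pmf \<xi> k" using k by (simp add: pmf_positive)
      \<comment> \<open>The threshold \<open>|z + k| + 1\<close> keeps \<open>z + k\<close> outside
        \<open>A\<close>, so that the single step does not already end the walk.\<close>
      have "ennreal m * hit_within \<xi> A {0} n (z + k) \<le> ennreal (1 / pmf \<xi> k) * C"
        if m: "m \<ge> max m0 (\<bar>real_of_int (z + k)\<bar> + 1)" and A: "\<And>a. a \<in> A \<Longrightarrow> m \<le> \<bar>real_of_int a\<bar>"
            for m A n
      proof -
        have "z + k \<notin> A" using A[of "z + k"] m by auto
        with False have "ennreal (pmf \<xi> k) * hit_within \<xi> A {0} n (z + k) \<le>
            hit_within \<xi> A {0} (Suc n) z"
          using step_mean_ge[of \<xi> k
              "\<lambda>z. if z \<in> {0} then 0 else if z \<in> A then 1 else hit_within \<xi> A {0} n z" z]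
          by simp
        then have "ennreal m * (ennreal (pmf \<xi> k) * hit_within \<xi> A {0} n (z + k))
            \<le> ennreal m * hit_within \<xi> A {0} (Suc n) z"
          by (rule mult_left_mono) simp
        also have "\<dots> \<le> C"
          using m by (intro C(2)[rule_format] A) simp_all
        finally have "ennreal m * (ennreal (pmf \<xi> k) * hit_within \<xi> A {0} n (z + k)) \<le> C" .
        then have "ennreal (1 / pmf \<xi> k) *
            (ennreal m * (ennreal (pmf \<xi> k) * hit_within \<xi> A {0} n (z + k)))
            \<le> ennreal (1 / pmf \<xi> k) * C"
          by (rule mult_left_mono) simp
        moreover have "ennreal (1 / pmf \<xi> k) *
            (ennreal m * (ennreal (pmf \<xi> k) * hit_within \<xi> A {0} n (z + k)))
            = (ennreal (1 / pmf \<xi> k) * ennreal (pmf \<xi> k)) *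
                (ennreal m * hit_within \<xi> A {0} n (z + k))"
          by (simp only: ac_simps)
        moreover have "ennreal (1 / pmf \<xi> k) * ennreal (pmf \<xi> k) = 1"
          using p by (simp add: ennreal_mult[symmetric])
        ultimately show ?thesis by simp
      qed
      moreover have "ennreal (1 / pmf \<xi> k) * C < \<infinity>"
        using C(1) by (simp add: ennreal_mult_less_top)
      ultimately show ?thesis unfolding Q_def
        by (intro exI[of _ "ennreal (1 / pmf \<xi> k) * C"] exI[of _
            "max m0 (\<bar>real_of_int (z + k)\<bar> + 1)"]) auto
    qed (use \<open>Q 0\<close> in simp)
  qed fact
  then obtain C m0 where "C < (\<infinity>::ennreal)"
      "\<forall>m\<ge>m0. \<forall>A n. (\<forall>a\<in>A. m \<le> \<bar>real_of_int a\<bar>) \<longrightarrow> ennreal m * hit_within \<xi> A {0} n z \<le> C"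
    unfolding Q_def by (elim exE conjE)
  then show ?thesis by (intro that[of C m0]) auto
qed

text \<open>Recurrence, by splitting \<open>1 \<le> |z| / m + indicator {|z| < m}\<close>. The first
  part costs at most \<open>total_excess / m\<close> for all times; the second tends to 0 in time
  for fixed \<open>m\<close>. Then \<open>m\<close> goes to infinity.\<close>

lemma survive_at_0_tendsto_0: "(\<lambda>n. (killed_mean \<xi> (- {0}) ^^ n) (\<lambda>_. 1) 0) \<longlonglongrightarrow> 0"
proof -
  let ?S = "\<lambda>n. (killed_mean \<xi> (- {0}) ^^ n) (\<lambda>_. 1) 0"
  have dec: "decseq ?S"
  proof (rule decseq_SucI)
    fix n
    have "(killed_mean \<xi> (- {0}) ^^ n) (killed_mean \<xi> (- {0}) (\<lambda>_. 1)) 0 \<le> ?S n"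
    proof (rule killed_mean_pow_mono)
      fix z show "killed_mean \<xi> (- {0}) (\<lambda>_. 1) z \<le> 1"
        using killed_mean_le[of \<xi> "- {0}" "\<lambda>_. 1" z] by (simp add: step_mean_const)
    qed simp
    then show "?S (Suc n) \<le> ?S n" by (simp add: funpow_Suc_right del: funpow.simps)
  qed
  have bound: "(INF n. ?S n) \<le> ennreal (1 / real m) * total_excess" if m: "m > 0" for m :: nat
  proof -
    let ?I = "indicator {- int m<..<int m} :: int \<Rightarrow> ennreal"
    let ?a = "\<lambda>n. (killed_mean \<xi> (- {0}) ^^ n) ?I 0"
    \<comment> \<open>The Green function bound says that the window is visited at most finitely
      often on average before the return to 0, so the probabilities \<open>?a n\<close> are summable
      and tend to 0.\<close>
    have "(\<Sum>i<n. ?a i) \<le> (\<integral>\<^sup>+y. ?I y \<partial>count_space UNIV)" for n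
      using green_punctured_le[of "- {0}" \<xi> n ?I] by (simp add: green_def)
    then have "suminf ?a \<le> (\<integral>\<^sup>+y. ?I y \<partial>count_space UNIV)"
      by (intro suminf_le_const) auto
    also have "\<dots> < \<infinity>" by (simp add: of_nat_less_top)
    finally have sum: "suminf ?a < \<infinity>" .
    then have fin: "?a n < \<infinity>" for n
      using ennreal_suminf_lessD by blast
    then have eq: "?a n = ennreal (enn2real (?a n))" for n by simp
    have "suminf (\<lambda>n. ennreal (enn2real (?a n))) \<noteq> \<infinity>" using sum eq by simp
    then have "summable (\<lambda>n. enn2real (?a n))"
      by (intro summable_suminf_not_top) auto
    then have "(\<lambda>n. enn2real (?a n)) \<longlonglongrightarrow> 0" by (rule summable_LIMSEQ_zero)
    then have "(\<lambda>n. ennreal (enn2real (?a n))) \<longlonglongrightarrow> ennreal 0" by (rule tendsto_ennrealI)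
    then have a0: "?a \<longlonglongrightarrow> 0" using eq by simp
    have le: "?S n \<le> ennreal (1 / real m) * total_excess + ?a n" for n
    proof -
      have "?S n \<le> (killed_mean \<xi> (- {0}) ^^ n)
          (\<lambda>z. ennreal (1 / real m) * ennreal \<bar>real_of_int z\<bar> + ?I z) 0"
      proof (rule killed_mean_pow_mono)
        fix z
        show "1 \<le> ennreal (1 / real m) * ennreal \<bar>real_of_int z\<bar> + ?I z"
        proof (cases "z \<in> {- int m<..<int m}")
          case False
          then have "real m \<le> \<bar>real_of_int z\<bar>" by auto
          then have "1 \<le> \<bar>real_of_int z\<bar> / real m" using m by simp
          then have "ennreal 1 \<le> ennreal (\<bar>real_of_int z\<bar> / real m)" by (rule ennreal_leI)
          then have "1 \<le> ennreal (1 / real m) * ennreal \<bar>real_of_int z\<bar>"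
            by (simp add: ennreal_mult[symmetric])
          then show ?thesis by (rule order_trans) simp
        qed simp
      qed simp
      also have "\<dots> = ennreal (1 / real m) *
          (killed_mean \<xi> (- {0}) ^^ n) (\<lambda>z. ennreal \<bar>real_of_int z\<bar>) 0 + ?a n"
        by (simp only: killed_mean_pow_add killed_mean_pow_cmult)
      also have "\<dots> \<le> ennreal (1 / real m) * total_excess + ?a n"
        using killed_mean_pow_abs_le[where y = 0 and W = "- {0}" and n = n] green_excess_le[of
            "- {0}" n]
        by (intro add_right_mono mult_left_mono) auto
      finally show ?thesis .
    qed
    have "(\<lambda>n. ennreal (1 / real m) * total_excess + ?a n) \<longlonglongrightarrow> ennreal (1 / real m) * total_excess +
        0"
      by (intro tendsto_add tendsto_const a0)
    moreover have "(INF n. ?S n) \<le> ennreal (1 / real m) * total_excess + ?a n" for n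
      using le[of n] by (meson INF_lower2 UNIV_I)
    ultimately show ?thesis
      by (intro tendsto_lowerbound[where f = "\<lambda>n. ennreal (1 / real m) * total_excess + ?a n"]) auto
  qed
  obtain t where t: "total_excess = ennreal t" "0 \<le> t"
    using total_excess_finite by (cases total_excess) auto
  have "(INF n. ?S n) \<le> ennreal (t / real (Suc m))" for m
    using bound[of "Suc m"] t by (simp add: ennreal_mult[symmetric])
  moreover have "(\<lambda>m. ennreal (t / real (Suc m))) \<longlonglongrightarrow> ennreal 0"
    by (intro tendsto_ennrealI LIMSEQ_Suc lim_const_over_n)
  ultimately have "(INF n. ?S n) \<le> ennreal 0"
    by (intro tendsto_lowerbound[where f = "\<lambda>m. ennreal (t / real (Suc m))"]) auto
  then show ?thesis using LIMSEQ_INF[OF dec] by simp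
qed

text \<open>Transport along paths from 0: surviving \<open>n\<close> steps from \<open>z + k\<close>
  is, up to the factor \<open>pmf \<xi> k\<close>, a way of surviving \<open>n + 1\<close> steps
  from \<open>z\<close>. A path that meets 0 restarts from the known case.\<close>

lemma survive_tendsto_0: "(\<lambda>n. (killed_mean \<xi> (- {0}) ^^ n) (\<lambda>_. 1) z) \<longlonglongrightarrow> 0"
proof (rule irreducible_closure[OF irreducible, where x = 0])
  fix z k assume z: "(\<lambda>n. (killed_mean \<xi> (- {0}) ^^ n) (\<lambda>_. 1) z) \<longlonglongrightarrow> 0" and k: "k \<in> set_pmf \<xi>"
  show "(\<lambda>n. (killed_mean \<xi> (- {0}) ^^ n) (\<lambda>_. 1) (z + k)) \<longlonglongrightarrow> 0"
  proof (cases "z + k = 0")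
    case True
    then show ?thesis using survive_at_0_tendsto_0 by simp
  next
    case False
    have p: "0 < pmf \<xi> k" using k by (simp add: pmf_positive)
    have le: "(killed_mean \<xi> (- {0}) ^^ n) (\<lambda>_. 1) (z + k) \<le>
        ennreal (1 / pmf \<xi> k) * (killed_mean \<xi> (- {0}) ^^ Suc n) (\<lambda>_. 1) z" for n
    proof -
      have "ennreal (pmf \<xi> k) * (killed_mean \<xi> (- {0}) ^^ n) (\<lambda>_. 1) (z + k) \<le>
          (killed_mean \<xi> (- {0}) ^^ Suc n) (\<lambda>_. 1) z"
        using step_mean_ge[of \<xi> k "\<lambda>y. indicator (- {0}) y *
            (killed_mean \<xi> (- {0}) ^^ n) (\<lambda>_. 1) y" z] False
        by (simp add: killed_mean_def[of _ _ "(killed_mean \<xi> (- {0}) ^^ n) (\<lambda>_. 1)"])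
      then have "ennreal (1 / pmf \<xi> k) *
          (ennreal (pmf \<xi> k) * (killed_mean \<xi> (- {0}) ^^ n) (\<lambda>_. 1) (z + k))
         \<le> ennreal (1 / pmf \<xi> k) * (killed_mean \<xi> (- {0}) ^^ Suc n) (\<lambda>_. 1) z"
        by (rule mult_left_mono) simp
      then show ?thesis using p
        by (simp add: mult.assoc[symmetric] ennreal_mult[symmetric] del: funpow.simps)
    qed
    have "(\<lambda>n. ennreal (1 / pmf \<xi> k) * (killed_mean \<xi> (- {0}) ^^ Suc n) (\<lambda>_. 1) z) \<longlonglongrightarrow> ennreal
        (1 / pmf \<xi> k) * 0"
      by (rule ennreal_tendsto_cmult[OF _ LIMSEQ_Suc[OF z]]) simp
    then have lim: "(\<lambda>n. ennreal (1 / pmf \<xi> k) * (killed_mean \<xi> (- {0}) ^^ Suc n) (\<lambda>_. 1) z) \<longlonglongrightarrow> 0"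
      by simp
    show ?thesis
      by (rule tendsto_sandwich[OF _ _ tendsto_const lim])
          (simp_all only: le zero_le eventually_True)
  qed
qed (rule survive_at_0_tendsto_0)

section \<open>Undershoot at the first entrance of a half line\<close>

definition inv_up_prob :: ennreal where
  "inv_up_prob = inverse (emeasure (measure_pmf \<xi>) {0<..})"

text \<open>The factor \<open>1 / P(\<xi> > 0)\<close> bounds the Green function \<open>G(0, \<cdot>)\<close> of the half line \<open>{0..}\<close>.\<close>

definition undershoot_bound :: "nat \<Rightarrow> ennreal" where
  "undershoot_bound k = inv_up_prob *
     (\<integral>\<^sup>+w. indicator {0..} w * emeasure (measure_pmf \<xi>) {..< - (int k + w)} \<partial>count_space UNIV)"

lemma up_prob_pos: "0 < emeasure (measure_pmf \<xi>) {0<..}"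
proof -
  obtain k where "k \<in> set_pmf \<xi>" "k > 0" using step_support_pos by blast
  then have "0 < ennreal (pmf \<xi> k)" by (simp add: pmf_positive)
  also have "\<dots> = emeasure (measure_pmf \<xi>) {k}" by (simp add: emeasure_pmf_single)
  also have "\<dots> \<le> emeasure (measure_pmf \<xi>) {0<..}" using \<open>k > 0\<close> by (intro emeasure_mono) auto
  finally show ?thesis .
qed

lemma inv_up_prob_mult: "inv_up_prob * emeasure (measure_pmf \<xi>) {0<..} = 1"
proof -
  have "emeasure (measure_pmf \<xi>) {0<..} < top"
    by (simp add: measure_pmf.emeasure_eq_measure)
  then show ?thesis
    unfolding inv_up_prob_def using up_prob_pos
    by (simp add: mult.commute[of "inverse _"] divide_ennreal_def[symmetric] ennreal_divide_self)
qed

lemma inv_up_prob_finite: "inv_up_prob < \<infinity>"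
  using up_prob_pos unfolding inv_up_prob_def infinity_ennreal_def less_top[symmetric]
  by (subst ennreal_inverse_eq_top_iff) simp

text \<open>The jump over \<open>{- int k..<0}\<close> is made from some site
  \<open>w \<ge> 0\<close>. Such a site is visited at most \<open>1 / P(\<xi> > 0)\<close> times on
  average, and the jump needs a step below \<open>- (k + w)\<close>.\<close>

lemma hit_within_ladder_le:
  "hit_within \<xi> {..< - int k} {- int k..<0} n 0 \<le> undershoot_bound k"
proof -
  have W: "- ({- int k..<0} \<union> {..< - int k}) = {0..}" and B:
      "{..< - int k} - {- int k..<0} = {..< - int k}" by auto
  have "step_mean \<xi> (indicator {..< - int k}) w = emeasure (measure_pmf \<xi>) {..< - (int k + w)}"
      for w
  proof -
    have "step_mean \<xi> (indicator {..< - int k}) w =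
        (\<integral>\<^sup>+j. indicator {..< - (int k + w)} j \<partial>measure_pmf \<xi>)"
      unfolding step_mean_def by (intro nn_integral_cong) (auto simp: indicator_def)
    then show ?thesis by simp
  qed
  then show ?thesis
    using green_half_line_le[OF inv_up_prob_mult, of n "step_mean \<xi> (indicator {..< - int k})"]
    unfolding hit_within_eq_green W B undershoot_bound_def by simp
qed

text \<open>A step \<open>j\<close> is counted for pairs \<open>(k, w)\<close> with
  \<open>k + w < - j\<close>. They lie in a square of side \<open>|j|\<close>, so the double sum is
  bounded by the second moment.\<close>

lemma suminf_undershoot_bound: "(\<Sum>k. undershoot_bound k) < \<infinity>"
proof -
  let ?P = "\<lambda>k w. \<integral>\<^sup>+j. indicator {..< - (int k + w)} j \<partial>measure_pmf \<xi>"
  have "(\<integral>\<^sup>+k. \<integral>\<^sup>+w. indicator {0..} w * emeasure (measure_pmf \<xi>) {..< - (int k + w)} \<partial>count_space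
      UNIV \<partial>count_space UNIV) =
     (\<integral>\<^sup>+k. \<integral>\<^sup>+w. \<integral>\<^sup>+j. indicator {0..} w *
         indicator {..< - (int k + w)} j \<partial>measure_pmf \<xi> \<partial>count_space UNIV \<partial>count_space UNIV)"
    by (simp add: nn_integral_cmult)
  also have "\<dots> \<le> (\<integral>\<^sup>+j. ennreal (\<bar>real_of_int j\<bar>\<^sup>2) \<partial>measure_pmf \<xi>)"
  proof -
    have "(\<integral>\<^sup>+k. \<integral>\<^sup>+w. indicator {0..} w * indicator {..< - (int k + w)} j \<partial>count_space UNIV
        \<partial>count_space UNIV)
      \<le> ennreal (\<bar>real_of_int j\<bar>\<^sup>2)" for j
    proof -
      have "(\<integral>\<^sup>+k. \<integral>\<^sup>+w. indicator {0..} w *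
          indicator {..< - (int k + w)} j \<partial>count_space UNIV \<partial>count_space UNIV)
        \<le> (\<integral>\<^sup>+k. \<integral>\<^sup>+w. indicator {..<nat \<bar>j\<bar>} k *
            indicator {0..<\<bar>j\<bar>} w \<partial>count_space UNIV \<partial>count_space UNIV)"
        by (intro nn_integral_mono) (auto simp: indicator_def)
      also have "\<dots> = ennreal (\<bar>real_of_int j\<bar>\<^sup>2)"
        by (simp add: nn_integral_cmult nn_integral_multc ennreal_of_nat_eq_real_of_nat
            ennreal_mult[symmetric] power2_eq_square)
      finally show ?thesis .
    qed
    then show ?thesis
      unfolding nn_integral_count_pmf_swap by (rule nn_integral_mono)
  qed
  also have "\<dots> = ennreal (\<integral>k. \<bar>real_of_int k\<bar>\<^sup>2 \<partial>measure_pmf \<xi>)"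
    by (intro nn_integral_eq_integral integrable_square) auto
  also have "\<dots> < \<infinity>" by simp
  finally have fin: "(\<integral>\<^sup>+k. \<integral>\<^sup>+w. indicator {0..} w *
      emeasure (measure_pmf \<xi>) {..< - (int k + w)} \<partial>count_space UNIV \<partial>count_space UNIV) < \<infinity>" .
  have "(\<Sum>k. undershoot_bound k) = (\<integral>\<^sup>+k. undershoot_bound k \<partial>count_space UNIV)"
    by (simp add: nn_integral_count_space_nat)
  also have "\<dots> = inv_up_prob * (\<integral>\<^sup>+k. \<integral>\<^sup>+w. indicator {0..} w *
      emeasure (measure_pmf \<xi>) {..< - (int k + w)} \<partial>count_space UNIV \<partial>count_space UNIV)"
    unfolding undershoot_bound_def by (simp add: nn_integral_cmult)
  also have "\<dots> < \<infinity>"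
    using fin inv_up_prob_finite by (simp add: ennreal_mult_less_top)
  finally show ?thesis .
qed

definition undershoot_tail :: "nat \<Rightarrow> ennreal" where
  "undershoot_tail K = (\<Sum>k. undershoot_bound (k + K))"

lemma undershoot_tail_tendsto_0: "undershoot_tail \<longlonglongrightarrow> 0"
proof -
  define f where "f k = enn2real (undershoot_bound k)" for k
  have "undershoot_bound k < \<infinity>" for k
    using suminf_undershoot_bound ennreal_suminf_lessD by blast
  then have f: "undershoot_bound k = ennreal (f k)" for k by (simp add: f_def)
  have f0: "0 \<le> f k" for k by (simp add: f_def)
  have "suminf (\<lambda>k. ennreal (f k)) \<noteq> \<infinity>" using suminf_undershoot_bound by (simp add: f)
  then have sf: "summable f" using f0 by (intro summable_suminf_not_top) auto
  have tail: "undershoot_tail K = ennreal (suminf f - sum f {..<K})" for K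
    unfolding undershoot_tail_def f
    using sf f0 by (subst suminf_ennreal2) (auto simp: summable_iff_shift
        suminf_minus_initial_segment)
  have "(\<lambda>K. suminf f - sum f {..<K}) \<longlonglongrightarrow> suminf f - suminf f"
    by (intro tendsto_diff tendsto_const summable_LIMSEQ sf)
  then have "(\<lambda>K. undershoot_tail K) \<longlonglongrightarrow> ennreal (suminf f - suminf f)"
    unfolding tail by (rule tendsto_ennrealI)
  then show ?thesis by simp
qed

text \<open>At its first entrance below \<open>y0\<close> the walk either jumps directly below
  \<open>- K\<close>, or lands in \<open>0..<y0\<close>, where \<open>b\<close> takes over, or lands
  in \<open>{- int K..<0}\<close> and does not undershoot.\<close>

lemma hit_within_undershoot_step:
  assumes "y0 \<ge> 0" and b: "\<And>y n. 0 \<le> y \<Longrightarrow> y < y0 \<Longrightarrow> hit_within \<xi> {..< - int K} {- int K..<0} n y \<le> b"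
    and "y0 \<le> z"
  shows "hit_within \<xi> {..< - int K} {- int K..<0} n z \<le>
      b + hit_within \<xi> {..< - int K} {- int K..<y0} n z"
  using \<open>y0 \<le> z\<close>
proof (induction n arbitrary: z)
  case (Suc n)
  have "hit_within \<xi> {..< - int K} {- int K..<0} (Suc n) z \<le>
    step_mean \<xi> (\<lambda>z. b + (if z \<in> {- int K..<y0} then 0 else if z \<in> {..< - int K} then 1
      else hit_within \<xi> {..< - int K} {- int K..<y0} n z)) z"
    unfolding hit_within.simps
  proof (rule step_mean_mono)
    fix y
    show "(if y \<in> {- int K..<0} then 0 else if y \<in> {..< - int K} then 1
      else hit_within \<xi> {..< - int K} {- int K..<0} n y) \<le>
          b + (if y \<in> {- int K..<y0} then 0 else if y \<in> {..< - int K} then 1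
      else hit_within \<xi> {..< - int K} {- int K..<y0} n y)"
      using Suc.IH[of y] b[of y n] \<open>y0 \<ge> 0\<close> by auto
  qed
  then show ?case by (simp only: step_mean_add step_mean_const hit_within.simps)
qed simp

text \<open>Strong induction along the successive minima of the walk: an undershoot from the minimum
  level \<open>w\<close> jumps over a window of length \<open>w + K\<close>. Every level contributes
  one term of a convergent series, so the bound stays uniform in \<open>y\<close>.\<close>

lemma hit_within_undershoot_le_sum:
  "hit_within \<xi> {..< - int K} {- int K..<0} n (int y) \<le> (\<Sum>w\<le>y. undershoot_bound (w + K))"
proof (induction y arbitrary: n rule: less_induct)
  case (less y)
  define b where "b = (\<Sum>w<y. undershoot_bound (w + K))"
  have "hit_within \<xi> {..< - int K} {- int K..<0} n y' \<le> b" if "0 \<le> y'" "y' < int y" for y' n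
  proof -
    have "hit_within \<xi> {..< - int K} {- int K..<0} n (int (nat y')) \<le>
        (\<Sum>w\<le>nat y'. undershoot_bound (w + K))"
      using that by (intro less) auto
    also have "\<dots> \<le> b" unfolding b_def using that by (intro sum_mono2) auto
    finally show ?thesis using that by simp
  qed
  then have "hit_within \<xi> {..< - int K} {- int K..<0} n (int y) \<le>
      b + hit_within \<xi> {..< - int K} {- int K..<int y} n (int y)"
    by (intro hit_within_undershoot_step) auto
  also have "hit_within \<xi> {..< - int K} {- int K..<int y} n (int y) =
     hit_within \<xi> {..< - int (y + K)} {- int (y + K)..<0} n 0"
  proof -
    have "(+) (int y) ` {..< - int (y + K)} = {..< - int K}"
      "(+) (int y) ` {- int (y + K)..<0} = {- int K..<int y}"
      by (auto simp: image_iff intro!: bexI[of _ "_ - int y"])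
    then show ?thesis
      using hit_within_translate[of \<xi> "int y" "{..< - int (y + K)}" "{- int (y + K)..<0}" n 0]
          by simp
  qed
  also have "\<dots> \<le> undershoot_bound (y + K)" by (rule hit_within_ladder_le)
  finally show ?case by (simp add: b_def lessThan_Suc_atMost[symmetric] add_left_mono)
qed

lemma hit_within_undershoot_le:
  "0 \<le> y \<Longrightarrow> hit_within \<xi> {..< - int K} {- int K..<0} n y \<le> undershoot_tail K"
proof -
  assume "0 \<le> y"
  have "(\<Sum>w\<le>nat y. undershoot_bound (w + K)) \<le> undershoot_tail K"
    unfolding undershoot_tail_def by (intro sum_le_suminf) auto
  with hit_within_undershoot_le_sum[of K n "nat y"] \<open>0 \<le> y\<close> show ?thesis by simp
qed

text \<open>The walk from \<open>y\<close> enters the region below \<open>L\<close> through the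
  window of length \<open>K\<close>, where \<open>h\<close> is at least \<open>c\<close>, up to an
  undershoot of probability at most \<open>undershoot_tail K\<close>. The condition
  \<open>c \<le> 1\<close> lets undershooting and surviving paths be counted with weight 1.\<close>

lemma superharmonic_ge_near_boundary:
  fixes h :: "int \<Rightarrow> ennreal"
  assumes sup: "\<And>y. y \<ge> L \<Longrightarrow> step_mean \<xi> h y \<le> h y"
    and c: "c \<le> 1" "\<And>z. L - int K \<le> z \<Longrightarrow> z < L \<Longrightarrow> c \<le> h z"
    and "L \<le> y"
  shows "c \<le> h y + undershoot_tail K"
proof -
  define g where "g = (\<lambda>z. h (L + z))"
  have supg: "step_mean \<xi> g z \<le> g z" if "z \<ge> 0" for z
    using sup[of "L + z"] that by (simp add: g_def step_mean_shift[of \<xi> h] )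
  \<comment> \<open>Staying in \<open>{0..}\<close> implies avoiding \<open>- 1\<close>; after a
    translation, recurrence makes the probability of the latter vanish.\<close>
  have surv: "(killed_mean \<xi> {0..} ^^ n) (\<lambda>_. 1) z \<le> (killed_mean \<xi> (- {- 1}) ^^ n) (\<lambda>_. 1) z"
      for n z
    by (rule killed_mean_pow_mono) auto
  have tr: "(killed_mean \<xi> (- {- 1}) ^^ n) (\<lambda>_. 1) z = (killed_mean \<xi> (- {0}) ^^ n) (\<lambda>_. 1) (1 + z)"
      for n z
  proof (induction n arbitrary: z)
    case (Suc n)
    have "indicator (- {- 1}) w = (indicator (- {0}) (1 + w) :: ennreal)" for w :: int
      by (auto simp: indicator_def)
    then show ?case
      by (simp add: killed_mean_def[of _ _ "(killed_mean _ _ ^^ n) _"] step_mean_shift Suc)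
  qed simp
  have main: "c \<le> g z + hit_within \<xi> {..< - int K} {- int K..<0} n z +
      (killed_mean \<xi> {0..} ^^ n) (\<lambda>_. 1) z"
    if "z \<ge> 0" for n z
    using that
  proof (induction n arbitrary: z)
    case 0
    then show ?case using c(1) by (simp add: add_increasing)
  next
    case (Suc n)
    let ?H = "\<lambda>z. if z \<in> {- int K..<0} then 0 else if z \<in> {..< - int K} then 1 else
       hit_within \<xi> {..< - int K} {- int K..<0} n z"
    let ?S = "\<lambda>z. indicator {0..} z * (killed_mean \<xi> {0..} ^^ n) (\<lambda>_. 1) z"
    have "c \<le> step_mean \<xi> (\<lambda>z. g z + ?H z + ?S z) z"
    proof -
      have "c \<le> g w + ?H w + ?S w" for w
      proof (cases "w \<ge> 0")
        case True
        then show ?thesis using Suc.IH[of w] by simp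
      next
        case False
        then show ?thesis using c(1) c(2)[of "L + w"]
          by (cases "w < - int K") (auto simp: g_def add_increasing add_increasing2)
      qed
      then have "step_mean \<xi> (\<lambda>_. c) z \<le> step_mean \<xi> (\<lambda>z. g z + ?H z + ?S z) z"
        by (intro step_mean_mono)
      then show ?thesis by (simp only: step_mean_const)
    qed
    also have "\<dots> = step_mean \<xi> g z + hit_within \<xi> {..< - int K} {- int K..<0} (Suc n) z
       + (killed_mean \<xi> {0..} ^^ Suc n) (\<lambda>_. 1) z"
      unfolding step_mean_add hit_within.simps funpow.simps o_apply killed_mean_def[of _ _
          "(killed_mean _ _ ^^ n) _"] ..
    also have "\<dots> \<le> g z + hit_within \<xi> {..< - int K} {- int K..<0} (Suc n) z
       + (killed_mean \<xi> {0..} ^^ Suc n) (\<lambda>_. 1) z"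
      using supg[OF Suc.prems] by (intro add_right_mono)
    finally show ?case .
  qed
  define z where "z = y - L"
  have z: "z \<ge> 0" using \<open>L \<le> y\<close> by (simp add: z_def)
  have "c \<le> g z + undershoot_tail K + (killed_mean \<xi> (- {0}) ^^ n) (\<lambda>_. 1) (1 + z)" for n
  proof -
    note main[OF z, of n]
    also have "g z + hit_within \<xi> {..< - int K} {- int K..<0} n z +
        (killed_mean \<xi> {0..} ^^ n) (\<lambda>_. 1) z
      \<le> g z + undershoot_tail K + (killed_mean \<xi> (- {0}) ^^ n) (\<lambda>_. 1) (1 + z)"
      using hit_within_undershoot_le[OF z, of K n] surv[of n z]
          by (intro add_mono) (simp_all add: tr)
    finally show ?thesis .
  qed
  moreover have "(\<lambda>n. g z + undershoot_tail K + (killed_mean \<xi> (- {0}) ^^ n) (\<lambda>_. 1) (1 + z))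
     \<longlonglongrightarrow> g z + undershoot_tail K + 0"
    by (intro tendsto_add tendsto_const survive_tendsto_0)
  ultimately have "c \<le> g z + undershoot_tail K + 0"
    by (intro tendsto_lowerbound[where a = c and f =
        "\<lambda>n. g z + undershoot_tail K + (killed_mean \<xi> (- {0}) ^^ n) (\<lambda>_. 1) (1 + z)"])
       (auto simp del: add_0_right)
  then show ?thesis by (simp add: g_def z_def)
qed

section \<open>Limits of harmonic functions at infinity\<close>

lemma prob_far_left_tendsto_0: "((\<lambda>N. measure_pmf.prob \<xi> {..<- N}) \<longlongrightarrow> 0) at_top"
proof (rule decreasing_tendsto)
  fix x :: real assume x: "0 < x"
  have "(\<lambda>n. measure_pmf.prob \<xi> {..<- int n}) \<longlonglongrightarrow> measure_pmf.prob \<xi> (\<Inter>n. {..<- int n})"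
    by (intro measure_pmf.finite_Lim_measure_decseq) (auto simp: decseq_def)
  moreover have "(\<Inter>n. {..<- int n}) = {}"
  proof -
    have "\<not> z < - int (nat \<bar>z\<bar>)" for z by auto
    then show ?thesis by blast
  qed
  ultimately have "eventually (\<lambda>n. measure_pmf.prob \<xi> {..<- int n} < x) sequentially"
    using x by (intro order_tendstoD) auto
  then obtain n where n: "measure_pmf.prob \<xi> {..<- int n} < x"
    by (auto simp: eventually_sequentially)
  have "measure_pmf.prob \<xi> {..<- N} < x" if "N \<ge> int n" for N
    using n that
    by (intro le_less_trans[OF measure_pmf.finite_measure_mono n]) auto
  then show "\<forall>\<^sub>F N in at_top. measure_pmf.prob \<xi> {..<- N} < x"
    by (auto simp: eventually_at_top_linorder)
qed auto

lemma int_shift_at_top: "filterlim (\<lambda>y::int. y + c) at_top at_top"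
  unfolding filterlim_at_top eventually_at_top_linorder
proof
  fix Z :: int
  have "\<forall>n\<ge>Z - c. Z \<le> n + c" by auto
  then show "\<exists>N. \<forall>n\<ge>N. Z \<le> n + c" by blast
qed

text \<open>A maximum principle with errors: if an average of values barely above \<open>s\<close>
  is close to \<open>s\<close>, then each value that carries fixed weight is close to
  \<open>s\<close> too.\<close>

lemma near_sup_propagates:
  fixes D :: "int \<Rightarrow> real"
  assumes D: "\<And>y. \<bar>D y\<bar> \<le> 1" and harm: "\<And>y. y \<ge> L \<Longrightarrow> D y = (\<integral>k. D (y + k) \<partial>measure_pmf \<xi>)"
    and s: "0 \<le> s" "\<And>e. e > 0 \<Longrightarrow> eventually (\<lambda>y. D y \<le> s + e) at_top"
    and z: "z \<in> set_pmf \<xi>" and e: "e > 0"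
  shows "\<exists>e'>0. eventually (\<lambda>y. D y \<ge> s - e' \<longrightarrow> D (y + z) \<ge> s - e) at_top"
proof -
  define p where "p = pmf \<xi> z"
  have p: "0 < p" using z by (simp add: p_def pmf_positive)
  \<comment> \<open>Three errors of size \<open>d\<close> enter: the deficit at \<open>y\<close>,
    the margin in the upper bound and the mass far to the left. Measured from \<open>s + d\<close>,
    the deficit at \<open>y + z\<close> is therefore below
    \<open>3 * d / p = 3 * e / 4\<close>.\<close>
  define d where "d = p * e / 4"
  have d: "d > 0" using p e by (simp add: d_def)
  obtain Y where Y: "\<And>y. y \<ge> Y \<Longrightarrow> D y \<le> s + d"
    using s(2)[OF d] by (auto simp: eventually_at_top_linorder)
  \<comment> \<open>Steps below \<open>- N\<close> may lead to where only \<open>D \<le> 1\<close>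
    is known; their probability is made smaller than \<open>d\<close>.\<close>
  have "eventually (\<lambda>N. measure_pmf.prob \<xi> {..<- N} < d) at_top"
    using prob_far_left_tendsto_0 d by (rule order_tendstoD)
  then obtain N where N: "measure_pmf.prob \<xi> {..<- N} < d"
    by (auto simp: eventually_at_top_linorder)
  have int: "integrable (measure_pmf \<xi>) f" if "\<And>k. \<bar>f k\<bar> \<le> B" for f :: "int \<Rightarrow> real" and B
    using that by (intro measure_pmf.integrable_const_bound[where B = B]) auto
  have "D (y + z) \<ge> s - e" if y: "y \<ge> max L (Y + N)" "y + z \<ge> Y" and Dy: "D y \<ge> s - d" for y
  proof -
    have i1: "integrable (measure_pmf \<xi>) (\<lambda>k. indicator {..<- N} k :: real)"
      and i2: "integrable (measure_pmf \<xi>) (\<lambda>k. indicator {z} k * (D (y + z) - (s + d)))"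
      by (auto intro!: integrable_mult_left int[of _ 1] simp: indicator_def)
    have "D y \<le> (\<integral>k. s + d + indicator {..<- N} k + indicator {z} k *
        (D (y + z) - (s + d)) \<partial>measure_pmf \<xi>)"
    proof -
      have "D (y + k) \<le> s + d + indicator {..<- N} k + indicator {z} k * (D (y + z) - (s + d))"
          for k
      proof (cases "k = z")
        case False
        have "D (y + k) \<le> 1" using D[of "y + k"] by simp
        with False s(1) d Y[of "y + k"] y show ?thesis
          by (cases "k < - N") (auto simp: indicator_def)
      qed (auto simp: indicator_def)
      moreover have "integrable (measure_pmf \<xi>) (\<lambda>k. D (y + k))" using D by (rule int)
      moreover have "integrable (measure_pmf \<xi>)
          (\<lambda>k. s + d + indicator {..<- N} k + indicator {z} k * (D (y + z) - (s + d)))"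
        by (intro Bochner_Integration.integrable_add i1 i2 measure_pmf.integrable_const)
      ultimately have "(\<integral>k. D (y + k) \<partial>measure_pmf \<xi>) \<le>
          (\<integral>k. s + d + indicator {..<- N} k + indicator {z} k *
              (D (y + z) - (s + d)) \<partial>measure_pmf \<xi>)"
        by (intro integral_mono) auto
      then show ?thesis using harm[of y] y by simp
    qed
    also have "\<dots> = s + d + measure_pmf.prob \<xi> {..<- N} + p * (D (y + z) - (s + d))"
      using i1 i2 by (simp add: p_def measure_pmf_single)
    finally have "s - d < s + d + d + p * (D (y + z) - (s + d))" using N Dy by linarith
    then have "p * (s + d - D (y + z)) < p * (3 * e / 4)"
      by (simp add: d_def algebra_simps)
    then have "s + d - D (y + z) < 3 * e / 4" using p mult_less_cancel_left_pos by blast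
    with d e show ?thesis by simp
  qed
  moreover have "eventually (\<lambda>y. y \<ge> max L (Y + N) \<and> y + z \<ge> Y) at_top"
    by (auto simp: eventually_at_top_linorder intro!: exI[of _ "max (max L (Y + N)) (Y - z)"])
  ultimately show ?thesis
    using d by (intro exI[of _ d]) (auto elim: eventually_mono)
qed

text \<open>A version at infinity of the Choquet--Deny theorem: if the increments of \<open>h\<close> had a positive
  limsup, then near-maximal increments would repeat along an arithmetic progression.\<close>

lemma increment_eventually_le:
  fixes h :: "int \<Rightarrow> real"
  assumes h: "\<And>y. 0 \<le> h y" "\<And>y. h y \<le> 1"
    and harm: "\<And>y. y \<ge> L \<Longrightarrow> h y = (\<integral>k. h (y + k) \<partial>measure_pmf \<xi>)"
    and z: "z \<in> set_pmf \<xi>" and e: "e > 0"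
  shows "eventually (\<lambda>y. h (y + z) - h y \<le> e) at_top"
proof (rule ccontr)
  assume neg: "\<not> ?thesis"
  define D where "D y = h (y + z) - h y" for y
  have D: "\<bar>D y\<bar> \<le> 1" for y using h(1)[of y] h(2)[of y] h(1)[of "y + z"] h(2)[of "y + z"]
      by (simp add: D_def)
  have int: "integrable (measure_pmf \<xi>) (\<lambda>k. h (y + k))" for y
    using h by (intro measure_pmf.integrable_const_bound[where B = 1]) auto
  have harmD: "D y = (\<integral>k. D (y + k) \<partial>measure_pmf \<xi>)" if "y \<ge> max L (L - z)" for y
  proof -
    have "D y = (\<integral>k. h (y + z + k) \<partial>measure_pmf \<xi>) - (\<integral>k. h (y + k) \<partial>measure_pmf \<xi>)"
      unfolding D_def using that by (subst (1 2) harm) auto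
    also have "\<dots> = (\<integral>k. h (y + z + k) - h (y + k) \<partial>measure_pmf \<xi>)"
      by (intro Bochner_Integration.integral_diff[symmetric] int)
    finally show ?thesis by (simp add: D_def ac_simps)
  qed
  \<comment> \<open>The infimum \<open>s\<close> of \<open>U\<close> is the limsup of
    \<open>D\<close> at infinity, and the negated claim forces \<open>s \<ge> e > 0\<close>.\<close>
  define U where "U = {c. eventually (\<lambda>y. D y \<le> c) at_top}"
  have U1: "1 \<in> U" using D by (auto simp: U_def abs_le_iff)
  have Ulow: "c \<ge> e" if "c \<in> U" for c
  proof (rule ccontr)
    assume "\<not> c \<ge> e"
    with that have "eventually (\<lambda>y. D y \<le> e) at_top"
      unfolding U_def by (auto elim!: eventually_mono)
    then show False using neg by (simp add: D_def)
  qed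
  define s where "s = Inf U"
  have s: "e \<le> s" unfolding s_def using U1 Ulow by (intro cInf_greatest) auto
  have up: "eventually (\<lambda>y. D y \<le> s + d) at_top" if "d > 0" for d
  proof -
    have "Inf U < s + d" using that by (simp add: s_def)
    then obtain c where "c \<in> U" "c < s + d" using cInf_lessD[of U "s + d"] U1 by auto
    then show ?thesis by (auto simp: U_def elim!: eventually_mono)
  qed
  have freq0: "frequently (\<lambda>y. D y \<ge> s - d) at_top" if "d > 0" for d
  proof (rule ccontr)
    assume "\<not> ?thesis"
    then have "s - d \<in> U" by (auto simp: U_def frequently_def elim!: eventually_mono)
    then have "s \<le> s - d" unfolding s_def using Ulow
        by (intro cInf_lower) (auto simp: bdd_below_def)
    with that show False by simp
  qed
  \<comment> \<open>Near-maximality is passed on \<open>j\<close> times; the tolerances are chosen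
    backwards, from the last increment to the first.\<close>
  have freq: "\<exists>d'>0. eventually (\<lambda>y. D y \<ge> s - d' \<longrightarrow> (\<forall>i\<le>j. D (y + int i * z) \<ge> s - d)) at_top"
      if "d > 0" for d and j :: nat
    using that
  proof (induction j arbitrary: d)
    case 0
    then show ?case by (intro exI[of _ d]) auto
  next
    case (Suc j)
    obtain d1 where d1: "d1 > 0" "eventually (\<lambda>y. D y \<ge> s - d1 \<longrightarrow> D (y + z) \<ge> s - d) at_top"
      using near_sup_propagates[of D "max L (L - z)" s z d, OF D harmD _ up z Suc.prems] s e by auto
    obtain d2 where d2: "d2 > 0" "eventually (\<lambda>y. D y \<ge> s - d2 \<longrightarrow>
        (\<forall>i\<le>j. D (y + int i * z) \<ge> s - min d d1)) at_top"
      using Suc.IH[of "min d d1"] Suc.prems d1 by auto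
    have "eventually (\<lambda>y. D (y + int j * z) \<ge> s - d1 \<longrightarrow> D (y + int j * z + z) \<ge> s - d) at_top"
      using eventually_compose_filterlim[OF d1(2) int_shift_at_top[of "int j * z"]] by simp
    with d2(2) have "eventually (\<lambda>y. D y \<ge> s - d2 \<longrightarrow> (\<forall>i\<le>Suc j. D (y + int i * z) \<ge> s - d)) at_top"
    proof eventually_elim
      case (elim y)
      show ?case
      proof (intro impI allI)
        fix i assume *: "D y \<ge> s - d2" "i \<le> Suc j"
        show "s - d \<le> D (y + int i * z)"
        proof (cases "i = Suc j")
          case True
          have "D (y + int j * z) \<ge> s - min d d1" using elim(1) * by blast
          then have "D (y + int j * z + z) \<ge> s - d" using elim(2) by simp
          then show ?thesis using True by (simp add: algebra_simps)
        next
          case False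
          with * have "i \<le> j" by simp
          with elim(1) * have "D (y + int i * z) \<ge> s - min d d1" by blast
          then show ?thesis by simp
        qed
      qed
    qed
    with d2(1) show ?case by blast
  qed
  \<comment> \<open>The sum of \<open>J\<close> consecutive increments of size at least
    \<open>s / 2\<close> telescopes and would move \<open>h\<close> by more than 1.\<close>
  obtain J :: nat where J: "real J * (s / 2) > 1"
    using s e reals_Archimedean3[of "s / 2"] by (metis half_gt_zero less_le_trans)
  obtain d' where d': "d' > 0" "eventually (\<lambda>y. D y \<ge> s - d' \<longrightarrow>
      (\<forall>i\<le>J. D (y + int i * z) \<ge> s - s / 2)) at_top"
    using freq[of "s / 2" J] s e by auto
  have "\<exists>y. D y \<ge> s - d' \<and> (D y \<ge> s - d' \<longrightarrow> (\<forall>i\<le>J. D (y + int i * z) \<ge> s - s / 2))"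
    using frequently_eventually_frequently[OF freq0[OF d'(1)] d'(2)] by (rule frequently_ex)
  then obtain y where y: "\<forall>i\<le>J. D (y + int i * z) \<ge> s - s / 2" by blast
  have "(\<Sum>i<J. s / 2) \<le> (\<Sum>i<J. D (y + int i * z))"
  proof (rule sum_mono)
    fix i assume "i \<in> {..<J}"
    then have "D (y + int i * z) \<ge> s - s / 2" using y by simp
    then show "s / 2 \<le> D (y + int i * z)" by simp
  qed
  also have "\<dots> = h (y + int J * z) - h y"
    by (induction J) (simp_all add: D_def algebra_simps)
  finally have "real J * (s / 2) \<le> h (y + int J * z) - h y" by simp
  with J h(2)[of "y + int J * z"] h(1)[of y] show False by simp
qed

text \<open>For a step \<open>k\<close> in the support the one-sided bound is applied to
  \<open>h\<close> and to \<open>1 - h\<close>. Increments add along paths, so irreducibility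
  extends the limit to every shift.\<close>

lemma increment_tendsto_0:
  fixes h :: "int \<Rightarrow> real"
  assumes h: "\<And>y. 0 \<le> h y" "\<And>y. h y \<le> 1"
    and harm: "\<And>y. y \<ge> L \<Longrightarrow> h y = (\<integral>k. h (y + k) \<partial>measure_pmf \<xi>)"
  shows "((\<lambda>y. h (y + z) - h y) \<longlongrightarrow> 0) at_top"
proof (rule irreducible_closure[OF irreducible, where x = 0])
  have int: "integrable (measure_pmf \<xi>) (\<lambda>k. h (y + k))" for y
    using h by (intro measure_pmf.integrable_const_bound[where B = 1]) auto
  fix z k assume z: "((\<lambda>y. h (y + z) - h y) \<longlongrightarrow> 0) at_top" and k: "k \<in> set_pmf \<xi>"
  have "((\<lambda>y. h (y + k) - h y) \<longlongrightarrow> 0) at_top"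
  proof (rule tendstoI)
    fix e :: real assume e: "e > 0"
    have 1: "eventually (\<lambda>y. h (y + k) - h y \<le> e / 2) at_top"
      using e by (intro increment_eventually_le[OF h harm k]) auto
    have 2: "eventually (\<lambda>y. (1 - h (y + k)) - (1 - h y) \<le> e / 2) at_top"
    proof (rule increment_eventually_le[where L = L])
      show "1 - h y = (\<integral>k. 1 - h (y + k) \<partial>measure_pmf \<xi>)" if "y \<ge> L" for y
        using harm[OF that] int[of y] by simp
    qed (use h k e in auto)
    show "eventually (\<lambda>y. dist (h (y + k) - h y) 0 < e) at_top"
      using 1 2 by eventually_elim (use e in \<open>auto simp: dist_real_def\<close>)
  qed
  from filterlim_compose[OF this int_shift_at_top[of z]] z
  have "((\<lambda>y. (h (y + z + k) - h (y + z)) + (h (y + z) - h y)) \<longlongrightarrow> 0 + 0) at_top"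
    by (intro tendsto_add)
  then show "((\<lambda>y. h (y + (z + k)) - h y) \<longlongrightarrow> 0) at_top"
    by (simp add: add.assoc)
qed simp

lemma harmonic_ge_near_boundary:
  fixes h :: "int \<Rightarrow> real"
  assumes h: "\<And>y. 0 \<le> h y" "\<And>y. h y \<le> 1"
    and harm: "\<And>y. y \<ge> L \<Longrightarrow> h y = (\<integral>k. h (y + k) \<partial>measure_pmf \<xi>)"
    and c: "c \<le> 1" "\<And>z. L - int K \<le> z \<Longrightarrow> z < L \<Longrightarrow> c \<le> h z"
    and t: "undershoot_tail K \<le> ennreal e" "0 \<le> e" and y: "L \<le> y"
  shows "c \<le> h y + e"
proof -
  have "ennreal c \<le> ennreal (h y) + undershoot_tail K"
  proof (rule superharmonic_ge_near_boundary[where L = L])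
    fix y assume "L \<le> y"
    have "step_mean \<xi> (\<lambda>z. ennreal (h z)) y = ennreal (\<integral>k. h (y + k) \<partial>measure_pmf \<xi>)"
      unfolding step_mean_def using h
      by (intro nn_integral_eq_integral measure_pmf.integrable_const_bound[where B = 1]) auto
    with harm[OF \<open>L \<le> y\<close>] show "step_mean \<xi> (\<lambda>z. ennreal (h z)) y \<le> ennreal (h y)" by simp
  qed (use c y in \<open>auto intro: ennreal_leI\<close>)
  also have "\<dots> \<le> ennreal (h y) + ennreal e" by (intro add_left_mono t)
  also have "\<dots> = ennreal (h y + e)" using h t by simp
  finally show ?thesis using h(1)[of y] t(2) by (subst (asm) ennreal_le_iff) auto
qed

lemma undershoot_tail_small: "e > 0 \<Longrightarrow> \<exists>K. undershoot_tail K \<le> ennreal e"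
proof -
  assume "e > 0"
  then have "eventually (\<lambda>K. undershoot_tail K < ennreal e) sequentially"
    using undershoot_tail_tendsto_0 by (intro order_tendstoD) auto
  then show ?thesis by (auto simp: eventually_sequentially intro: less_imp_le)
qed

text \<open>Vanishing increments make \<open>h\<close> nearly constant on a window of length
  \<open>K\<close>. By tightness of the undershoot, all values to the right are then close to the
  value on the window: from below by the estimate for \<open>h\<close>, from above by that for
  \<open>1 - h\<close>.\<close>

lemma harmonic_at_top_convergent:
  fixes h :: "int \<Rightarrow> real"
  assumes h: "\<And>y. 0 \<le> h y" "\<And>y. h y \<le> 1"
    and harm: "\<And>y. y \<ge> L \<Longrightarrow> h y = (\<integral>k. h (y + k) \<partial>measure_pmf \<xi>)"
  shows "\<exists>l. (h \<longlongrightarrow> l) at_top"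
proof -
  have int: "integrable (measure_pmf \<xi>) (\<lambda>k. h (y + k))" for y
    using h by (intro measure_pmf.integrable_const_bound[where B = 1]) auto
  have osc: "\<exists>Y. \<forall>y\<ge>Y. \<bar>h y - h Y\<bar> \<le> e" if e: "e > 0" for e
  proof -
    obtain K where K: "undershoot_tail K \<le> ennreal (e / 2)"
        using undershoot_tail_small[of "e / 2"] e by auto
    \<comment> \<open>Only finitely many shifts occur, so their increments are small
      simultaneously.\<close>
    have "eventually (\<lambda>y. \<forall>i\<in>{- int K..0}. \<bar>h (y + i) - h y\<bar> \<le> e / 2) at_top"
      unfolding eventually_ball_finite_distrib[OF finite_atLeastAtMost_int]
    proof
      fix i
      have "eventually (\<lambda>y. dist (h (y + i) - h y) 0 < e / 2) at_top"
        using increment_tendsto_0[OF h harm] e by (intro tendstoD) auto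
      then show "eventually (\<lambda>y. \<bar>h (y + i) - h y\<bar> \<le> e / 2) at_top"
        by eventually_elim (simp add: dist_real_def)
    qed
    then obtain Y0 where Y0: "\<And>y i. y \<ge> Y0 \<Longrightarrow> i \<in> {- int K..0} \<Longrightarrow> \<bar>h (y + i) - h y\<bar> \<le> e / 2"
      unfolding eventually_at_top_linorder by blast
    define Y where "Y = max L Y0"
    have near: "\<bar>h z - h Y\<bar> \<le> e / 2" if "Y + 1 - int K \<le> z" "z < Y + 1" for z
      using Y0[of Y "z - Y"] that by (auto simp: Y_def)
    have "\<bar>h y - h Y\<bar> \<le> e" if "y \<ge> Y" for y
    proof (cases "y = Y")
      case False
      with that have y: "Y + 1 \<le> y" by simp
      have "h Y - e / 2 \<le> h y + e / 2"
      proof (rule harmonic_ge_near_boundary[where L = "Y + 1" and K = K, OF h])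
        show "h Y - e / 2 \<le> h z" if "Y + 1 - int K \<le> z" "z < Y + 1" for z
          using near[OF that] by linarith
      qed (use harm h(2)[of Y] e K y in \<open>auto simp: Y_def\<close>)
      moreover have "(1 - h Y) - e / 2 \<le> (1 - h y) + e / 2"
      proof (rule harmonic_ge_near_boundary[where L = "Y + 1" and K = K])
        show "1 - h Y - e / 2 \<le> 1 - h z" if "Y + 1 - int K \<le> z" "z < Y + 1" for z
          using near[OF that] by linarith
        show "1 - h z = (\<integral>k. 1 - h (z + k) \<partial>measure_pmf \<xi>)" if "Y + 1 \<le> z" for z
        proof -
          have "h z = (\<integral>k. h (z + k) \<partial>measure_pmf \<xi>)" using that by (intro harm) (simp add: Y_def)
          then show ?thesis using int[of z] by simp
        qed
        show "1 - h Y - e / 2 \<le> 1" using h(1)[of Y] e by linarith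
      qed (use h e K y in auto)
      ultimately show ?thesis by (simp add: abs_le_iff)
    qed (use e in simp)
    then show ?thesis by blast
  qed
  have "Cauchy (\<lambda>n. h (int n))"
  proof (rule metric_CauchyI)
    fix e :: real assume e: "e > 0"
    obtain Y where Y: "\<And>y. y \<ge> Y \<Longrightarrow> \<bar>h y - h Y\<bar> \<le> e / 3" using osc[of "e / 3"] e by auto
    have "dist (h (int m)) (h (int n)) < e" if "m \<ge> nat Y" "n \<ge> nat Y" for m n
    proof -
      have "\<bar>h (int m) - h Y\<bar> \<le> e / 3" "\<bar>h (int n) - h Y\<bar> \<le> e / 3"
        using that by (intro Y, simp add: nat_le_iff)+
      then show ?thesis using e unfolding dist_real_def by linarith
    qed
    then show "\<exists>M. \<forall>m\<ge>M. \<forall>n\<ge>M. dist (h (int m)) (h (int n)) < e" by blast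
  qed
  then obtain l where l: "(\<lambda>n. h (int n)) \<longlonglongrightarrow> l"
    using Cauchy_convergent convergent_def by blast
  have "(h \<longlongrightarrow> l) at_top"
  proof (rule tendstoI)
    fix e :: real assume e: "e > 0"
    obtain Y where Y: "\<And>y. y \<ge> Y \<Longrightarrow> \<bar>h y - h Y\<bar> \<le> e / 3" using osc[of "e / 3"] e by auto
    have "\<bar>l - h Y\<bar> \<le> e / 3"
    proof (rule tendsto_upperbound)
      show "(\<lambda>n. \<bar>h (int n) - h Y\<bar>) \<longlonglongrightarrow> \<bar>l - h Y\<bar>" by (intro tendsto_intros l)
      show "eventually (\<lambda>n. \<bar>h (int n) - h Y\<bar> \<le> e / 3) sequentially"
        using Y by (auto simp: eventually_sequentially nat_le_iff intro!: exI[of _ "nat Y"])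
    qed simp
    then have "dist (h y) l < e" if "y \<ge> Y" for y
      using Y[OF that] e unfolding dist_real_def by linarith
    then show "eventually (\<lambda>y. dist (h y) l < e) at_top" by (auto simp: eventually_at_top_linorder)
  qed
  then show ?thesis by blast
qed

section \<open>Lower bounds for the gluing measure\<close>

lemma centred_walk_reflect: "centred_walk (map_pmf uminus \<xi>)"
proof
  show "irreducible_steps (map_pmf uminus \<xi>)" by (rule irreducible_steps_reflect[OF irreducible])
  show "integrable (measure_pmf (map_pmf uminus \<xi>)) (\<lambda>k. \<bar>real_of_int k\<bar>\<^sup>2)"
    using integrable_square by (simp add: map_pmf_rep_eq integrable_distr_eq)
  show "measure_pmf.expectation (map_pmf uminus \<xi>) (\<lambda>k. real_of_int k) = 0"
    using mean_zero by simp
qed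

text \<open>As time 0 is ignored, \<open>hit_before\<close> does not take the values 0 and 1 on
  \<open>A\<close> and \<open>B\<close>. With these values put in, the average over one step equals
  \<open>hit_before\<close> everywhere.\<close>

definition boundary_ext :: "int set \<Rightarrow> int set \<Rightarrow> int \<Rightarrow> real" where
  "boundary_ext B A z = (if z \<in> A then 0 else if z \<in> B then 1 else hit_before \<xi> z B A)"

lemma boundary_ext_bounds: "0 \<le> boundary_ext B A z" "boundary_ext B A z \<le> 1"
  by (auto simp: boundary_ext_def hit_before_nonneg hit_before_le_1)

lemma hit_before_eq_integral: "hit_before \<xi> y B A = (\<integral>k. boundary_ext B A (y + k) \<partial>measure_pmf \<xi>)"
proof -
  have "ennreal (hit_before \<xi> y B A) = step_mean \<xi> (\<lambda>z. ennreal (boundary_ext B A z)) y"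
    unfolding hit_before_harmonic[of \<xi> y B A] step_mean_def boundary_ext_def
    by (intro nn_integral_cong) auto
  also have "\<dots> = ennreal (\<integral>k. boundary_ext B A (y + k) \<partial>measure_pmf \<xi>)"
    unfolding step_mean_def using boundary_ext_bounds
    by (intro nn_integral_eq_integral measure_pmf.integrable_const_bound[where B = 1]) auto
  finally show ?thesis
    by (subst (asm) ennreal_inj) (auto simp: hit_before_nonneg boundary_ext_bounds)
qed

lemma hit_before_convergent:
  assumes "finite A" "finite B"
  shows "\<exists>l. ((\<lambda>y. hit_before \<xi> y B A) \<longlongrightarrow> l) at_top"
proof -
  define L where "L = Max (insert 0 (A \<union> B)) + 1"
  have "z \<le> Max (insert 0 (A \<union> B))" if "z \<in> A \<union> B" for z
    using that assms by (intro Max_ge) auto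
  then have L: "boundary_ext B A y = hit_before \<xi> y B A" if "y \<ge> L" for y
    using that by (fastforce simp: L_def boundary_ext_def)
  have harm: "boundary_ext B A y = (\<integral>k. boundary_ext B A (y + k) \<partial>measure_pmf \<xi>)" if "y \<ge> L" for y
    using L[OF that] hit_before_eq_integral[of y B A] by simp
  obtain l where "(boundary_ext B A \<longlongrightarrow> l) at_top"
    using harmonic_at_top_convergent[OF boundary_ext_bounds harm] by blast
  moreover have "eventually (\<lambda>y. boundary_ext B A y = hit_before \<xi> y B A) at_top"
    using L by (auto simp: eventually_at_top_linorder)
  ultimately have "((\<lambda>y. hit_before \<xi> y B A) \<longlongrightarrow> l) at_top"
    by (rule Lim_transform_eventually)
  then show ?thesis ..
qed

text \<open>A path that meets neither target for \<open>n\<close> steps avoids 0 for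
  \<open>n\<close> steps, and recurrence makes this probability vanish.\<close>

lemma hit_before_complement:
  assumes "0 \<notin> A"
  shows "1 \<le> hit_before \<xi> z {0} A + hit_before \<xi> z A {0}"
proof -
  let ?S = "\<lambda>n z. (killed_mean \<xi> (- {0}) ^^ n) (\<lambda>_. 1) z"
  have fin: "1 \<le> hit_within \<xi> {0} A n z + hit_within \<xi> A {0} n z + ?S n z" for n z
  proof (induction n arbitrary: z)
    case (Suc n)
    let ?f = "\<lambda>z. if z \<in> A then 0 else if z \<in> {0} then 1 else hit_within \<xi> {0} A n z"
    let ?g = "\<lambda>z. if z \<in> {0} then 0 else if z \<in> A then 1 else hit_within \<xi> A {0} n z"
    have "1 \<le> ?f w + ?g w + indicator (- {0}) w * ?S n w" for w
      using Suc[of w] assms by (auto simp: add_increasing2)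
    then have "step_mean \<xi> (\<lambda>_. 1) z \<le>
        step_mean \<xi> (\<lambda>w. ?f w + ?g w + indicator (- {0}) w * ?S n w) z"
      by (intro step_mean_mono)
    then show ?case
      unfolding step_mean_add step_mean_const hit_within.simps funpow.simps o_apply
        killed_mean_def[of _ _ "(killed_mean _ _ ^^ n) _"] .
  qed simp
  define t where "t = ennreal (hit_before \<xi> z {0} A) + ennreal (hit_before \<xi> z A {0})"
  have "1 \<le> t + ?S n z" for n
    using order_trans[OF fin[of n z]] unfolding t_def
    by (meson add_mono add_right_mono hit_within_le_hit_before)
  moreover have "(\<lambda>n. t + ?S n z) \<longlonglongrightarrow> t + 0"
    by (intro tendsto_add tendsto_const survive_tendsto_0)
  ultimately have "1 \<le> t + 0"
    by (intro tendsto_lowerbound[where f = "\<lambda>n. t + ?S n z"]) (auto simp del: add_0_right)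
  then have "ennreal 1 \<le> ennreal (hit_before \<xi> z {0} A + hit_before \<xi> z A {0})"
    by (simp add: t_def hit_before_nonneg)
  then show ?thesis
    by (subst (asm) ennreal_le_iff) (auto simp: hit_before_nonneg)
qed

lemma hit_before_far_small:
  assumes "e > 0"
  shows "\<exists>m0>0. \<forall>m\<ge>m0. \<forall>A. (\<forall>a\<in>A. m \<le> \<bar>real_of_int a\<bar>) \<longrightarrow> hit_before \<xi> z A {0} \<le> e"
proof -
  obtain C m0 where C: "C < (\<infinity>::ennreal)"
    "\<And>m A n. m0 \<le> m \<Longrightarrow> (\<And>a. a \<in> A \<Longrightarrow> m \<le> \<bar>real_of_int a\<bar>) \<Longrightarrow> ennreal m * hit_within \<xi> A {0} n z \<le> C"
    using hit_within_far_le[of z] by metis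
  obtain c where c: "C = ennreal c" "0 \<le> c" using C(1) by (cases C) auto
  define m1 where "m1 = max (max m0 1) (c / e)"
  have "hit_before \<xi> z A {0} \<le> e" if m: "m \<ge> m1" and A: "\<forall>a\<in>A. m \<le> \<bar>real_of_int a\<bar>" for m A
  proof -
    have m': "m \<ge> m0" "m > 0" "c / e \<le> m" using m by (auto simp: m1_def)
    have "hit_within \<xi> A {0} n z \<le> ennreal e" for n
    proof -
      have "ennreal m * hit_within \<xi> A {0} n z \<le> ennreal c"
        using C(2)[of m A n] A m'(1) c by auto
      then have "ennreal (1 / m) * (ennreal m * hit_within \<xi> A {0} n z) \<le>
          ennreal (1 / m) * ennreal c"
        by (rule mult_left_mono) simp
      also have "\<dots> = ennreal (c / m)" using m' c by (simp add: ennreal_mult[symmetric])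
      also have "\<dots> \<le> ennreal e" using m' assms by (intro ennreal_leI) (simp add: field_simps)
      finally show ?thesis
        using m' by (simp add: mult.assoc[symmetric] ennreal_mult[symmetric])
    qed
    then have "ennreal (hit_before \<xi> z A {0}) \<le> ennreal e"
      unfolding hit_before_conv_SUP by (intro SUP_least)
    then show ?thesis using assms by (subst (asm) ennreal_le_iff) auto
  qed
  moreover have "m1 > 0" by (simp add: m1_def)
  ultimately show ?thesis by blast
qed

text \<open>First \<open>K\<close> is fixed with undershoot probability at most 1/4. Then
  \<open>m\<close> is taken so large that from each of the finitely many points of the window below
  1 the far set precedes 0 with probability at most 1/4. What remains is
  \<open>3/4 - 1/4\<close>.\<close>

lemma hit_before_from_infinity_ge_half:
  "\<exists>m0>0. \<forall>m\<ge>m0. \<forall>A. (\<forall>a\<in>A. real_of_int a \<le> - m) \<longrightarrow> (\<forall>y\<ge>1. 1 / 2 \<le> hit_before \<xi> y {0} A)"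
proof -
  obtain K where K: "undershoot_tail K \<le> ennreal (1 / 4)" using undershoot_tail_small[of "1 / 4"]
      by auto
  have "\<forall>z. \<exists>m0>0. \<forall>m\<ge>m0. \<forall>A. (\<forall>a\<in>A. m \<le> \<bar>real_of_int a\<bar>) \<longrightarrow> hit_before \<xi> z A {0} \<le> 1 / 4"
    using hit_before_far_small[of "1 / 4"] by simp
  then obtain f where f: "\<And>z. f z > (0::real)"
    "\<And>z m A. m \<ge> f z \<Longrightarrow> (\<forall>a\<in>A. m \<le> \<bar>real_of_int a\<bar>) \<Longrightarrow> hit_before \<xi> z A {0} \<le> 1 / 4"
    by metis
  \<comment> \<open>The entry \<open>real K + 1\<close> puts \<open>A\<close> below the window; the
    others are the thresholds of its points.\<close>
  define m0 where "m0 = Max (insert (real K + 1) (f ` {- int K..0}))"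
  have m0: "real K + 1 \<le> m0" "z \<in> {- int K..0} \<Longrightarrow> f z \<le> m0" for z
    unfolding m0_def by (auto intro!: Max_ge simp del: Max_insert)
  have "1 / 2 \<le> hit_before \<xi> y {0} A" if m: "m \<ge> m0" and A: "\<forall>a\<in>A. real_of_int a \<le> - m" and y:
      "y \<ge> 1" for m A y
  proof -
    have pos: "z \<notin> A" if "z \<ge> - int K" for z using A m m0(1) that by force
    have harm: "boundary_ext {0} A w = (\<integral>k. boundary_ext {0} A (w + k) \<partial>measure_pmf \<xi>)" if "w \<ge> 1"
        for w
      using that pos[of w] hit_before_eq_integral[of w "{0}" A] by (simp add: boundary_ext_def)
    have "3 / 4 \<le> boundary_ext {0} A y + 1 / 4"
    proof (rule harmonic_ge_near_boundary[where L = 1 and K = K, OF boundary_ext_bounds harm])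
      fix z assume z: "1 - int K \<le> z" "z < (1::int)"
      show "3 / 4 \<le> boundary_ext {0} A z"
      proof (cases "z = 0")
        case False
        have "m \<ge> f z" using m0(2)[of z] m z by auto
        moreover have "m \<le> \<bar>real_of_int a\<bar>" if "a \<in> A" for a using A that by force
        ultimately have "hit_before \<xi> z A {0} \<le> 1 / 4" using f(2) by blast
        then have "3 / 4 \<le> hit_before \<xi> z {0} A"
          using hit_before_complement[of A z] pos[of 0] by simp
        with False pos[of z] z show ?thesis by (simp add: boundary_ext_def)
      qed (use pos[of 0] in \<open>simp add: boundary_ext_def\<close>)
    qed (use K y in auto)
    then show ?thesis using y pos[of y] by (simp add: boundary_ext_def)
  qed
  moreover have "m0 > 0" using m0(1) by linarith
  ultimately show ?thesis by blast
qed

lemma escape_le: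
  assumes "0 < m" "\<And>a. a \<in> A \<Longrightarrow> m \<le> \<bar>real_of_int (a - x)\<bar>"
  shows "m * hit_before \<xi> x A {x} \<le> enn2real total_excess"
proof -
  have eq: "hit_before \<xi> x A {x} = hit_before \<xi> 0 ((+) (- x) ` A) {0}"
    using hit_before_translate[of \<xi> "- x" x A "{x}"] by simp
  have "hit_within \<xi> ((+) (- x) ` A) {0} n 0 \<le> ennreal (enn2real total_excess / m)" for n
  proof -
    have "ennreal m * hit_within \<xi> ((+) (- x) ` A) {0} n 0 \<le> total_excess"
      using assms by (intro escape_within_le) auto
    also have "\<dots> = ennreal (enn2real total_excess)" using total_excess_finite by simp
    finally have "ennreal (1 / m) * (ennreal m * hit_within \<xi> ((+) (- x) ` A) {0} n 0)
      \<le> ennreal (1 / m) * ennreal (enn2real total_excess)"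
      by (rule mult_left_mono) simp
    then show ?thesis using assms(1) by (simp add: mult.assoc[symmetric] ennreal_mult[symmetric])
  qed
  then have "ennreal (hit_before \<xi> x A {x}) \<le> ennreal (enn2real total_excess / m)"
    unfolding eq hit_before_conv_SUP by (intro SUP_least)
  then have "hit_before \<xi> x A {x} \<le> enn2real total_excess / m"
    using assms(1) by (subst (asm) ennreal_le_iff) auto
  then show ?thesis using assms(1) by (simp add: field_simps)
qed

text \<open>One direct step to \<open>a\<close> is an escape. This makes the denominator of
  \<open>gluing\<close> positive whenever its factor \<open>pmf \<xi> (a - x)\<close> is.\<close>

lemma pmf_le_escape:
  assumes "a \<in> A" "a \<noteq> x"
  shows "pmf \<xi> (a - x) \<le> hit_before \<xi> x A {x}"
proof -
  have "ennreal (pmf \<xi> (a - x)) \<le> ennreal (hit_before \<xi> x A {x})"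
    unfolding hit_before_harmonic[of \<xi> x A "{x}"]
    using step_mean_ge[of \<xi> "a - x"
        "\<lambda>z. if z \<in> {x} then 0 else if z \<in> A then 1 else ennreal (hit_before \<xi> z A {x})" x] assms
    by simp
  then show ?thesis by (subst (asm) ennreal_le_iff) (auto simp: hit_before_nonneg)
qed

text \<open>\<open>Lim\<close> carries information only once convergence is known. The limit at
  \<open>at_bot\<close> is the limit at \<open>at_top\<close> for the reflected walk.\<close>

lemma hit_before_limits:
  assumes "finite A"
  obtains l r where "((\<lambda>y. hit_before \<xi> y {x} A) \<longlongrightarrow> r) at_top"
      "((\<lambda>y. hit_before \<xi> y {x} A) \<longlongrightarrow> l) at_bot"
    "0 \<le> l" "0 \<le> r" "hit_before_infinity \<xi> {x} A = (r + l) / 2"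
proof -
  interpret refl: centred_walk "map_pmf uminus \<xi>" by (rule centred_walk_reflect)
  obtain r where r: "((\<lambda>y. hit_before \<xi> y {x} A) \<longlongrightarrow> r) at_top"
    using hit_before_convergent[of A "{x}"] assms by auto
  obtain l where "((\<lambda>y. hit_before (map_pmf uminus \<xi>) y (uminus ` {x}) (uminus ` A)) \<longlongrightarrow> l) at_top"
    using refl.hit_before_convergent[of "uminus ` A" "uminus ` {x}"] assms by auto
  moreover have "hit_before (map_pmf uminus \<xi>) y (uminus ` {x}) (uminus ` A) =
      hit_before \<xi> (- y) {x} A" for y
    using hit_before_reflect[of \<xi> "- y" "{x}" A] by simp
  ultimately have l: "((\<lambda>y. hit_before \<xi> y {x} A) \<longlongrightarrow> l) at_bot"
    by (simp add: at_bot_mirror[where 'a = int] filterlim_filtermap)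
  have "0 \<le> l" "0 \<le> r"
    by (rule tendsto_lowerbound[OF l] tendsto_lowerbound[OF r]; simp add: hit_before_nonneg
        trivial_limit_at_bot_linorder)+
  moreover have "hit_before_infinity \<xi> {x} A = (r + l) / 2"
    unfolding hit_before_infinity_def using tendsto_Lim[OF _ l] tendsto_Lim[OF _ r]
    by (simp add: trivial_limit_at_bot_linorder)
  ultimately show ?thesis using that l r by blast
qed

lemma hit_before_infinity_nonneg: "finite A \<Longrightarrow> 0 \<le> hit_before_infinity \<xi> {x} A"
  by (metis hit_before_limits add_nonneg_nonneg divide_nonneg_pos zero_less_numeral)

lemma gluing_nonneg: "finite S \<Longrightarrow> 0 \<le> gluing \<xi> x a S"
  unfolding gluing_def by (simp add: hit_before_infinity_nonneg hit_before_nonneg)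

lemma gluing_right_ge:
  "\<exists>c>0. \<exists>m0>0. \<forall>m\<ge>m0. \<forall>S x. finite S \<longrightarrow> (\<forall>b\<in>S. real_of_int b + m \<le> real_of_int x) \<longrightarrow>
     (\<forall>a\<in>S. c * m * pmf \<xi> (a - x) \<le> gluing \<xi> x a S)"
proof -
  obtain m0 where m0: "m0 > 0"
    "\<forall>m\<ge>m0. \<forall>A. (\<forall>a\<in>A. real_of_int a \<le> - m) \<longrightarrow> (\<forall>y\<ge>1. 1 / 2 \<le> hit_before \<xi> y {0} A)"
    using hit_before_from_infinity_ge_half by blast
  \<comment> \<open>The summand 1 keeps \<open>C\<close> positive for the division.\<close>
  define C where "C = enn2real total_excess + 1"
  have C: "C > 0" by (simp add: C_def add_nonneg_pos)
  have "1 / (4 * C) * m * pmf \<xi> (a - x) \<le> gluing \<xi> x a S"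
    if m: "m \<ge> m0" and S: "finite S" "\<forall>b\<in>S. real_of_int b + m \<le> real_of_int x" and a: "a \<in> S"
        for m S x a
  proof (cases "pmf \<xi> (a - x) = 0")
    case True
    then show ?thesis by (simp add: gluing_def)
  next
    case False
    then have p: "pmf \<xi> (a - x) > 0" by (simp add: order_less_le)
    have mpos: "m > 0" using m m0 by simp
    define E where "E = hit_before \<xi> x S {x}"
    have "a \<noteq> x" using S a mpos by force
    then have E0: "E > 0" using pmf_le_escape[OF a, of x] p by (simp add: E_def)
    have "m * E \<le> enn2real total_excess"
      unfolding E_def using S(2) mpos by (intro escape_le) force+
    then have E1: "m * E \<le> C" by (simp add: C_def)
    obtain l r where lr: "((\<lambda>y. hit_before \<xi> y {x} S) \<longlongrightarrow> r) at_top" "0 \<le> l"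
      "hit_before_infinity \<xi> {x} S = (r + l) / 2"
      using hit_before_limits[OF S(1)] by metis
    have "1 / 2 \<le> hit_before \<xi> y {x} S" if "y \<ge> x + 1" for y
    proof -
      have "hit_before \<xi> y {x} S = hit_before \<xi> (y - x) {0} ((+) (- x) ` S)"
        using hit_before_translate[of \<xi> "- x" y "{x}" S] by simp
      moreover have "1 / 2 \<le> hit_before \<xi> (y - x) {0} ((+) (- x) ` S)"
        using m0(2)[rule_format, OF m, of "(+) (- x) ` S" "y - x"] S(2) that by force
      ultimately show ?thesis by simp
    qed
    then have "1 / 2 \<le> r"
      by (intro tendsto_lowerbound[OF lr(1)]) (auto simp: eventually_at_top_linorder)
    \<comment> \<open>The limit at \<open>at_bot\<close> enters only through its sign, so the mean
      is at least half of 1/2.\<close>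
    then have H: "1 / 4 \<le> hit_before_infinity \<xi> {x} S" using lr by simp
    have "1 / (4 * C) * m \<le> (1 / 4) / E" using E0 E1 C by (simp add: field_simps)
    also have "\<dots> \<le> hit_before_infinity \<xi> {x} S / E" using H E0 by (intro divide_right_mono) auto
    finally have "1 / (4 * C) * m * pmf \<xi> (a - x) \<le> hit_before_infinity \<xi> {x} S / E * pmf \<xi> (a - x)"
      using p by (intro mult_right_mono) auto
    then show ?thesis by (simp add: gluing_def E_def mult.commute)
  qed
  moreover have "1 / (4 * C) > 0" using C by simp
  ultimately show ?thesis using m0(1) by blast
qed

end

lemma Lim_filtermap: "Lim (filtermap g F) f = Lim F (\<lambda>x. f (g x))"
  by (simp add: t2_space_class.Lim_def filterlim_filtermap)

text \<open>Reflection exchanges the two limits in \<open>hit_before_infinity\<close>, and their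
  mean is symmetric.\<close>

lemma gluing_reflect: "gluing (map_pmf uminus \<xi>) (- x) (- a) (uminus ` S) = gluing \<xi> x a S"
proof -
  have eq: "hit_before (map_pmf uminus \<xi>) y (uminus ` B) (uminus ` A) = hit_before \<xi> (- y) B A"
      for y B A
    using hit_before_reflect[of \<xi> "- y" B A] by simp
  have top: "(at_top :: int filter) = filtermap uminus at_bot"
    by (rule at_top_mirror)
  have bot: "(at_bot :: int filter) = filtermap uminus at_top"
    by (rule at_bot_mirror)
  have "hit_before_infinity (map_pmf uminus \<xi>) {- x} (uminus ` S) = hit_before_infinity \<xi> {x} S"
    using eq[of _ "{x}" S] Lim_filtermap[of uminus at_bot "\<lambda>y. hit_before \<xi> (- y) {x} S"]
      Lim_filtermap[of uminus at_top "\<lambda>y. hit_before \<xi> (- y) {x} S"]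
    by (simp add: hit_before_infinity_def top[symmetric] bot[symmetric])
  moreover have "pmf (map_pmf uminus \<xi>) (- a - - x) = pmf \<xi> (a - x)"
    using pmf_map_inj'[of uminus \<xi> "a - x"] by simp
  moreover have "hit_before (map_pmf uminus \<xi>) (- x) (uminus ` S) {- x} = hit_before \<xi> x S {x}"
    using eq[of "- x" S "{x}"] by simp
  ultimately show ?thesis by (simp add: gluing_def)
qed

lemma (in centred_walk) gluing_far_ge:
  obtains c m0 :: real where "c > 0" "m0 > 0"
    "\<And>m S x a. m \<ge> m0 \<Longrightarrow> finite S \<Longrightarrow> a \<in> S \<Longrightarrow>
       (\<forall>b\<in>S. real_of_int b + m \<le> real_of_int x) \<or> (\<forall>b\<in>S. real_of_int x + m \<le> real_of_int b) \<Longrightarrow>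
       c * m * pmf \<xi> (a - x) \<le> gluing \<xi> x a S"
proof -
  interpret refl: centred_walk "map_pmf uminus \<xi>" by (rule centred_walk_reflect)
  obtain c1 m1 where 1: "c1 > 0" "m1 > 0"
    "\<forall>m\<ge>m1. \<forall>S x. finite S \<longrightarrow> (\<forall>b\<in>S. real_of_int b + m \<le> real_of_int x) \<longrightarrow>
       (\<forall>a\<in>S. c1 * m * pmf \<xi> (a - x) \<le> gluing \<xi> x a S)"
    using gluing_right_ge by blast
  obtain c2 m2 where 2: "c2 > 0" "m2 > 0"
    "\<forall>m\<ge>m2. \<forall>S x. finite S \<longrightarrow> (\<forall>b\<in>S. real_of_int b + m \<le> real_of_int x) \<longrightarrow>
       (\<forall>a\<in>S. c2 * m * pmf (map_pmf uminus \<xi>) (a - x) \<le> gluing (map_pmf uminus \<xi>) x a S)"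
    using refl.gluing_right_ge by blast
  show ?thesis
  proof (rule that[of "min c1 c2" "max m1 m2"])
    fix m S x a
    assume m: "m \<ge> max m1 m2" and S: "finite S" "a \<in> S" and
      far: "(\<forall>b\<in>S. real_of_int b + m \<le> real_of_int x) \<or> (\<forall>b\<in>S. real_of_int x + m \<le> real_of_int b)"
    have mpos: "m > 0" using m 1 by simp
    have mono: "min c1 c2 * m * pmf \<xi> (a - x) \<le> c * m * pmf \<xi> (a - x)" if "min c1 c2 \<le> c" for c
      using that mpos by (intro mult_right_mono) auto
    from far show "min c1 c2 * m * pmf \<xi> (a - x) \<le> gluing \<xi> x a S"
    proof
      assume "\<forall>b\<in>S. real_of_int b + m \<le> real_of_int x"
      then have "c1 * m * pmf \<xi> (a - x) \<le> gluing \<xi> x a S" using 1(3) m S by simp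
      then show ?thesis using mono[of c1] by simp
    next
      assume "\<forall>b\<in>S. real_of_int x + m \<le> real_of_int b"
      then have "\<forall>b\<in>uminus ` S. real_of_int b + m \<le> real_of_int (- x)" by auto
      then have "c2 * m * pmf (map_pmf uminus \<xi>) (- a - - x) \<le>
          gluing (map_pmf uminus \<xi>) (- x) (- a) (uminus ` S)"
        using m S by (intro 2(3)[rule_format]) auto
      moreover have "pmf (map_pmf uminus \<xi>) (- a - - x) = pmf \<xi> (a - x)"
        using pmf_map_inj'[of uminus \<xi> "a - x"] by simp
      ultimately have "c2 * m * pmf \<xi> (a - x) \<le> gluing \<xi> x a S" by (simp add: gluing_reflect)
      then show ?thesis using mono[of c2] by simp
    qed
  qed (use 1 2 in auto)
qed

section \<open>One step of the aggregation process\<close>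

text \<open>Transition probabilities are added over finitely many attachment points at a time;
  exhaustion by finite windows passes the bound on to the whole tail.\<close>

lemma pmf_prob_le_of_finite:
  fixes T :: "int set"
  assumes "\<And>K. finite K \<Longrightarrow> K \<subseteq> T \<Longrightarrow> c * (\<Sum>k\<in>K. pmf \<xi> k) \<le> b"
  shows "c * measure_pmf.prob \<xi> T \<le> b"
proof -
  have "(\<lambda>n. measure_pmf.prob \<xi> (T \<inter> {- int n..int n})) \<longlonglongrightarrow> measure_pmf.prob \<xi>
      (\<Union>n. T \<inter> {- int n..int n})"
    by (intro measure_pmf.finite_Lim_measure_incseq) (auto simp: incseq_def)
  moreover have "(\<Union>n. T \<inter> {- int n..int n}) = T"
  proof -
    have "x \<in> {- int (nat \<bar>x\<bar>)..int (nat \<bar>x\<bar>)}" for x by auto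
    then show ?thesis by blast
  qed
  ultimately have "(\<lambda>n. c * measure_pmf.prob \<xi> (T \<inter> {- int n..int n})) \<longlonglongrightarrow> c * measure_pmf.prob \<xi> T"
    by (intro tendsto_mult tendsto_const) simp
  moreover have "c * measure_pmf.prob \<xi> (T \<inter> {- int n..int n}) \<le> b" for n
    using assms[of "T \<inter> {- int n..int n}"] by (simp add: measure_measure_pmf_finite)
  ultimately show ?thesis by (intro tendsto_upperbound) auto
qed

lemma diam_insert_ge:
  assumes "finite S" "S \<noteq> {}" "m \<ge> 0" "x \<ge> Max S + m \<or> x + m \<le> Min S"
  shows "diam S + m \<le> diam (insert x S)"
proof -
  define u v where "u = Max S" and "v = Min S"
  have "v \<le> u" using assms(1,2) by (simp add: u_def v_def)
  moreover have "diam (insert x S) = max x u - min x v" "diam S = u - v"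
    using assms(1,2) by (simp_all add: diam_def u_def v_def)
  ultimately show ?thesis
    using assms(3,4) by (auto simp: u_def[symmetric] v_def[symmetric])
qed

lemma diam_nonneg: "finite S \<Longrightarrow> S \<noteq> {} \<Longrightarrow> 0 \<le> diam S"
  by (simp add: diam_def)

lemma diam_mono: "finite T \<Longrightarrow> S \<noteq> {} \<Longrightarrow> S \<subseteq> T \<Longrightarrow> diam S \<le> diam T"
  unfolding diam_def by (intro diff_mono Max_mono Min_antimono)

context centred_walk
begin

text \<open>The number \<open>b\<close> stands for the total gluing mass of far points, tested on
  finite sets only. The first estimate uses every \<open>a \<in> S\<close> and grows with the
  cardinality; the second uses one extreme point per direction and does not depend on
  \<open>S\<close>, which is what linear growth of the cardinality requires.\<close>

lemma gluing_sum_ge: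
  obtains c :: real and m0 :: int where "c > 0" "m0 > 0"
    "\<And>m S b. m \<ge> m0 \<Longrightarrow> finite S \<Longrightarrow> S \<noteq> {} \<Longrightarrow>
       (\<And>Y. finite Y \<Longrightarrow> Y \<subseteq> {x. x \<ge> Max S + m \<or> x + m \<le> Min S} \<Longrightarrow> (\<Sum>x\<in>Y. \<Sum>a\<in>S. gluing \<xi> x a S) \<le> b) \<Longrightarrow>
       c * real_of_int m * real (card S) * tail \<xi> (real_of_int (diam S + m)) \<le> b \<and>
       c * real_of_int m * tail \<xi> (real_of_int m) \<le> b"
proof -
  obtain c m1 where c: "c > 0" "m1 > 0" and
    far: "\<And>m S x a. m \<ge> m1 \<Longrightarrow> finite S \<Longrightarrow> a \<in> S \<Longrightarrow>
       (\<forall>b\<in>S. real_of_int b + m \<le> real_of_int x) \<or> (\<forall>b\<in>S. real_of_int x + m \<le> real_of_int b) \<Longrightarrow>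
       c * m * pmf \<xi> (a - x) \<le> gluing \<xi> x a S"
    using gluing_far_ge by metis
  show ?thesis
  proof (rule that[of c "\<lceil>m1\<rceil>"])
    fix m :: int and S and b :: real
    assume m: "m \<ge> \<lceil>m1\<rceil>" and S: "finite S" "S \<noteq> {}"
      and b: "\<And>Y. finite Y \<Longrightarrow> Y \<subseteq> {x. x \<ge> Max S + m \<or> x + m \<le> Min S} \<Longrightarrow>
          (\<Sum>x\<in>Y. \<Sum>a\<in>S. gluing \<xi> x a S) \<le> b"
    define X where "X = {x. x \<ge> Max S + m \<or> x + m \<le> Min S}"
    have m1: "m1 \<le> real_of_int m" using m by linarith
    have mpos: "m > 0" using m1 c by linarith
    have bds: "Min S \<le> a" "a \<le> Max S" if "a \<in> S" for a using that S by auto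
    have ge: "c * m * pmf \<xi> (a - x) \<le> gluing \<xi> x a S" if "a \<in> S" "x \<in> X" for a x
    proof (rule far[OF m1 S(1) that(1)])
      from that(2) consider "x \<ge> Max S + m" | "x + m \<le> Min S" by (auto simp: X_def)
      then show "(\<forall>b\<in>S. real_of_int b + m \<le> real_of_int x) \<or>
          (\<forall>b\<in>S. real_of_int x + m \<le> real_of_int b)"
      proof cases
        case 1
        then have "b + m \<le> x" if "b \<in> S" for b using bds(2)[OF that] by simp
        then show ?thesis by (metis of_int_add of_int_le_iff)
      next
        case 2
        then have "x + m \<le> b" if "b \<in> S" for b using bds(1)[OF that] by simp
        then show ?thesis by (metis of_int_add of_int_le_iff)
      qed
    qed
    have nn: "0 \<le> gluing \<xi> x a S" for x a by (rule gluing_nonneg[OF S(1)])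
    have bX: "(\<Sum>x\<in>Y. \<Sum>a\<in>S. gluing \<xi> x a S) \<le> b" if "finite Y" "Y \<subseteq> X" for Y
      using b that by (simp add: X_def)
    have "c * real_of_int m * real (card S) * measure_pmf.prob \<xi> {k. \<bar>k\<bar> > diam S + m} \<le> b"
    proof (rule pmf_prob_le_of_finite)
      fix K assume K: "finite K" "K \<subseteq> {k. \<bar>k\<bar> > diam S + m}"
      \<comment> \<open>A step \<open>k\<close> that ends at \<open>a\<close> starts at
        \<open>a - k\<close>. As \<open>|k|\<close> exceeds \<open>diam S + m\<close>, this start
        lies at distance at least \<open>m\<close> outside \<open>S\<close>, whichever
        \<open>a\<close> is used.\<close>
      define Y where "Y = (\<Union>a\<in>S. (\<lambda>k. a - k) ` K)"
      have Y: "finite Y" using K S by (simp add: Y_def)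
      have YX: "Y \<subseteq> X"
      proof
        fix x assume "x \<in> Y"
        then obtain a k where "a \<in> S" "k \<in> K" "x = a - k" by (auto simp: Y_def)
        then show "x \<in> X" using K(2) bds[of a] by (force simp: X_def diam_def)
      qed
      have "c * real_of_int m * real (card S) * (\<Sum>k\<in>K. pmf \<xi> k) =
         (\<Sum>a\<in>S. \<Sum>k\<in>K. c * m * pmf \<xi> k)"
        by (simp add: sum_distrib_left[symmetric])
      also have "\<dots> = (\<Sum>a\<in>S. \<Sum>x\<in>(\<lambda>k. a - k) ` K. c * m * pmf \<xi> (a - x))"
        by (rule sum.cong[OF refl]) (simp add: sum.reindex inj_on_def o_def)
      also have "\<dots> \<le> (\<Sum>a\<in>S. \<Sum>x\<in>(\<lambda>k. a - k) ` K. gluing \<xi> x a S)"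
        using YX by (intro sum_mono ge) (auto simp: Y_def)
      also have "\<dots> \<le> (\<Sum>a\<in>S. \<Sum>x\<in>Y. gluing \<xi> x a S)"
        using Y nn by (intro sum_mono sum_mono2) (auto simp: Y_def)
      also have "\<dots> = (\<Sum>x\<in>Y. \<Sum>a\<in>S. gluing \<xi> x a S)" by (rule sum.swap)
      also have "\<dots> \<le> b" using Y YX by (rule bX)
      finally show "c * real_of_int m * real (card S) * (\<Sum>k\<in>K. pmf \<xi> k) \<le> b" .
    qed
    moreover have "c * real_of_int m * measure_pmf.prob \<xi> {k. \<bar>k\<bar> > m} \<le> b"
    proof (rule pmf_prob_le_of_finite)
      fix K assume K: "finite K" "K \<subseteq> {k. \<bar>k\<bar> > m}"
      \<comment> \<open>A negative step ends at the maximum and a positive one at the minimum, so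
        \<open>|k| > m\<close> alone puts its start far enough outside. The two sides are disjoint,
        whence injectivity.\<close>
      define f where "f k = (if k < 0 then Max S else Min S)" for k :: int
      define Y where "Y = (\<lambda>k. f k - k) ` K"
      have fS: "f k \<in> S" for k using S by (simp add: f_def)
      have MM: "Min S \<le> Max S" using bds fS by (meson S(1) S(2) Max_in Min_le)
      have inj: "inj_on (\<lambda>k. f k - k) K"
        using K(2) mpos MM by (force simp: inj_on_def f_def split: if_splits)
      have YX: "f k - k \<in> X" if "k \<in> K" for k
        using that K(2) by (auto simp: X_def f_def)
      have "c * real_of_int m * (\<Sum>k\<in>K. pmf \<xi> k) = (\<Sum>k\<in>K. c * m * pmf \<xi> (f k - (f k - k)))"
        by (simp add: sum_distrib_left)
      also have "\<dots> \<le> (\<Sum>k\<in>K. gluing \<xi> (f k - k) (f k) S)"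
        using YX fS by (intro sum_mono ge)
      also have "\<dots> \<le> (\<Sum>k\<in>K. \<Sum>a\<in>S. gluing \<xi> (f k - k) a S)"
        using fS S nn by (intro sum_mono member_le_sum) auto
      also have "\<dots> = (\<Sum>x\<in>Y. \<Sum>a\<in>S. gluing \<xi> x a S)"
        unfolding Y_def by (subst sum.reindex[OF inj]) simp
      also have "\<dots> \<le> b" using K YX by (intro bX) (auto simp: Y_def)
      finally show "c * real_of_int m * (\<Sum>k\<in>K. pmf \<xi> k) \<le> b" .
    qed
    moreover have "tail \<xi> (real_of_int t) = measure_pmf.prob \<xi> {k. \<bar>k\<bar> > t}" for t
    proof -
      have "real_of_int t < \<bar>real_of_int k\<bar> \<longleftrightarrow> t < \<bar>k\<bar>" for k
        by (metis of_int_abs of_int_less_iff)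
      then show ?thesis by (simp add: tail_def)
    qed
    ultimately show "c * real_of_int m * real (card S) * tail \<xi> (real_of_int (diam S + m)) \<le> b \<and>
       c * real_of_int m * tail \<xi> (real_of_int m) \<le> b" by (simp only:)
  qed (use c in auto)
qed

end

section \<open>Conditioning on the history of the aggregation process\<close>

locale dla = centred_walk \<xi> + prob_space M
  for \<xi> and M :: "'w measure" +
  fixes A :: "nat \<Rightarrow> 'w \<Rightarrow> int set"
  assumes process: "DLA_process \<xi> M A"
begin

lemma A_measurable: "A n \<in> M \<rightarrow>\<^sub>M count_space {S. finite S}"
  using process by (simp add: DLA_process_def)

lemma finite_A: "\<omega> \<in> space M \<Longrightarrow> finite (A n \<omega>)"
  using measurable_space[OF A_measurable] by simp

lemma pred_A [measurable]: "Measurable.pred M (\<lambda>\<omega>. P (A n \<omega>))"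
  by (rule measurable_compose[OF A_measurable]) simp

lemma AE_A_0: "AE \<omega> in M. A 0 \<omega> = {0}"
  using process by (simp add: DLA_process_def)

lemma AE_A_mono: "AE \<omega> in M. \<forall>n. A n \<omega> \<subseteq> A (Suc n) \<omega>"
  using process by (simp add: DLA_process_def)

lemma markov_property:
  assumes "\<P>(\<omega> in M. \<forall>i\<le>n. A i \<omega> = B i) \<noteq> 0"
  shows "\<P>(\<omega> in M. A (Suc n) \<omega> = C \<bar> \<forall>i\<le>n. A i \<omega> = B i) =
    \<P>(\<omega> in M. A (Suc n) \<omega> = C \<bar> A n \<omega> = B n)"
  using process unfolding DLA_process_def by (elim conjE) (rule assms[THEN rev_mp], elim allE)

lemma transition:
  assumes "finite S" "x \<notin> S" "\<P>(\<omega> in M. A n \<omega> = S) \<noteq> 0"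
  shows "\<P>(\<omega> in M. A (Suc n) \<omega> = insert x S \<bar> A n \<omega> = S) = (\<Sum>a\<in>S. gluing \<xi> x a S)"
  using process assms unfolding DLA_process_def by (elim conjE) simp

lemma AE_incseq: "AE \<omega> in M. incseq (\<lambda>n. A n \<omega>) \<and> (\<forall>n. A n \<omega> \<noteq> {})"
  using AE_A_0 AE_A_mono
proof eventually_elim
  case (elim \<omega>)
  then have "incseq (\<lambda>n. A n \<omega>)" by (intro incseq_SucI) auto
  moreover have "A 0 \<omega> \<subseteq> A n \<omega>" for n using calculation by (auto simp: incseq_def)
  then have "A n \<omega> \<noteq> {}" for n using elim(1) by blast
  ultimately show ?case by simp
qed

text \<open>The Markov property in multiplied form, which also covers null histories, where both
  sides vanish.\<close>

lemma prob_history_insert: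
  assumes "finite (B n)" "x \<notin> B n"
  shows "prob {\<omega> \<in> space M. A (Suc n) \<omega> = insert x (B n) \<and> (\<forall>i\<le>n. A i \<omega> = B i)} =
     prob {\<omega> \<in> space M. \<forall>i\<le>n. A i \<omega> = B i} * (\<Sum>a\<in>B n. gluing \<xi> x a (B n))"
proof (cases "prob {\<omega> \<in> space M. \<forall>i\<le>n. A i \<omega> = B i} = 0")
  case True
  have "prob {\<omega> \<in> space M. A (Suc n) \<omega> = insert x (B n) \<and> (\<forall>i\<le>n. A i \<omega> = B i)} \<le>
    prob {\<omega> \<in> space M. \<forall>i\<le>n. A i \<omega> = B i}"
    by (intro finite_measure_mono) auto
  with True show ?thesis by (simp add: measure_le_0_iff)
next
  case False
  have "prob {\<omega> \<in> space M. \<forall>i\<le>n. A i \<omega> = B i} \<le> prob {\<omega> \<in> space M. A n \<omega> = B n}"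
    by (intro finite_measure_mono) auto
  with False have F2: "prob {\<omega> \<in> space M. A n \<omega> = B n} \<noteq> 0"
    by (auto simp: measure_le_0_iff)
  have "\<P>(\<omega> in M. A (Suc n) \<omega> = insert x (B n) \<bar> \<forall>i\<le>n. A i \<omega> = B i) =
      \<P>(\<omega> in M. A (Suc n) \<omega> = insert x (B n) \<bar> A n \<omega> = B n)"
    by (rule markov_property[OF False])
  also have "\<dots> = (\<Sum>a\<in>B n. gluing \<xi> x a (B n))"
    by (rule transition[OF assms F2])
  finally show ?thesis using False by (simp add: cond_prob_def field_simps)
qed

text \<open>Attaching different points outside \<open>B n\<close> produces different sets, so the
  events are disjoint and their probabilities add.\<close>

lemma prob_history_insert_sum:
  assumes "finite (B n)" "finite Y" "Y \<inter> B n = {}" "\<And>x. x \<in> Y \<Longrightarrow> P (insert x (B n))"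
  shows "prob {\<omega> \<in> space M. \<forall>i\<le>n. A i \<omega> = B i} * (\<Sum>x\<in>Y. \<Sum>a\<in>B n. gluing \<xi> x a (B n)) \<le>
     prob {\<omega> \<in> space M. P (A (Suc n) \<omega>) \<and> (\<forall>i\<le>n. A i \<omega> = B i)}"
proof -
  let ?E = "\<lambda>x. {\<omega> \<in> space M. A (Suc n) \<omega> = insert x (B n) \<and> (\<forall>i\<le>n. A i \<omega> = B i)}"
  have "prob {\<omega> \<in> space M. \<forall>i\<le>n. A i \<omega> = B i} * (\<Sum>x\<in>Y. \<Sum>a\<in>B n. gluing \<xi> x a (B n)) =
    (\<Sum>x\<in>Y. prob (?E x))"
    using assms by (subst sum_distrib_left, intro sum.cong refl prob_history_insert[symmetric]) auto
  also have "\<dots> = prob (\<Union>x\<in>Y. ?E x)"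
  proof (rule finite_measure_finite_Union[symmetric])
    show "disjoint_family_on ?E Y"
      using assms(3) by (auto simp: disjoint_family_on_def)
  qed (use assms in auto)
  also have "\<dots> \<le> prob {\<omega> \<in> space M. P (A (Suc n) \<omega>) \<and> (\<forall>i\<le>n. A i \<omega> = B i)}"
    using assms(4) by (intro finite_measure_mono) auto
  finally show ?thesis .
qed

definition jump :: "nat \<Rightarrow> int \<Rightarrow> 'w \<Rightarrow> bool" where
  "jump n m \<omega> \<longleftrightarrow> diam (A n \<omega>) + m \<le> diam (A (Suc n) \<omega>)"

lemma jump_measurable [measurable]: "Measurable.pred M (jump n m)"
proof -
  \<comment> \<open>\<open>pred_A\<close> treats one time at a time; the two diameters are compared
    through a countable choice of the value \<open>d\<close>.\<close>
  have "jump n m = (\<lambda>\<omega>. \<exists>d. diam (A n \<omega>) = d \<and> d + m \<le> diam (A (Suc n) \<omega>))"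
    by (simp add: jump_def fun_eq_iff)
  also have "Measurable.pred M \<dots>" by measurable
  finally show ?thesis .
qed

text \<open>Coding sets by lists makes the histories a countable type.\<close>

definition history :: "nat \<Rightarrow> 'w \<Rightarrow> int list list" where
  "history n \<omega> = map (\<lambda>i. sorted_list_of_set (A i \<omega>)) [0..<Suc n]"

lemma history_eq_iff:
  assumes "\<omega> \<in> space M" "\<omega>' \<in> space M"
  shows "history n \<omega> = history n \<omega>' \<longleftrightarrow> (\<forall>i\<le>n. A i \<omega> = A i \<omega>')"
proof -
  have "sorted_list_of_set (A i \<omega>) = sorted_list_of_set (A i \<omega>') \<longleftrightarrow> A i \<omega> = A i \<omega>'" for i
    using finite_A[OF assms(1)] finite_A[OF assms(2)]
        by (metis sorted_list_of_set.set_sorted_key_list_of_set)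
  then show ?thesis
    unfolding history_def map_eq_conv by (auto simp: less_Suc_eq_le)
qed

lemma history_event:
  assumes "\<omega>' \<in> space M"
  shows "{\<omega> \<in> space M. history n \<omega> = history n \<omega>'} = {\<omega> \<in> space M. \<forall>i\<le>n. A i \<omega> = A i \<omega>'}"
  using history_eq_iff[OF _ assms] by auto

lemma history_event_sets: "{\<omega> \<in> space M. history n \<omega> = h} \<in> sets M"
proof (cases "\<exists>\<omega>'\<in>space M. history n \<omega>' = h")
  case True
  then obtain \<omega>' where "\<omega>' \<in> space M" "h = history n \<omega>'" by auto
  then show ?thesis by (simp add: history_event)
next
  case False
  then have "{\<omega> \<in> space M. history n \<omega> = h} = {}" by auto
  then show ?thesis by (simp only: sets.empty_sets)
qed

lemma prob_le_by_history:
  assumes E: "E \<in> sets M" and F: "F \<in> sets M" and "q \<ge> 0"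
    and le: "\<And>\<omega>. \<omega> \<in> space M \<Longrightarrow>
      q * prob (E \<inter> {\<omega>' \<in> space M. history n \<omega>' = history n \<omega>}) \<le>
      prob (F \<inter> {\<omega>' \<in> space M. history n \<omega>' = history n \<omega>})"
  shows "q * prob E \<le> prob F"
proof -
  \<comment> \<open>For \<open>j\<close> outside the range of \<open>to_nat\<close> the value
    \<open>from_nat j\<close> is arbitrary; the second conjunct makes the class empty then, so the
    classes form a countable partition.\<close>
  let ?H = "\<lambda>j. {\<omega> \<in> space M. history n \<omega> = from_nat j \<and> to_nat (history n \<omega>) = j}"
  have Hs: "?H j \<in> sets M" for j
  proof -
    have "?H j = (if to_nat (from_nat j :: int list list) = j then {\<omega> \<in> space M. history n \<omega> =
        from_nat j} else {})"
      by auto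
    then show ?thesis using history_event_sets by simp
  qed
  have dec: "(\<lambda>j. prob (G \<inter> ?H j)) sums prob G" if "G \<in> sets M" for G
  proof -
    have "(\<lambda>j. prob (G \<inter> ?H j)) sums prob (\<Union>j. G \<inter> ?H j)"
      using that Hs by (intro finite_measure_UNION) (auto simp: disjoint_family_on_def)
    also have "(\<Union>j. G \<inter> ?H j) = G" using sets.sets_into_space[OF that] by auto
    finally show ?thesis .
  qed
  have lej: "q * prob (E \<inter> ?H j) \<le> prob (F \<inter> ?H j)" for j
  proof (cases "?H j = {}")
    case False
    then obtain \<omega> where w: "\<omega> \<in> space M" "to_nat (history n \<omega>) = j" by auto
    then have "?H j = {\<omega>' \<in> space M. history n \<omega>' = history n \<omega>}" by auto
    then show ?thesis using le[OF w(1)] by simp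
  next
    case True
    show ?thesis unfolding True by simp
  qed
  show ?thesis
    using sums_le[OF lej sums_mult[OF dec[OF E], of q] dec[OF F]] .
qed

text \<open>Conditional probability without conditional expectations: \<open>E\<close> is a union of
  history classes up to time \<open>n\<close>, the bound \<open>q\<close> holds on each class inside
  \<open>E\<close>, and the classes are summed. The alternative in the hypothesis matches the two
  estimates of \<open>gluing_sum_ge\<close>.\<close>

lemma jump_prob_ge:
  obtains c :: real and m0 :: int where "c > 0" "m0 > 0"
    "\<And>m n q E. m \<ge> m0 \<Longrightarrow> q \<ge> 0 \<Longrightarrow> Measurable.pred M E \<Longrightarrow>
       (\<And>\<omega> \<omega>'. \<omega> \<in> space M \<Longrightarrow> \<omega>' \<in> space M \<Longrightarrow> \<forall>i\<le>n. A i \<omega> = A i \<omega>' \<Longrightarrow> E \<omega> \<Longrightarrow> E \<omega>') \<Longrightarrow>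
       (\<And>\<omega>. \<omega> \<in> space M \<Longrightarrow> E \<omega> \<Longrightarrow> A n \<omega> \<noteq> {} \<and>
         (q \<le> c * real_of_int m * real (card (A n \<omega>)) * tail \<xi> (real_of_int (diam (A n \<omega>) + m)) \<or>
          q \<le> c * real_of_int m * tail \<xi> (real_of_int m))) \<Longrightarrow>
       q * prob {\<omega> \<in> space M. E \<omega>} \<le> prob {\<omega> \<in> space M. E \<omega> \<and> jump n m \<omega>}"
proof -
  obtain c m0 where c: "c > 0" "m0 > 0" and gl:
    "\<And>m S b. m \<ge> m0 \<Longrightarrow> finite S \<Longrightarrow> S \<noteq> {} \<Longrightarrow>
       (\<And>Y. finite Y \<Longrightarrow> Y \<subseteq> {x. x \<ge> Max S + m \<or> x + m \<le> Min S} \<Longrightarrow> (\<Sum>x\<in>Y. \<Sum>a\<in>S. gluing \<xi> x a S) \<le> b) \<Longrightarrow>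
       c * real_of_int m * real (card S) * tail \<xi> (real_of_int (diam S + m)) \<le> b \<and>
       c * real_of_int m * tail \<xi> (real_of_int m) \<le> b"
    by (rule gluing_sum_ge) blast
  show ?thesis
  proof (rule that[OF c])
    fix m n q E
    assume m: "m \<ge> m0" and q: "q \<ge> (0::real)" and [measurable]: "Measurable.pred M E"
      and det: "\<And>\<omega> \<omega>'. \<omega> \<in> space M \<Longrightarrow> \<omega>' \<in> space M \<Longrightarrow> \<forall>i\<le>n. A i \<omega> = A i \<omega>' \<Longrightarrow> E \<omega> \<Longrightarrow> E \<omega>'"
      and big: "\<And>\<omega>. \<omega> \<in> space M \<Longrightarrow> E \<omega> \<Longrightarrow> A n \<omega> \<noteq> {} \<and>
         (q \<le> c * real_of_int m * real (card (A n \<omega>)) * tail \<xi> (real_of_int (diam (A n \<omega>) + m)) \<or>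
          q \<le> c * real_of_int m * tail \<xi> (real_of_int m))"
    show "q * prob {\<omega> \<in> space M. E \<omega>} \<le> prob {\<omega> \<in> space M. E \<omega> \<and> jump n m \<omega>}"
    proof (rule prob_le_by_history[where n = n])
      fix \<omega> assume w: "\<omega> \<in> space M"
      let ?P = "prob {\<omega>' \<in> space M. \<forall>i\<le>n. A i \<omega>' = A i \<omega>}"
      show "q * prob ({\<omega> \<in> space M. E \<omega>} \<inter> {\<omega>' \<in> space M. history n \<omega>' = history n \<omega>}) \<le>
        prob ({\<omega> \<in> space M. E \<omega> \<and> jump n m \<omega>} \<inter> {\<omega>' \<in> space M. history n \<omega>' = history n \<omega>})"
      proof (cases "E \<omega>")
        case False
        have "{\<omega> \<in> space M. E \<omega>} \<inter> {\<omega>' \<in> space M. history n \<omega>' = history n \<omega>} = {}"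
        proof -
          have "E \<omega>" if "\<omega>' \<in> space M" "\<forall>i\<le>n. A i \<omega>' = A i \<omega>" "E \<omega>'" for \<omega>'
            by (rule det[OF that(1) w that(2,3)])
          with False show ?thesis unfolding history_event[OF w] by blast
        qed
        then show ?thesis by (simp only: measure_empty mult_zero_right measure_nonneg)
      next
        case True
        define S where "S = A n \<omega>"
        have S: "finite S" "S \<noteq> {}" using finite_A[OF w] big[OF w True] by (auto simp: S_def)
        let ?H = "\<lambda>\<omega>'. \<forall>i\<le>n. A i \<omega>' = A i \<omega>"
        have d: "E \<omega>'" if "\<omega>' \<in> space M" "?H \<omega>'" for \<omega>'
          by (rule det[OF w that(1) _ True]) (simp add: that(2))
        have eq1: "{\<omega> \<in> space M. E \<omega>} \<inter> {\<omega>' \<in> space M. history n \<omega>' = history n \<omega>} =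
            {\<omega>' \<in> space M. ?H \<omega>'}"
          unfolding history_event[OF w] using d by blast
        have iff: "\<omega>' \<in> space M \<and> E \<omega>' \<and> jump n m \<omega>' \<and> ?H \<omega>' \<longleftrightarrow>
            \<omega>' \<in> space M \<and> diam S + m \<le> diam (A (Suc n) \<omega>') \<and> ?H \<omega>'" for \<omega>'
        proof (cases "\<omega>' \<in> space M \<and> ?H \<omega>'")
          case True
          then have "E \<omega>'" "A n \<omega>' = S" using d by (auto simp: S_def)
          then show ?thesis using True by (simp add: jump_def)
        qed blast
        have eq2: "{\<omega> \<in> space M. E \<omega> \<and> jump n m \<omega>} \<inter> {\<omega>' \<in> space M. history n \<omega>' = history n \<omega>} =
            {\<omega>' \<in> space M. diam S + m \<le> diam (A (Suc n) \<omega>') \<and> ?H \<omega>'}"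
          unfolding history_event[OF w] using iff by blast
        let ?J = "prob {\<omega>' \<in> space M. diam S + m \<le> diam (A (Suc n) \<omega>') \<and> (\<forall>i\<le>n. A i \<omega>' = A i \<omega>)}"
        have "q * ?P \<le> ?J"
        \<comment> \<open>A null history contributes nothing. Otherwise the quotient
          \<open>?J / ?P\<close> serves as the bound \<open>b\<close> of
          \<open>gluing_sum_ge\<close>.\<close>
        proof (cases "?P = 0")
          case False
          then have P: "?P > 0" by (simp add: zero_less_measure_iff)
          have "(\<Sum>x\<in>Y. \<Sum>a\<in>S. gluing \<xi> x a S) \<le> ?J / ?P"
            if Y: "finite Y" "Y \<subseteq> {x. x \<ge> Max S + m \<or> x + m \<le> Min S}" for Y
          proof -
            have "Y \<inter> S = {}"
            proof -
              have "Min S \<le> a" "a \<le> Max S" if "a \<in> S" for a using that S by auto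
              then show ?thesis using Y(2) m c by fastforce
            qed
            moreover have "diam S + m \<le> diam (insert x S)" if "x \<in> Y" for x
              using that Y(2) m c S by (intro diam_insert_ge) auto
            ultimately have "?P * (\<Sum>x\<in>Y. \<Sum>a\<in>S. gluing \<xi> x a S) \<le> ?J"
              using prob_history_insert_sum[of "\<lambda>i. A i \<omega>" n Y "\<lambda>T. diam S + m \<le> diam T"] S Y
              by (simp add: S_def)
            then show ?thesis using P by (simp add: field_simps)
          qed
          from gl[OF m S this] have "q \<le> ?J / ?P"
            using big[OF w True] by (auto simp: S_def)
          then show ?thesis using P by (simp add: field_simps)
        qed simp
        then show ?thesis unfolding eq1 eq2 .
      qed
    qed (use q in measurable)
  qed
qed

end

section \<open>Linear growth of the cardinality\<close>

lemma tail_antimono: "s \<le> t \<Longrightarrow> tail \<xi> t \<le> tail \<xi> s"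
  unfolding tail_def by (intro measure_pmf.finite_measure_mono) auto

context dla
begin

lemma AE_jump_imp_card_less:
  assumes "m > 0"
  shows "AE \<omega> in M. jump n m \<omega> \<longrightarrow> card (A n \<omega>) < card (A (Suc n) \<omega>)"
  using AE_A_mono AE_space
proof eventually_elim
  case (elim \<omega>)
  show ?case
  proof
    assume "jump n m \<omega>"
    then have "A n \<omega> \<noteq> A (Suc n) \<omega>" using assms by (auto simp: jump_def)
    with elim show "card (A n \<omega>) < card (A (Suc n) \<omega>)"
      by (intro psubset_card_mono finite_A) auto
  qed
qed

text \<open>To end with at most \<open>Suc k\<close> points, the set must have had at most
  \<open>Suc k\<close> points, and a set of exactly \<open>Suc k\<close> points must not have
  jumped.\<close>

lemma card_prob_step:
  assumes q: "0 \<le> q" "\<And>E. Measurable.pred M E \<Longrightarrow>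
       (\<And>\<omega> \<omega>'. \<omega> \<in> space M \<Longrightarrow> \<omega>' \<in> space M \<Longrightarrow> \<forall>i\<le>n. A i \<omega> = A i \<omega>' \<Longrightarrow> E \<omega> \<Longrightarrow> E \<omega>') \<Longrightarrow>
       (\<And>\<omega>. \<omega> \<in> space M \<Longrightarrow> E \<omega> \<Longrightarrow> A n \<omega> \<noteq> {}) \<Longrightarrow>
       q * prob {\<omega> \<in> space M. E \<omega>} \<le> prob {\<omega> \<in> space M. E \<omega> \<and> jump n m \<omega>}"
    and m: "m > 0"
  shows "prob {\<omega> \<in> space M. card (A (Suc n) \<omega>) \<le> Suc k} \<le>
     (1 - q) * prob {\<omega> \<in> space M. card (A n \<omega>) \<le> Suc k} + q * prob {\<omega> \<in> space M. card (A n \<omega>) \<le> k}"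
proof -
  let ?F = "\<lambda>k. {\<omega> \<in> space M. card (A n \<omega>) \<le> k}"
  let ?E = "\<lambda>\<omega>. A n \<omega> \<noteq> {} \<and> card (A n \<omega>) = Suc k"
  let ?J = "{\<omega> \<in> space M. ?E \<omega> \<and> jump n m \<omega>}"
  have [measurable]: "Measurable.pred M ?E" by (rule pred_A)
  have FE: "?F (Suc k) - ?F k = {\<omega> \<in> space M. ?E \<omega>}" by auto
  have "prob {\<omega> \<in> space M. card (A (Suc n) \<omega>) \<le> Suc k} \<le> prob (?F (Suc k) - ?J)"
  proof (rule finite_measure_mono_AE)
    show "AE \<omega> in M. \<omega> \<in> {\<omega> \<in> space M. card (A (Suc n) \<omega>) \<le> Suc k} \<longrightarrow> \<omega> \<in> ?F (Suc k) - ?J"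
      using AE_jump_imp_card_less[OF m, of n] AE_A_mono AE_space
    proof eventually_elim
      case (elim \<omega>)
      have "card (A n \<omega>) \<le> card (A (Suc n) \<omega>)"
        using elim by (intro card_mono finite_A) auto
      then show ?case using elim by auto
    qed
  qed measurable
  also have "\<dots> = prob (?F (Suc k)) - prob ?J"
    by (intro finite_measure_Diff) auto
  also have "\<dots> \<le> prob (?F (Suc k)) - q * prob {\<omega> \<in> space M. ?E \<omega>}"
    using q(2)[of ?E] by (intro diff_left_mono) auto
  also have "prob {\<omega> \<in> space M. ?E \<omega>} = prob (?F (Suc k)) - prob (?F k)"
    unfolding FE[symmetric] by (intro finite_measure_Diff) auto
  finally show ?thesis by (simp add: algebra_simps)
qed

lemma card_linear_growth:
  assumes tail_pos: "\<And>t. 0 < tail \<xi> t"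
  obtains \<kappa> :: real where "\<kappa> > 0" "AE \<omega> in M. \<forall>\<^sub>F n in sequentially. \<kappa> *
      real n < real (card (A n \<omega>))"
proof -
  obtain c m0 where c: "c > 0" "m0 > 0" and jp:
    "\<And>m n q E. m \<ge> m0 \<Longrightarrow> q \<ge> 0 \<Longrightarrow> Measurable.pred M E \<Longrightarrow>
       (\<And>\<omega> \<omega>'. \<omega> \<in> space M \<Longrightarrow> \<omega>' \<in> space M \<Longrightarrow> \<forall>i\<le>n. A i \<omega> = A i \<omega>' \<Longrightarrow> E \<omega> \<Longrightarrow> E \<omega>') \<Longrightarrow>
       (\<And>\<omega>. \<omega> \<in> space M \<Longrightarrow> E \<omega> \<Longrightarrow> A n \<omega> \<noteq> {} \<and>
         (q \<le> c * real_of_int m * real (card (A n \<omega>)) * tail \<xi> (real_of_int (diam (A n \<omega>) + m)) \<or>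
          q \<le> c * real_of_int m * tail \<xi> (real_of_int m))) \<Longrightarrow>
       q * prob {\<omega> \<in> space M. E \<omega>} \<le> prob {\<omega> \<in> space M. E \<omega> \<and> jump n m \<omega>}"
    by (rule jump_prob_ge) blast
  \<comment> \<open>The cap 1/2 keeps the coefficient \<open>1 - q\<close> positive.\<close>
  define q where "q = min (1 / 2) (c * real_of_int m0 * tail \<xi> (real_of_int m0))"
  have q: "0 < q" "q \<le> 1 / 2" "q \<le> c * real_of_int m0 * tail \<xi> (real_of_int m0)"
    using c tail_pos by (auto simp: q_def)
  have step: "prob {\<omega> \<in> space M. card (A (Suc n) \<omega>) \<le> Suc k} \<le>
     (1 - q) * prob {\<omega> \<in> space M. card (A n \<omega>) \<le> Suc k} + q * prob {\<omega> \<in> space M. card (A n \<omega>) \<le>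
         k}" for n k
  proof (rule card_prob_step[OF _ _ c(2)])
    fix E assume E: "Measurable.pred M E"
      "\<And>\<omega> \<omega>'. \<omega> \<in> space M \<Longrightarrow> \<omega>' \<in> space M \<Longrightarrow> \<forall>i\<le>n. A i \<omega> = A i \<omega>' \<Longrightarrow> E \<omega> \<Longrightarrow> E \<omega>'"
      "\<And>\<omega>. \<omega> \<in> space M \<Longrightarrow> E \<omega> \<Longrightarrow> A n \<omega> \<noteq> {}"
    show "q * prob {\<omega> \<in> space M. E \<omega>} \<le> prob {\<omega> \<in> space M. E \<omega> \<and> jump n m0 \<omega>}"
    proof (rule jp[OF order_refl _ E(1)])
      show "E \<omega>'" if "\<omega> \<in> space M" "\<omega>' \<in> space M" "\<forall>i\<le>n. A i \<omega> = A i \<omega>'" "E \<omega>" for \<omega> \<omega>'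
        by (rule E(2)[OF that])
      show "A n \<omega> \<noteq> {} \<and>
         (q \<le> c * real_of_int m0 * real (card (A n \<omega>)) * tail \<xi> (real_of_int (diam (A n \<omega>) + m0)) \<or>
          q \<le> c * real_of_int m0 * tail \<xi> (real_of_int m0))" if "\<omega> \<in> space M" "E \<omega>" for \<omega>
        using q(3) E(3)[OF that] by blast
    qed (use q in simp)
  qed (use q in simp)
  \<comment> \<open>The mean of \<open>exp (- X)\<close> for a Bernoulli variable \<open>X\<close>
    with parameter \<open>q\<close>. The recursion compares the cardinality with a sum of
    \<open>n\<close> such independent variables, and the induction below is the exponential Markov
    inequality for that sum.\<close>
  define \<rho> where "\<rho> = 1 - q + q * exp (- 1)"
  have "exp (- 1) < (1::real)" by simp
  then have rho: "0 < \<rho>" "\<rho> < 1"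
    using q by (auto simp: \<rho>_def intro!: add_pos_nonneg)
  have tail_le: "prob {\<omega> \<in> space M. card (A n \<omega>) \<le> k} \<le> exp (real k) * \<rho> ^ n" for n k
  proof (induction n arbitrary: k)
    case 0
    have "prob {\<omega> \<in> space M. card (A 0 \<omega>) \<le> k} \<le> 1" by simp
    also have "1 \<le> exp (real k)" by simp
    finally show ?case by simp
  next
    case (Suc n)
    show ?case
    proof (cases k)
      case 0
      have "prob {\<omega> \<in> space M. card (A (Suc n) \<omega>) \<le> k} = 0"
      proof (subst prob_eq_0)
        show "AE \<omega> in M. \<omega> \<notin> {\<omega> \<in> space M. card (A (Suc n) \<omega>) \<le> k}"
          using AE_incseq AE_space
        proof eventually_elim
          case (elim \<omega>)
          then have "card (A (Suc n) \<omega>) \<noteq> 0" using finite_A by (auto simp: card_eq_0_iff)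
          then show ?case using 0 by simp
        qed
      qed measurable
      then show ?thesis using rho by simp
    next
      case (Suc j)
      have "prob {\<omega> \<in> space M. card (A (Suc n) \<omega>) \<le> k} \<le>
        (1 - q) * (exp (real (Suc j)) * \<rho> ^ n) + q * (exp (real j) * \<rho> ^ n)"
        unfolding Suc using q by (intro order_trans[OF step] add_mono mult_left_mono Suc.IH) auto
      also have "exp (real j) = exp (real (Suc j)) * exp (- 1)" by (simp add: exp_add[symmetric])
      also have "(1 - q) * (exp (real (Suc j)) * \<rho> ^ n) + q * (exp (real (Suc j)) * exp (- 1) *
          \<rho> ^ n) =
         exp (real k) * \<rho> ^ Suc n"
        by (simp add: \<rho>_def Suc algebra_simps)
      finally show ?thesis .
    qed
  qed
  \<comment> \<open>Half of the exponential rate, so that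
    \<open>exp (\<kappa> * n) * \<rho> ^ n\<close> equals \<open>sqrt \<rho> ^ n\<close> and is
    summable.\<close>
  define \<kappa> where "\<kappa> = - ln \<rho> / 2"
  have kappa: "\<kappa> > 0" using rho by (simp add: \<kappa>_def)
  define r where "r = exp \<kappa> * \<rho>"
  have "r = exp (\<kappa> + ln \<rho>)" using rho by (simp add: r_def exp_add)
  also have "\<dots> < 1" using rho by (simp add: \<kappa>_def)
  finally have r: "r < 1" "0 < r" using rho by (auto simp: r_def)
  have bound: "prob {\<omega> \<in> space M. real (card (A n \<omega>)) \<le> \<kappa> * real n} \<le> r ^ n" for n
  proof -
    have "prob {\<omega> \<in> space M. real (card (A n \<omega>)) \<le> \<kappa> * real n} \<le>
       prob {\<omega> \<in> space M. card (A n \<omega>) \<le> nat \<lfloor>\<kappa> * real n\<rfloor>}"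
      by (intro finite_measure_mono) (auto simp: le_nat_floor)
    also note tail_le
    also have "exp (real (nat \<lfloor>\<kappa> * real n\<rfloor>)) * \<rho> ^ n \<le> exp (\<kappa> * real n) * \<rho> ^ n"
      using rho kappa by (intro mult_right_mono) auto
    also have "\<dots> = r ^ n"
      by (simp add: r_def power_mult_distrib exp_of_nat2_mult)
    finally show ?thesis .
  qed
  have "AE \<omega> in M. \<forall>\<^sub>F n in sequentially. \<omega> \<in> space M - {\<omega> \<in> space M. real (card (A n \<omega>)) \<le>
      \<kappa> * real n}"
  proof (rule borel_cantelli_AE1)
    show "summable (\<lambda>n. prob {\<omega> \<in> space M. real (card (A n \<omega>)) \<le> \<kappa> * real n})"
      using r bound by (intro summable_comparison_test'[OF summable_geometric[of r]]) auto
  qed (auto simp: emeasure_eq_measure)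
  then have "AE \<omega> in M. \<forall>\<^sub>F n in sequentially. \<kappa> * real n < real (card (A n \<omega>))"
  proof eventually_elim
    case (elim \<omega>)
    then show ?case
    proof eventually_elim
      case (elim n)
      then show ?case by (simp add: not_le)
    qed
  qed
  with kappa that show ?thesis by blast
qed

text \<open>In each step the barrier is broken with conditional probability at least
  \<open>q\<close>, and \<open>1 - q \<le> exp (- q)\<close> turns the product into an exponential
  of a sum. The barrier may move, since the limsup requires one that increases with time.\<close>

lemma survive_prob_le:
  assumes tl: "\<And>t. t \<ge> t0 \<Longrightarrow> ct * t powr (- \<alpha>) \<le> tail \<xi> t" and "ct > 0" "\<kappa> > 0"
  obtains c L0 :: real where "c > 0" "L0 \<ge> 1"
    "\<And>N n L. N \<le> n \<Longrightarrow> (\<And>i. i \<in> {N..n} \<Longrightarrow> L0 \<le> L i) \<Longrightarrow> (\<And>i. i \<in> {N..<n} \<Longrightarrow> L i \<le> L (Suc i)) \<Longrightarrow>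
      prob {\<omega> \<in> space M. \<forall>i\<in>{N..n}. A i \<omega> \<noteq> {} \<and> \<kappa> * real i \<le> real (card (A i \<omega>)) \<and>
          real_of_int (diam (A i \<omega>)) \<le> L i}
        \<le> exp (- (\<Sum>i\<in>{N..<n}. c * real i * L (Suc i) powr (1 - \<alpha>)))"
proof -
  obtain c m0 where c: "c > 0" "m0 > 0" and jp:
    "\<And>m n q E. m \<ge> m0 \<Longrightarrow> q \<ge> 0 \<Longrightarrow> Measurable.pred M E \<Longrightarrow>
       (\<And>\<omega> \<omega>'. \<omega> \<in> space M \<Longrightarrow> \<omega>' \<in> space M \<Longrightarrow> \<forall>i\<le>n. A i \<omega> = A i \<omega>' \<Longrightarrow> E \<omega> \<Longrightarrow> E \<omega>') \<Longrightarrow>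
       (\<And>\<omega>. \<omega> \<in> space M \<Longrightarrow> E \<omega> \<Longrightarrow> A n \<omega> \<noteq> {} \<and>
         (q \<le> c * real_of_int m * real (card (A n \<omega>)) * tail \<xi> (real_of_int (diam (A n \<omega>) + m)) \<or>
          q \<le> c * real_of_int m * tail \<xi> (real_of_int m))) \<Longrightarrow>
       q * prob {\<omega> \<in> space M. E \<omega>} \<le> prob {\<omega> \<in> space M. E \<omega> \<and> jump n m \<omega>}"
    by (rule jump_prob_ge) blast
  define C where "C = c * \<kappa> * ct * 3 powr (- \<alpha>)"
  define L0 where "L0 = max (max 1 (real_of_int m0)) t0"
  have C: "C > 0" using c assms by (simp add: C_def)
  show ?thesis
  proof (rule that[of C L0])
    fix N n and L :: "nat \<Rightarrow> real"
    define E where "E n \<omega> \<longleftrightarrow> (\<forall>i\<in>{N..n}. A i \<omega> \<noteq> {} \<and> \<kappa> * real i \<le> real (card (A i \<omega>)) \<and>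
        real_of_int (diam (A i \<omega>)) \<le> L i)" for n \<omega>
    have [measurable]: "Measurable.pred M (E n)" for n
      unfolding E_def by (intro pred_intros_finite pred_A) auto
    assume "N \<le> n" "\<And>i. i \<in> {N..n} \<Longrightarrow> L0 \<le> L i" "\<And>i. i \<in> {N..<n} \<Longrightarrow> L i \<le> L (Suc i)"
    then have "prob {\<omega> \<in> space M. E n \<omega>} \<le>
        exp (- (\<Sum>i\<in>{N..<n}. C * real i * L (Suc i) powr (1 - \<alpha>)))"
    proof (induction n rule: dec_induct)
      case base
      then show ?case by simp
    next
      case (step n)
      define L' where "L' = L (Suc n)"
      \<comment> \<open>The least integer above \<open>L'\<close>: as the diameter is nonnegative, a
        jump by \<open>m\<close> alone breaks the barrier.\<close>
      define m where "m = \<lfloor>L'\<rfloor> + 1"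
      define q where "q = C * real n * L' powr (1 - \<alpha>)"
      have L': "L0 \<le> L'" "1 \<le> L'" "real_of_int m0 \<le> L'" "t0 \<le> L'"
        using step.prems(1)[of "Suc n"] step.hyps by (auto simp: L'_def L0_def)
      have Ln: "L n \<le> L'" using step.prems(2)[of n] step.hyps by (auto simp: L'_def)
      have m: "L' \<le> real_of_int m" "real_of_int m \<le> L' + 1" "L' < real_of_int m" "m0 \<le> m"
        unfolding m_def using L' by linarith+
      have q0: "q \<ge> 0" using C by (simp add: q_def)
      have jump: "q * prob {\<omega> \<in> space M. E n \<omega>} \<le> prob {\<omega> \<in> space M. E n \<omega> \<and> jump n m \<omega>}"
      proof (rule jp[OF m(4) q0])
        show "E n \<omega>'" if "\<forall>i\<le>n. A i \<omega> = A i \<omega>'" "E n \<omega>" for \<omega> \<omega>'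
          using that by (simp add: E_def)
        fix \<omega> assume w: "\<omega> \<in> space M" "E n \<omega>"
        then have En: "A n \<omega> \<noteq> {}" "\<kappa> * real n \<le> real (card (A n \<omega>))"
            "real_of_int (diam (A n \<omega>)) \<le> L n"
          using step.hyps by (auto simp: E_def)
        \<comment> \<open>The diameter is at most \<open>L'\<close>, \<open>m\<close> is at most
          \<open>L' + 1\<close>, and \<open>1 \<le> L'\<close>; so the required step length is at
          most \<open>3 * L'\<close>, which explains the factor in \<open>C\<close>.\<close>
        have "ct * (3 * L') powr (- \<alpha>) \<le> tail \<xi> (3 * L')"
          using L' by (intro tl) linarith
        also have "\<dots> \<le> tail \<xi> (real_of_int (diam (A n \<omega>) + m))"
          using En(3) Ln m L' by (intro tail_antimono) simp
        finally have t: "ct * (3 * L') powr (- \<alpha>) \<le> tail \<xi> (real_of_int (diam (A n \<omega>) + m))" .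
        have "q = c * L' * (\<kappa> * real n) * (ct * (3 * L') powr (- \<alpha>))"
        proof -
          have "L' powr (1 - \<alpha>) = L' * L' powr (- \<alpha>)"
            using L' by (simp add: powr_diff powr_minus field_simps)
          then show ?thesis using L' by (simp add: q_def C_def powr_mult)
        qed
        also have "\<dots> \<le> c * real_of_int m * real (card (A n \<omega>)) *
            tail \<xi> (real_of_int (diam (A n \<omega>) + m))"
          using c m L' En t assms by (intro mult_mono) auto
        finally show "A n \<omega> \<noteq> {} \<and>
         (q \<le> c * real_of_int m * real (card (A n \<omega>)) * tail \<xi> (real_of_int (diam (A n \<omega>) + m)) \<or>
          q \<le> c * real_of_int m * tail \<xi> (real_of_int m))" using En by blast
      qed measurable
      have "prob {\<omega> \<in> space M. E (Suc n) \<omega>} \<le>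
          prob ({\<omega> \<in> space M. E n \<omega>} - {\<omega> \<in> space M. E n \<omega> \<and> jump n m \<omega>})"
      proof (intro finite_measure_mono subsetI)
        fix \<omega> assume "\<omega> \<in> {\<omega> \<in> space M. E (Suc n) \<omega>}"
        then have w: "\<omega> \<in> space M" "E (Suc n) \<omega>" by auto
        then have En: "E n \<omega>" by (auto simp: E_def)
        have "real_of_int (diam (A (Suc n) \<omega>)) \<le> L'" "A n \<omega> \<noteq> {}"
          using w(2) step.hyps by (auto simp: E_def L'_def)
        moreover have "0 \<le> diam (A n \<omega>)" using calculation(2) finite_A[OF w(1)]
            by (rule diam_nonneg[rotated])
        ultimately have "\<not> jump n m \<omega>" using m(3) unfolding jump_def by linarith
        with w En show "\<omega> \<in> {\<omega> \<in> space M. E n \<omega>} - {\<omega> \<in> space M. E n \<omega> \<and> jump n m \<omega>}" by simp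
      qed measurable
      also have "\<dots> = prob {\<omega> \<in> space M. E n \<omega>} - prob {\<omega> \<in> space M. E n \<omega> \<and> jump n m \<omega>}"
        by (intro finite_measure_Diff) auto
      also have "\<dots> \<le> (1 - q) * prob {\<omega> \<in> space M. E n \<omega>}" using jump by (simp add: algebra_simps)
      also have "\<dots> \<le> exp (- q) * prob {\<omega> \<in> space M. E n \<omega>}"
        using exp_ge_add_one_self[of "- q"] by (intro mult_right_mono) auto
      also have "\<dots> \<le> exp (- q) * exp (- (\<Sum>i\<in>{N..<n}. C * real i * L (Suc i) powr (1 - \<alpha>)))"
        using step.prems step.hyps by (intro mult_left_mono step.IH) auto
      also have "\<dots> = exp (- (\<Sum>i\<in>{N..<Suc n}. C * real i * L (Suc i) powr (1 - \<alpha>)))"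
        using step.hyps by (simp add: exp_add[symmetric] q_def L'_def)
      finally show ?case .
    qed
    then show "prob {\<omega> \<in> space M. \<forall>i\<in>{N..n}. A i \<omega> \<noteq> {} \<and> \<kappa> * real i \<le> real (card (A i \<omega>)) \<and>
        real_of_int (diam (A i \<omega>)) \<le> L i}
        \<le> exp (- (\<Sum>i\<in>{N..<n}. C * real i * L (Suc i) powr (1 - \<alpha>)))"
      by (simp only: E_def)
  qed (use C in \<open>auto simp: L0_def\<close>)
qed

end

section \<open>Growth of the diameter\<close>

lemma summable_exp_neg_of_ge_ln:
  assumes "\<forall>\<^sub>F k in sequentially. 2 * ln (real k) \<le> f k"
  shows "summable (\<lambda>k. exp (- f k))"
proof (rule summable_comparison_test_ev)
  show "\<forall>\<^sub>F k in sequentially. norm (exp (- f k)) \<le> inverse ((real k)\<^sup>2)"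
    using assms eventually_gt_at_top[of 0]
  proof eventually_elim
    case (elim k)
    have "exp (- f k) \<le> exp (- (2 * ln (real k)))" using elim by simp
    also have "exp (2 * ln (real k)) = (real k)\<^sup>2"
      using elim exp_of_nat_mult[of 2 "ln (real k)"] by simp
    then have "exp (- (2 * ln (real k))) = inverse ((real k)\<^sup>2)"
      by (simp add: exp_minus)
    finally show ?case by simp
  qed
  show "summable (\<lambda>k. inverse ((real k)\<^sup>2))"
    using inverse_power_summable[of 2, where ?'a = real] by simp
qed

text \<open>The index is shifted by one because the bound gained during
  \<open>{2 ^ k..2 ^ Suc k}\<close> is used on the following block.\<close>

lemma dyadic_block:
  fixes n :: nat
  assumes "2 ^ Suc k0 \<le> n"
  obtains k where "k \<ge> k0" "2 ^ Suc k \<le> n" "n < 2 ^ (k + 2)"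
proof -
  have "1 \<le> n" using assms by (meson one_le_numeral one_le_power order_trans)
  then obtain j where j: "2 ^ j \<le> n" "n < 2 ^ (j + 1)"
    using ex_power_ivl1[of 2 n] by auto
  have "Suc k0 < j + 1"
  proof (rule ccontr)
    assume "\<not> ?thesis"
    then have "(2::nat) ^ (j + 1) \<le> 2 ^ Suc k0" by (intro power_increasing) auto
    then show False using j assms by linarith
  qed
  then have "j \<ge> Suc k0" by simp
  then show ?thesis using j by (intro that[of "j - 1"]) (auto simp: Suc_diff_le)
qed

context dla
begin

text \<open>With the constant barrier \<open>L k\<close>, the block has \<open>2 ^ k\<close> steps
  whose jump chances are at least of order \<open>2 ^ k * L k powr (1 - \<alpha>)\<close>, whence
  \<open>4 ^ k\<close>. A barrier broken inside the block stays broken by monotonicity of the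
  diameter.\<close>

lemma window_growth:
  fixes L :: "nat \<Rightarrow> real"
  assumes tl: "\<And>t. t \<ge> t0 \<Longrightarrow> ct * t powr (- \<alpha>) \<le> tail \<xi> t" and ct: "ct > 0"
    and tail_pos: "\<And>t. 0 < tail \<xi> t"
    and L: "filterlim L at_top sequentially"
    and sum: "\<And>C. C > 0 \<Longrightarrow> summable (\<lambda>k. exp (- (C * 4 ^ k * L k powr (1 - \<alpha>))))"
  shows "AE \<omega> in M. \<forall>\<^sub>F k in sequentially. \<forall>n\<ge>2 ^ Suc k. L k < real_of_int (diam (A n \<omega>))"
proof -
  obtain \<kappa> :: real where k: "\<kappa> > 0" and card:
      "AE \<omega> in M. \<forall>\<^sub>F n in sequentially. \<kappa> * real n < real (card (A n \<omega>))"
    using card_linear_growth[OF tail_pos] by blast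
  obtain c L0 :: real where c: "c > 0" "L0 \<ge> 1" and surv:
    "\<And>N n L. N \<le> n \<Longrightarrow> (\<And>i. i \<in> {N..n} \<Longrightarrow> L0 \<le> L i) \<Longrightarrow> (\<And>i. i \<in> {N..<n} \<Longrightarrow> L i \<le> L (Suc i)) \<Longrightarrow>
      prob {\<omega> \<in> space M. \<forall>i\<in>{N..n}. A i \<omega> \<noteq> {} \<and> \<kappa> * real i \<le> real (card (A i \<omega>)) \<and>
          real_of_int (diam (A i \<omega>)) \<le> L i}
        \<le> exp (- (\<Sum>i\<in>{N..<n}. c * real i * L (Suc i) powr (1 - \<alpha>)))"
    by (rule survive_prob_le[OF tl ct k]) blast+
  \<comment> \<open>The cardinality bound belongs to the event because it holds only from a random
    time on; it is removed pathwise after the Borel-Cantelli argument.\<close>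
  define B where "B k = {\<omega> \<in> space M. \<forall>i\<in>{2 ^ k..2 ^ Suc k}. A i \<omega> \<noteq> {} \<and> \<kappa> * real i \<le>
      real (card (A i \<omega>)) \<and>
     real_of_int (diam (A i \<omega>)) \<le> L k}" for k
  have Bs: "B k \<in> sets M" for k
    unfolding B_def by (rule predE, intro pred_intros_finite pred_A) auto
  have "\<forall>\<^sub>F k in sequentially. L0 \<le> L k"
    using L by (simp add: filterlim_at_top)
  then have "\<forall>\<^sub>F k in sequentially. norm (prob (B k)) \<le> exp (- (c * 4 ^ k * L k powr (1 - \<alpha>)))"
  proof eventually_elim
    case (elim k)
    have "prob (B k) \<le> exp (- (\<Sum>i\<in>{2 ^ k..<2 ^ Suc k}. c * real i * L k powr (1 - \<alpha>)))"
      unfolding B_def by (rule surv[of "2 ^ k" "2 ^ Suc k" "\<lambda>_. L k"]) (use elim in auto)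
    also have "\<dots> \<le> exp (- (\<Sum>i\<in>{2 ^ k..<(2::nat) ^ Suc k}. c * 2 ^ k * L k powr (1 - \<alpha>)))"
      unfolding exp_le_cancel_iff neg_le_iff_le
    proof (rule sum_mono)
      fix i assume "i \<in> {2 ^ k..<(2::nat) ^ Suc k}"
      then have "real (2 ^ k) \<le> real i" by (simp only: of_nat_le_iff atLeastLessThan_iff)
      then show "c * 2 ^ k * L k powr (1 - \<alpha>) \<le> c * real i * L k powr (1 - \<alpha>)"
        using c by (intro mult_right_mono mult_left_mono) auto
    qed
    also have "(\<Sum>i\<in>{2 ^ k..<(2::nat) ^ Suc k}. c * 2 ^ k * L k powr (1 - \<alpha>)) =
        2 ^ k * (c * 2 ^ k * L k powr (1 - \<alpha>))" by simp
    also have "\<dots> = c * (2 ^ k * 2 ^ k) * L k powr (1 - \<alpha>)" by (simp only: ac_simps)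
    also have "(2 ^ k * 2 ^ k :: real) = 4 ^ k" by (simp add: power_mult_distrib[symmetric])
    finally show ?case by simp
  qed
  then have "summable (\<lambda>k. prob (B k))"
    using sum[OF c(1)] by (rule summable_comparison_test_ev)
  then have "AE \<omega> in M. \<forall>\<^sub>F k in sequentially. \<omega> \<in> space M - B k"
    using Bs by (intro borel_cantelli_AE1) (auto simp: emeasure_eq_measure)
  with AE_incseq card AE_space show ?thesis
  proof eventually_elim
    case (elim \<omega>)
    obtain n0 where n0: "\<And>n. n \<ge> n0 \<Longrightarrow> \<kappa> * real n < real (card (A n \<omega>))"
      using elim(2) by (auto simp: eventually_sequentially)
    show ?case
      using elim(4) eventually_ge_at_top[of n0]
    proof eventually_elim
      case (elim k)
      have "n0 \<le> i" if "i \<in> {2 ^ k..2 ^ Suc k}" for i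
      proof -
        have "n0 \<le> k" using elim by simp
        also have "k < 2 ^ k" by (rule less_exp)
        also have "\<dots> \<le> i" using that by simp
        finally show ?thesis by simp
      qed
      moreover have "A i \<omega> \<noteq> {}" for i using \<open>incseq (\<lambda>n. A n \<omega>) \<and> (\<forall>n. A n \<omega> \<noteq> {})\<close> by blast
      moreover have "\<not> (\<forall>i\<in>{2 ^ k..2 ^ Suc k}. A i \<omega> \<noteq> {} \<and> \<kappa> * real i \<le> real (card (A i \<omega>)) \<and>
         real_of_int (diam (A i \<omega>)) \<le> L k)"
        using elim(1) by (simp add: B_def)
      ultimately obtain i where i: "i \<in> {2 ^ k..2 ^ Suc k}" "L k < real_of_int (diam (A i \<omega>))"
        using n0 by (meson less_imp_le not_le)
      show ?case
      proof (intro allI impI)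
        fix n :: nat assume "n \<ge> 2 ^ Suc k"
        with i have "A i \<omega> \<subseteq> A n \<omega>" using \<open>incseq (\<lambda>n. A n \<omega>) \<and> _\<close> by (auto simp: incseq_def)
        then have "diam (A i \<omega>) \<le> diam (A n \<omega>)"
          using \<open>A i \<omega> \<noteq> {}\<close> finite_A[OF \<open>\<omega> \<in> space M\<close>] by (intro diam_mono)
        with i(2) show "L k < real_of_int (diam (A n \<omega>))" by linarith
      qed
    qed
  qed
qed

lemma tail_pos_of_power_lower_bound:
  assumes "\<And>t. t \<ge> t0 \<Longrightarrow> ct * t powr (- \<alpha>) \<le> tail \<xi> t" "ct > 0"
  shows "0 < tail \<xi> t"
proof -
  have "0 < ct * (max (max t t0) 1) powr (- \<alpha>)" using assms(2) by simp
  also have "\<dots> \<le> tail \<xi> (max (max t t0) 1)" by (rule assms(1)) simp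
  also have "\<dots> \<le> tail \<xi> t" by (rule tail_antimono) simp
  finally show ?thesis .
qed

lemma diam_ge_of_dyadic:
  assumes "AE \<omega> in M. \<forall>\<^sub>F k in sequentially. \<forall>n\<ge>2 ^ Suc k. L k < real_of_int (diam (A n \<omega>))"
    and le: "\<forall>\<^sub>F k in sequentially. \<forall>n. 2 ^ Suc k \<le> n \<longrightarrow> n < 2 ^ (k + 2) \<longrightarrow> g n \<le> L k"
  shows "AE \<omega> in M. \<forall>\<^sub>F n in sequentially. g n \<le> real_of_int (diam (A n \<omega>))"
  using assms(1)
proof eventually_elim
  case (elim \<omega>)
  with le have "\<forall>\<^sub>F k in sequentially. \<forall>n. 2 ^ Suc k \<le> n \<longrightarrow> n < 2 ^ (k + 2) \<longrightarrow>
      g n \<le> real_of_int (diam (A n \<omega>))"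
    by eventually_elim (meson less_imp_le order_trans)
  then obtain k0 where k0: "\<And>k n. k \<ge> k0 \<Longrightarrow> 2 ^ Suc k \<le> n \<Longrightarrow> n < 2 ^ (k + 2) \<Longrightarrow>
      g n \<le> real_of_int (diam (A n \<omega>))"
    unfolding eventually_sequentially by blast
  have "g n \<le> real_of_int (diam (A n \<omega>))" if "n \<ge> 2 ^ Suc k0" for n
    using dyadic_block[OF that] k0 by metis
  then show ?case by (auto simp: eventually_sequentially)
qed

text \<open>As \<open>\<beta> * (1 - \<alpha>) = - 2\<close>, the power of 2 in \<open>L k\<close>
  cancels \<open>4 ^ k\<close> up to 1/16. What is left is the power \<open>\<alpha> - 1 > 1\<close>
  of a quantity asymptotic to \<open>ln k\<close>, and this exceeds \<open>2 * ln k\<close>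
  eventually, however small \<open>C\<close> is.\<close>

lemma diam_ge_loglog:
  assumes tl: "\<And>t. t \<ge> 1 \<Longrightarrow> ct * t powr (- \<alpha>) \<le> tail \<xi> t" and ct: "ct > 0"
    and \<alpha>: "2 < \<alpha>" and \<beta>: "\<beta> = 2 / (\<alpha> - 1)"
  shows "AE \<omega> in M. \<forall>\<^sub>F n in sequentially. real n powr \<beta> / ln (ln (real n)) \<le>
      real_of_int (diam (A n \<omega>))"
proof -
  \<comment> \<open>The numerator is taken at the right end of the following block and the
    denominator at its left end, so \<open>L k\<close> dominates the target on all of that
    block.\<close>
  define L where "L k = (2 ^ (k + 2)) powr \<beta> / ln (ln (2 ^ Suc k))" for k :: nat
  have b: "\<beta> > 0" using \<alpha> \<beta> by simp
  have ev: "\<forall>\<^sub>F k in sequentially. 0 < ln (ln (2 ^ Suc k :: real))" by real_asymp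
  show ?thesis
  proof (rule diam_ge_of_dyadic[where L = L])
    show "AE \<omega> in M. \<forall>\<^sub>F k in sequentially. \<forall>n\<ge>2 ^ Suc k. L k < real_of_int (diam (A n \<omega>))"
    proof (rule window_growth[OF tl ct])
      show "0 < tail \<xi> t" for t by (rule tail_pos_of_power_lower_bound[OF tl ct])
      show "filterlim L at_top sequentially" unfolding L_def using b by real_asymp
      fix C :: real assume C: "C > 0"
      have eq: "\<forall>\<^sub>F k in sequentially. C * 4 ^ k * L k powr (1 - \<alpha>) =
          C / 16 * ln (ln (2 ^ Suc k)) powr (\<alpha> - 1)"
        using ev
      proof eventually_elim
        case (elim k)
        have "\<beta> * (1 - \<alpha>) = - 2" using \<alpha> unfolding \<beta> by (simp add: field_simps)
        then have "L k powr (1 - \<alpha>) = (2 ^ (k + 2)) powr (- 2) / ln (ln (2 ^ Suc k)) powr (1 - \<alpha>)"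
          using elim unfolding L_def by (subst powr_divide) (auto simp: powr_powr)
        also have "ln (ln (2 ^ Suc k :: real)) powr (1 - \<alpha>) =
            inverse (ln (ln (2 ^ Suc k)) powr (\<alpha> - 1))"
          by (subst powr_minus[symmetric]) simp
        also have "(2 ^ (k + 2) :: real) powr (- 2) = inverse (16 * 4 ^ k)"
        proof -
          have "(2 ^ (k + 2) :: real) powr (- 2) = inverse ((2 ^ (k + 2)) powr 2)"
              by (rule powr_minus)
          also have "(2 ^ (k + 2) :: real) powr 2 = (2 ^ (k + 2))\<^sup>2" by (simp add: powr_numeral)
          also have "\<dots> = 16 * 4 ^ k"
              by (simp add: power_add power2_eq_square power_mult_distrib[symmetric])
          finally show ?thesis .
        qed
        finally show ?case by (simp add: field_simps)
      qed
      have "\<forall>\<^sub>F k in sequentially. 2 * ln (real k) \<le> C / 16 * ln (ln (2 ^ Suc k)) powr (\<alpha> - 1)"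
        using C \<alpha> by real_asymp
      with eq have "\<forall>\<^sub>F k in sequentially. 2 * ln (real k) \<le> C * 4 ^ k * L k powr (1 - \<alpha>)"
        by eventually_elim (simp only:)
      then show "summable (\<lambda>k. exp (- (C * 4 ^ k * L k powr (1 - \<alpha>))))"
        by (rule summable_exp_neg_of_ge_ln)
    qed
    show "\<forall>\<^sub>F k in sequentially. \<forall>n. 2 ^ Suc k \<le> n \<longrightarrow> n < 2 ^ (k + 2) \<longrightarrow>
        real n powr \<beta> / ln (ln (real n)) \<le> L k"
      using ev
    proof eventually_elim
      case (elim k)
      show ?case
      proof (intro allI impI)
        fix n :: nat assume n: "2 ^ Suc k \<le> n" "n < 2 ^ (k + 2)"
        have n1: "2 ^ Suc k \<le> real n" "real n \<le> 2 ^ (k + 2)"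
          using n by (metis of_nat_le_iff of_nat_numeral of_nat_power,
              metis less_imp_le of_nat_le_iff of_nat_numeral of_nat_power)
        have l1: "0 < ln (2 ^ Suc k :: real)"
            by (intro ln_gt_zero) (simp del: power_Suc add: one_less_power)
        have "0 < real n" by (rule less_le_trans[OF _ n1(1)]) simp
        then have l2: "ln (2 ^ Suc k) \<le> ln (real n)" using n1 by (subst ln_le_cancel_iff) auto
        have "ln (ln (2 ^ Suc k)) \<le> ln (ln (real n))"
          using l2 by (subst ln_le_cancel_iff[OF l1 less_le_trans[OF l1 l2]])
        moreover have "real n powr \<beta> \<le> (2 ^ (k + 2)) powr \<beta>" using n1 b by (intro powr_mono2) auto
        ultimately show "real n powr \<beta> / ln (ln (real n)) \<le> L k"
          unfolding L_def using elim by (intro frac_le) auto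
      qed
    qed
  qed
qed

text \<open>Below the critical exponent the block sum grows geometrically, like
  \<open>2 powr (\<delta> * k)\<close>, so no logarithmic correction is involved.\<close>

lemma diam_ge_power:
  assumes tl: "\<And>t. t \<ge> t0 \<Longrightarrow> ct * t powr (- \<alpha>) \<le> tail \<xi> t" and ct: "ct > 0"
    and \<alpha>: "1 < \<alpha>" and b: "b > 0" "b * (\<alpha> - 1) < 2"
  shows "AE \<omega> in M. \<forall>\<^sub>F n in sequentially. real n powr b \<le> real_of_int (diam (A n \<omega>))"
proof -
  define L where "L k = (2 ^ (k + 2)) powr b" for k :: nat
  show ?thesis
  proof (rule diam_ge_of_dyadic[where L = L])
    show "AE \<omega> in M. \<forall>\<^sub>F k in sequentially. \<forall>n\<ge>2 ^ Suc k. L k < real_of_int (diam (A n \<omega>))"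
    proof (rule window_growth[OF tl ct])
      show "0 < tail \<xi> t" for t by (rule tail_pos_of_power_lower_bound[OF tl ct])
      show "filterlim L at_top sequentially" unfolding L_def using b by real_asymp
      fix C :: real assume C: "C > 0"
      define \<delta> where "\<delta> = 2 - b * (\<alpha> - 1)"
      have d: "\<delta> > 0" using b by (simp add: \<delta>_def)
      define C' where "C' = C * 2 powr (2 * (b * (1 - \<alpha>)))"
      have C': "C' > 0" using C by (simp add: C'_def)
      have eq: "C * 4 ^ k * L k powr (1 - \<alpha>) = C' * 2 powr (\<delta> * real k)" for k
      proof -
        have "(4::real) ^ k = 2 powr (2 * real k)"
          by (simp add: powr_realpow[symmetric] powr_powr[symmetric])
        moreover have "L k powr (1 - \<alpha>) = 2 powr ((real k + 2) * (b * (1 - \<alpha>)))"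
        proof -
          have "(2::real) ^ (k + 2) = 2 powr (real k + 2)"
            by (simp add: powr_add powr_realpow power_add)
          then show ?thesis by (simp only: L_def powr_powr mult.assoc)
        qed
        moreover have "2 * real k + (real k + 2) * (b * (1 - \<alpha>)) = 2 * (b * (1 - \<alpha>)) + \<delta> * real k"
          by (simp add: \<delta>_def algebra_simps)
        ultimately show ?thesis
          by (simp only: C'_def mult.assoc powr_add[symmetric])
      qed
      have "\<forall>\<^sub>F k in sequentially. 2 * ln (real k) \<le> C' * 2 powr (\<delta> * real k)"
        using C' d by real_asymp
      then show "summable (\<lambda>k. exp (- (C * 4 ^ k * L k powr (1 - \<alpha>))))"
        unfolding eq by (rule summable_exp_neg_of_ge_ln)
    qed
    have "real n powr b \<le> L k" if "n < 2 ^ (k + 2)" for n k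
    proof -
      have "real n \<le> 2 ^ (k + 2)" using that
          by (metis less_imp_le of_nat_le_iff of_nat_numeral of_nat_power)
      then show ?thesis unfolding L_def using b by (intro powr_mono2) auto
    qed
    then show "\<forall>\<^sub>F k in sequentially. \<forall>n. 2 ^ Suc k \<le> n \<longrightarrow> n < 2 ^ (k + 2) \<longrightarrow> real n powr b \<le> L k"
      by simp
  qed
qed

text \<open>At this scale a dyadic block contributes only a bounded amount, so one moving barrier is
  followed over all times from \<open>N\<close> to \<open>n\<close>, and the divergence of the
  harmonic series does the rest.\<close>

lemma limsup_diam:
  assumes tl: "\<And>t. t \<ge> 1 \<Longrightarrow> ct * t powr (- \<alpha>) \<le> tail \<xi> t" and ct: "ct > 0"
    and \<alpha>: "2 < \<alpha>" and \<beta>: "\<beta> = 2 / (\<alpha> - 1)"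
  shows "AE \<omega> in M. limsup (\<lambda>n. ereal (real n powr (- \<beta>) * real_of_int (diam (A n \<omega>)))) = \<infinity>"
proof -
  have b: "\<beta> > 0" using \<alpha> \<beta> by simp
  have b2: "\<beta> * (1 - \<alpha>) = - 2" using \<alpha> unfolding \<beta> by (simp add: field_simps)
  obtain \<kappa> :: real where k: "\<kappa> > 0" and card:
      "AE \<omega> in M. \<forall>\<^sub>F n in sequentially. \<kappa> * real n < real (card (A n \<omega>))"
    using card_linear_growth[OF tail_pos_of_power_lower_bound[where ?t0.0 = 1, OF tl ct]] by blast
  obtain c L0 :: real where c: "c > 0" "L0 \<ge> 1" and surv:
    "\<And>N n L. N \<le> n \<Longrightarrow> (\<And>i. i \<in> {N..n} \<Longrightarrow> L0 \<le> L i) \<Longrightarrow> (\<And>i. i \<in> {N..<n} \<Longrightarrow> L i \<le> L (Suc i)) \<Longrightarrow>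
      prob {\<omega> \<in> space M. \<forall>i\<in>{N..n}. A i \<omega> \<noteq> {} \<and> \<kappa> * real i \<le> real (card (A i \<omega>)) \<and>
          real_of_int (diam (A i \<omega>)) \<le> L i}
        \<le> exp (- (\<Sum>i\<in>{N..<n}. c * real i * L (Suc i) powr (1 - \<alpha>)))"
    by (rule survive_prob_le[OF tl ct k]) blast+
  define Q where "Q K i \<omega> \<longleftrightarrow> A i \<omega> \<noteq> {} \<and> \<kappa> * real i \<le> real (card (A i \<omega>)) \<and>
    real_of_int (diam (A i \<omega>)) \<le> real K * real i powr \<beta>" for K i \<omega>
  have Q_pred [measurable]: "Measurable.pred M (Q K i)" for K i
    unfolding Q_def by (rule pred_A)
  have main: "AE \<omega> in M. \<not> (\<forall>i\<ge>N. Q K i \<omega>)" if K: "K \<ge> 1" and N: "N \<ge> 1"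
      "L0 \<le> real K * real N powr \<beta>" for K N :: nat
  proof -
    let ?E = "{\<omega> \<in> space M. \<forall>i\<ge>N. Q K i \<omega>}"
    \<comment> \<open>The division by 2 pays for \<open>i \<ge> (i + 1) / 2\<close>, valid for
      \<open>i \<ge> 1\<close>, which turns the terms into multiples of
      \<open>1 / (i + 1)\<close>.\<close>
    define c' where "c' = c * real K powr (1 - \<alpha>) / 2"
    have c': "c' > 0" using c K by (simp add: c'_def)
    have le: "prob ?E \<le> exp (- (c' * (harm n - harm N)))" if n: "n \<ge> N" for n
    proof -
      have mono: "real K * real i powr \<beta> \<le> real K * real j powr \<beta>" if "i \<le> j" for i j
        using that b by (intro mult_left_mono powr_mono2) auto
      have "prob ?E \<le> prob {\<omega> \<in> space M. \<forall>i\<in>{N..n}. Q K i \<omega>}"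
        by (intro finite_measure_mono) auto
      also have "\<dots> \<le> exp (- (\<Sum>i\<in>{N..<n}. c * real i * (real K * real (Suc i) powr \<beta>) powr (1 - \<alpha>)))"
        unfolding Q_def
      proof (rule surv[OF n])
        show "L0 \<le> real K * real i powr \<beta>" if "i \<in> {N..n}" for i
          using order_trans[OF N(2) mono[of N i]] that by simp
        show "real K * real i powr \<beta> \<le> real K * real (Suc i) powr \<beta>" for i
          by (rule mono) simp
      qed
      also have "\<dots> \<le> exp (- (\<Sum>i\<in>{N..<n}. c' / real (Suc i)))"
        unfolding exp_le_cancel_iff neg_le_iff_le
      proof (rule sum_mono)
        fix i assume i: "i \<in> {N..<n}"
        have "(real K * real (Suc i) powr \<beta>) powr (1 - \<alpha>) =
            real K powr (1 - \<alpha>) * real (Suc i) powr (- 2)"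
          using K by (simp add: powr_mult powr_powr b2)
        also have "real (Suc i) powr (- 2) = inverse ((real (Suc i))\<^sup>2)"
          by (simp add: powr_minus powr_numeral)
        finally have "c * real i * (real K * real (Suc i) powr \<beta>) powr (1 - \<alpha>) =
           c' * (2 * real i / (real (Suc i))\<^sup>2)"
          by (simp add: c'_def field_simps)
        moreover have "1 / real (Suc i) = real (Suc i) / (real (Suc i))\<^sup>2"
          by (simp add: power2_eq_square del: of_nat_Suc)
        then have "1 / real (Suc i) \<le> 2 * real i / (real (Suc i))\<^sup>2"
          using i N(1) by (simp only:) (intro divide_right_mono, auto)
        then have "c' * (1 / real (Suc i)) \<le> c' * (2 * real i / (real (Suc i))\<^sup>2)"
          using c' by (intro mult_left_mono) auto
        ultimately show "c' / real (Suc i) \<le>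
            c * real i * (real K * real (Suc i) powr \<beta>) powr (1 - \<alpha>)" by simp
      qed
      also have "(\<Sum>i\<in>{N..<n}. c' / real (Suc i)) = c' * (harm n - harm N)"
        using n by (induction n rule: dec_induct) (simp_all add: harm_Suc algebra_simps
            divide_inverse)
      finally show ?thesis .
    qed
    have "((\<lambda>n. exp (- (c' * (harm n - harm N)))) \<longlonglongrightarrow> 0)"
    proof -
      have "filterlim (\<lambda>n. c' * (- harm N + harm n)) at_top sequentially"
        using c' harm_at_top
        by (intro filterlim_tendsto_pos_mult_at_top[OF tendsto_const]
            filterlim_tendsto_add_at_top[OF tendsto_const]) auto
      then have "filterlim (\<lambda>n. c' * (harm n - harm N)) at_top sequentially" by simp
      then have "filterlim (\<lambda>n. - (c' * (harm n - harm N))) at_bot sequentially"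
        by (simp add: filterlim_uminus_at_bot)
      then show ?thesis by (rule filterlim_compose[OF exp_at_bot])
    qed
    then have "prob ?E \<le> 0"
      by (rule tendsto_lowerbound) (use le in \<open>auto simp: eventually_sequentially intro!:
          exI[of _ N]\<close>)
    then have "prob ?E = 0" by (simp add: measure_le_0_iff)
    then show ?thesis by (subst (asm) prob_eq_0) (auto elim!: AE_mp)
  qed
  have escape: "AE \<omega> in M. \<forall>N. \<not> (\<forall>i\<ge>N. Q K i \<omega>)" if K: "K \<ge> 1" for K
  proof -
    have "\<forall>\<^sub>F n in sequentially. L0 \<le> real K * real n powr \<beta>"
    proof -
      have "filterlim (\<lambda>n. real K * real n powr \<beta>) at_top sequentially"
        using K b by real_asymp
      then show ?thesis by (simp add: filterlim_at_top)
    qed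
    then obtain N0 where N0: "\<And>n. n \<ge> N0 \<Longrightarrow> L0 \<le> real K * real n powr \<beta>"
      by (auto simp: eventually_sequentially)
    \<comment> \<open>The survival bound starts at a threshold. Remaining below the barrier from
      \<open>N\<close> on implies the same from any later time, so enlarging \<open>N\<close> is
      harmless.\<close>
    have "AE \<omega> in M. \<forall>N. \<not> (\<forall>i\<ge>max N (max N0 1). Q K i \<omega>)"
      unfolding AE_all_countable by (intro allI main K N0) auto
    then show ?thesis by eventually_elim (meson max.boundedE)
  qed
  have "AE \<omega> in M. \<forall>K. \<forall>N. \<not> (\<forall>i\<ge>N. Q (Suc K) i \<omega>)"
    by (rule AE_all_countable[THEN iffD2], rule allI, rule escape) simp
  with card AE_incseq show ?thesis
  proof eventually_elim
    case (elim \<omega>)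
    let ?f = "\<lambda>n. ereal (real n powr (- \<beta>) * real_of_int (diam (A n \<omega>)))"
    obtain n0 where n0: "\<And>n. n \<ge> n0 \<Longrightarrow> \<kappa> * real n < real (card (A n \<omega>))"
      using elim(1) by (auto simp: eventually_sequentially)
    have le: "ereal (real (Suc K)) \<le> limsup ?f" for K
    proof (rule ccontr)
      assume "\<not> ?thesis"
      then have "limsup ?f < ereal (real (Suc K))" by simp
      then have "\<forall>\<^sub>F n in sequentially. ?f n < ereal (real (Suc K))" by (rule Limsup_lessD)
      then obtain n1 where n1: "\<And>n. n \<ge> n1 \<Longrightarrow> ?f n < ereal (real (Suc K))"
        unfolding eventually_sequentially by blast
      have "Q (Suc K) i \<omega>" if "i \<ge> max (max n0 n1) 1" for i
      proof -
        have "real i powr (- \<beta>) * real_of_int (diam (A i \<omega>)) < real (Suc K)"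
          using n1[of i] that by (simp del: of_nat_Suc)
        then have "real_of_int (diam (A i \<omega>)) < real (Suc K) * real i powr \<beta>"
          using that by (simp add: powr_minus field_simps del: of_nat_Suc)
        then show ?thesis using n0[of i] that elim(2) by (simp add: Q_def)
      qed
      then show False using elim(3) by blast
    qed
    have "limsup ?f \<noteq> ereal r" for r
    proof
      assume "limsup ?f = ereal r"
      moreover obtain K where "r < real K" using reals_Archimedean2 by blast
      ultimately show False using le[of K] by simp
    qed
    moreover have "limsup ?f \<noteq> - \<infinity>" using le[of 0] by auto
    ultimately show ?case by (cases "limsup ?f") auto
  qed
qed

lemma growth_at_least_diam:
  assumes tail: "tail_at_least \<xi> \<alpha>" and \<alpha>: "2 < \<alpha>" and \<beta>: "\<beta> = 2 / (\<alpha> - 1)"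
  shows "AE \<omega> in M. growth_at_least (\<lambda>n. real_of_int (diam (A n \<omega>))) \<beta>"
proof -
  have b: "\<beta> > 0" using \<alpha> \<beta> by simp
  have pow: "\<exists>t0. \<forall>t\<ge>t0. 1 * t powr (- a) \<le> tail \<xi> t" if "a > \<alpha>" for a
  proof -
    have "ereal (- a) < Liminf at_top (\<lambda>t. elog (tail \<xi> t) / ereal (ln t))"
      using tail that unfolding tail_at_least_def
          by (meson ereal_less(2) less_ereal.simps(1) less_le_trans neg_less_iff_less)
    then have "\<forall>\<^sub>F t in at_top. ereal (- a) < elog (tail \<xi> t) / ereal (ln t)" by (rule less_LiminfD)
    then have "\<forall>\<^sub>F t in at_top. 1 * t powr (- a) \<le> tail \<xi> t"
      using eventually_gt_at_top[of 1]
    proof eventually_elim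
      case (elim t)
      \<comment> \<open>Since \<open>elog 0\<close> is \<open>-\<infinity>\<close>, a vanishing tail
        would make the quotient \<open>-\<infinity>\<close>, against the strict lower bound.\<close>
      have nz: "tail \<xi> t \<noteq> 0"
      proof
        assume "tail \<xi> t = 0"
        with elim show False by (simp add: elog_def)
      qed
      then have pos: "tail \<xi> t > 0" by (simp add: tail_def zero_less_measure_iff)
      have "- a < ln (tail \<xi> t) / ln t" using elim nz by (simp add: elog_def)
      then have "- a * ln t \<le> ln (tail \<xi> t)" using elim by (simp add: field_simps)
      then have "exp (- a * ln t) \<le> tail \<xi> t" using pos by (metis exp_le_cancel_iff exp_ln)
      then show ?case using elim by (simp add: powr_def)
    qed
    then show ?thesis by (simp add: eventually_at_top_linorder)
  qed
  have ae: "AE \<omega> in M. \<forall>\<^sub>F n in sequentially. real n powr b \<le> real_of_int (diam (A n \<omega>))"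
      if "0 < b" "b < \<beta>" for b
  proof -
    have "\<alpha> = 1 + 2 / \<beta>" using \<alpha> by (simp add: \<beta> field_simps)
    then have less: "\<alpha> < 1 + 2 / b" using that by (simp add: frac_less2)
    \<comment> \<open>The critical tail exponent for growth \<open>b\<close> is
      \<open>1 + 2 / b\<close>, which exceeds \<open>\<alpha>\<close> for
      \<open>b < \<beta>\<close>. The midpoint leaves room on both sides: the tail bound holds with
      exponent \<open>a\<close>, and \<open>b\<close> is subcritical for \<open>a\<close>.\<close>
    define a where "a = (\<alpha> + (1 + 2 / b)) / 2"
    have a: "\<alpha> < a" "a < 1 + 2 / b" using less by (auto simp: a_def)
    obtain t0 where t0: "\<And>t. t \<ge> t0 \<Longrightarrow> 1 * t powr (- a) \<le> tail \<xi> t" using pow[OF a(1)] by blast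
    have "b * (a - 1) < 2" using a(2) that by (simp add: field_simps)
    then show ?thesis
      using diam_ge_power[of t0 1 a b, OF t0] a(1) \<alpha> that by simp
  qed
  \<comment> \<open>Countably many exponents increasing to \<open>\<beta>\<close> share one null
    set; \<open>j + 2\<close> keeps all of them positive.\<close>
  have "AE \<omega> in M. \<forall>j. \<forall>\<^sub>F n in sequentially. real n powr (\<beta> * (1 - 1 / real (j + 2))) \<le>
      real_of_int (diam (A n \<omega>))"
    by (rule AE_all_countable[THEN iffD2], rule allI, rule ae) (use b in \<open>simp_all add: field_simps
        add_pos_nonneg\<close>)
  then show ?thesis
  proof eventually_elim
    case (elim \<omega>)
    let ?l = "liminf (\<lambda>n. elog (real_of_int (diam (A n \<omega>))) / ereal (ln (real n)))"
    have le: "ereal (\<beta> * (1 - 1 / real (j + 2))) \<le> ?l" for j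
    proof (rule Liminf_bounded)
      let ?b = "\<beta> * (1 - 1 / real (j + 2))"
      have "\<forall>\<^sub>F n in sequentially. real n powr ?b \<le> real_of_int (diam (A n \<omega>))" using elim by blast
      then show "\<forall>\<^sub>F n in sequentially. ereal ?b \<le>
          elog (real_of_int (diam (A n \<omega>))) / ereal (ln (real n))"
        using eventually_gt_at_top[of 1]
      proof eventually_elim
        case (elim n)
        have pos: "0 < real n powr ?b" using elim by simp
        then have d: "real_of_int (diam (A n \<omega>)) > 0" using elim by linarith
        have "?b * ln (real n) = ln (real n powr ?b)" using elim by (simp add: ln_powr)
        also have "\<dots> \<le> ln (real_of_int (diam (A n \<omega>)))" using elim pos d
            by (subst ln_le_cancel_iff) auto
        finally have "?b \<le> ln (real_of_int (diam (A n \<omega>))) / ln (real n)"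
          using elim by (simp add: pos_le_divide_eq)
        then show ?case using d elim by (simp add: elog_def)
      qed
    qed
    have "(\<lambda>j. \<beta> * (1 - 1 / real (j + 2))) \<longlonglongrightarrow> \<beta>" by real_asymp
    then have "(\<lambda>j. ereal (\<beta> * (1 - 1 / real (j + 2)))) \<longlonglongrightarrow> ereal \<beta>" by simp
    then have "ereal \<beta> \<le> ?l" by (rule LIMSEQ_le_const2) (use le in blast)
    then show ?case by (simp add: growth_at_least_def)
  qed
qed

end

theorem theorem5p1:
  fixes \<xi> :: "int pmf" and M :: "'w measure" and A :: "nat \<Rightarrow> 'w \<Rightarrow> int set"
    and \<alpha> \<beta> :: real and D :: "nat \<Rightarrow> 'w \<Rightarrow> real"
  assumes "aperiodic_walk \<xi>"
    and "integrable (measure_pmf \<xi>) (\<lambda>k. \<bar>real_of_int k\<bar>\<^sup>2)"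
    and "measure_pmf.expectation \<xi> (\<lambda>k. real_of_int k) = 0"
    and "DLA_process \<xi> M A"
    and "\<And>n \<omega>. D n \<omega> = real_of_int (diam (A n \<omega>))"
    and "2 < \<alpha>" and "\<alpha> \<le> 3"
    and "\<beta> = 2 / (\<alpha> - 1)"
  shows "((\<exists>c>0. \<forall>t\<ge>1. tail \<xi> t \<ge> c * t powr (- \<alpha>)) \<longrightarrow>
           (AE \<omega> in M. limsup (\<lambda>n. ereal (real n powr (- \<beta>) * D n \<omega>)) = \<infinity>) \<and>
           (AE \<omega> in M. \<forall>\<^sub>F n in sequentially. D n \<omega> \<ge> real n powr \<beta> / ln (ln (real n)))) \<and>
         (\<alpha> < 3 \<and> tail_at_least \<xi> \<alpha> \<longrightarrow> (AE \<omega> in M. growth_at_least (\<lambda>n. D n \<omega>) \<beta>))"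
proof -
  interpret centred_walk \<xi>
    by unfold_locales (use assms aperiodic_walk_imp_irreducible_steps in auto)
  interpret prob_space M using assms(4) by (simp add: DLA_process_def)
  interpret dla \<xi> M A by unfold_locales fact
  show ?thesis
    unfolding assms(5)
    using limsup_diam[OF _ _ assms(6,8)] diam_ge_loglog[OF _ _ assms(6,8)]
      growth_at_least_diam[OF _ assms(6,8)]
    by blast
qed

end
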